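(* Let $\Omega\subset\mathbb R^n$ be open and let $\omega:\Omega\to\mathbb R^n$ be of class $C^1$. Consider the integrable system $\dot I=0$, $\dot\theta=\omega(I)$ on $\Omega\times\mathbb T^n$, with flow $\Psi_t(I,\theta)=(I,\theta+t\omega(I))$. Let the initial density satisfy $f_0\in C^1_c(\Omega\times\mathbb T^n)$, $f_0\ge0$, and let the observable be $G\in C(\Omega\times\mathbb T^n)$. Let $G_k(I)$, $f_{0,k}(I)$ ($k\in\mathbb Z^n$) be the Fourier coefficients of $G$ and $f_0$ in $\theta$. Fix $K\ge1$ and set $$a_k(I):=G_k(I)f_{0,-k}(I),\qquad \phi_k(I):=k\cdot\omega(I).$$ Assume that for each $k\in\mathbb Z^n$ with $0<|k|\le K$ one has $a_k\in W^{1,1}(\Omega)$ and $\gamma_k(\Omega):=\inf_{I\in\Omega}|\nabla_I\phi_k(I)|>0$. Then for any $t\ne0$, $$\big|\langle G\rangle_t-\langle\langle G\rangle_\theta\rangle_0\big|\le\frac{C_G(K;\Omega)}{|t|}+\mathcal R_{>K}(G,f_0;\Omega),$$ where $$C_G(K;\Omega):=(2\pi)^n\sum_{0<|k|\le K}\|u_k\|_{L^1(\Omega)},\qquad u_k:=\operatorname{div}_I\!\left(a_k\frac{\nabla_I\phi_k}{|\nabla_I\phi_k|^2}\right),$$ $$\mathcal R_{>K}(G,f_0;\Omega):=(2\pi)^n\sum_{|k|>K}\int_\Omega|G_k(I)f_{0,-k}(I)|\,dI.$$ Moreover, if $\omega\in C^2(\Omega)$ and $M_k(\Omega):=\|\nabla_I^2\phi_k\|_{L^\infty(\Omega)}=\|\nabla_I^2(k\cdot\omega)\|_{L^\infty(\Omega)}$,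 then $$C_G(K;\Omega)\le(2\pi)^n\sum_{0<|k|\le K}\left[\frac{\|\nabla_Ia_k\|_{L^1(\Omega)}}{\gamma_k(\Omega)}+\frac{(n+2)M_k(\Omega)}{\gamma_k(\Omega)^2}\|a_k\|_{L^1(\Omega)}\right].$$
   Context: $\mathbb T^n=(\mathbb R/2\pi\mathbb Z)^n$. For $k\in\mathbb Z^n$, $|k|=|k_1|+\dots+|k_n|$; for vectors in $\mathbb R^n$, $|\cdot|$ is the Euclidean norm; the size of a Hessian matrix is its operator norm. Fourier coefficients: $G(\theta,I)=\sum_kG_k(I)e^{ik\cdot\theta}$ with $G_k(I)=(2\pi)^{-n}\int_{\mathbb T^n}G\,e^{-ik\cdot\theta}\,d\theta$, and similarly for $f_0$. The averages are $$\langle G\rangle_t:=\int_{\Omega\times\mathbb T^n}G(\Psi_t(I,\theta))\,f_0(I,\theta)\,d\theta\,dI,\qquad \langle G\rangle_\theta(I):=\frac1{(2\pi)^n}\int_{\mathbb T^n}G(\theta,I)\,d\theta,$$ $$\langle\langle G\rangle_\theta\rangle_0:=\int_{\Omega\times\mathbb T^n}\langle G\rangle_\theta(I)\,f_0(\theta,I)\,d\theta\,dI.$$ The order of the arguments $(I,\theta)$ or $(\theta,I)$ is immaterial. The divergence defining $u_k$ is in the sense of distributions on $\Omega$, and $\|u_k\|_{L^1}=+\infty$ if $u_k$ is not an integrable function. $M_k(\Omega)\in[0,\infty]$, with the convention $0\cdot\infty=0$. *)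

theory Defs
  imports "HOL-Probability.Essential_Supremum"
begin

text \<open>Class \<open>C\<^sup>m\<close> on an open set \<open>S\<close>, through iterated directional derivatives; in finite
  dimension this is equivalent to continuity of the \<open>m\<close>-th Frechet derivative.\<close>

primrec Ck_on :: "nat \<Rightarrow> 'a::euclidean_space set \<Rightarrow> ('a \<Rightarrow> 'b::real_normed_vector) \<Rightarrow> bool" where
  "Ck_on 0 S f \<longleftrightarrow> continuous_on S f"
| "Ck_on (Suc m) S f \<longleftrightarrow>
     (\<forall>x\<in>S. f differentiable (at x)) \<and> (\<forall>v. Ck_on m S (\<lambda>x. frechet_derivative f (at x) v))"

definition grad :: "(real^'n \<Rightarrow> real) \<Rightarrow> real^'n \<Rightarrow> real^'n" where
  "grad f x = (\<chi> i. frechet_derivative f (at x) (axis i 1))"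

definition hessian :: "(real^'n \<Rightarrow> real) \<Rightarrow> real^'n \<Rightarrow> real^'n^'n" where
  "hessian f x = matrix (frechet_derivative (grad f) (at x))"

definition test_function :: "(real^'n) set \<Rightarrow> (real^'n \<Rightarrow> real) \<Rightarrow> bool" where
  "test_function S \<psi> \<longleftrightarrow>
     (\<forall>m. Ck_on m UNIV \<psi>) \<and> (\<exists>C. compact C \<and> C \<subseteq> S \<and> (\<forall>x. x \<notin> C \<longrightarrow> \<psi> x = 0))"

definition L1_norm :: "(real^'n) set \<Rightarrow> (real^'n \<Rightarrow> 'b::real_normed_vector) \<Rightarrow> ennreal" where
  "L1_norm S u = (\<integral>\<^sup>+x\<in>S. ennreal (norm (u x)) \<partial>lebesgue)"

definition Linf_norm :: "(real^'n) set \<Rightarrow> (real^'n \<Rightarrow> real) \<Rightarrow> ennreal" where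
  "Linf_norm S h = esssup (lebesgue_on S) (\<lambda>x. ennreal \<bar>h x\<bar>)"

definition locally_integrable_on ::
    "(real^'n) set \<Rightarrow> (real^'n \<Rightarrow> 'b::{banach, second_countable_topology}) \<Rightarrow> bool" where
  "locally_integrable_on S F \<longleftrightarrow> (\<forall>C. compact C \<and> C \<subseteq> S \<longrightarrow> set_integrable lebesgue C F)"

definition is_weak_gradient ::
    "(real^'n) set \<Rightarrow> (real^'n \<Rightarrow> complex) \<Rightarrow> (real^'n \<Rightarrow> complex^'n) \<Rightarrow> bool" where
  "is_weak_gradient S a g \<longleftrightarrow> locally_integrable_on S a \<and> locally_integrable_on S g \<and>
     (\<forall>\<psi>. test_function S \<psi> \<longrightarrow> (\<forall>i.
        (LINT x:S|lebesgue. \<psi> x *\<^sub>R g x $ i) = - (LINT x:S|lebesgue. (grad \<psi> x $ i) *\<^sub>R a x)))"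

definition is_weak_divergence ::
    "(real^'n) set \<Rightarrow> (real^'n \<Rightarrow> complex^'n) \<Rightarrow> (real^'n \<Rightarrow> complex) \<Rightarrow> bool" where
  "is_weak_divergence S F u \<longleftrightarrow> locally_integrable_on S F \<and> locally_integrable_on S u \<and>
     (\<forall>\<psi>. test_function S \<psi> \<longrightarrow>
        (LINT x:S|lebesgue. \<psi> x *\<^sub>R u x)
          = - (LINT x:S|lebesgue. (\<Sum>i\<in>UNIV. (grad \<psi> x $ i) *\<^sub>R F x $ i)))"

definition W11 :: "(real^'n) set \<Rightarrow> (real^'n \<Rightarrow> complex) \<Rightarrow> bool" where
  "W11 S a \<longleftrightarrow> set_integrable lebesgue S a \<and>
     (\<exists>g. is_weak_gradient S a g \<and> set_integrable lebesgue S g)"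

text \<open>Weak gradients and weak divergences are unique almost everywhere, so each infimum below is
  the common \<open>L\<^sup>1\<close> norm of all representatives. It is \<open>\<infinity>\<close>, the infimum of the empty set, when the
  distribution is not an integrable function.\<close>

definition weak_gradient_L1_norm :: "(real^'n) set \<Rightarrow> (real^'n \<Rightarrow> complex) \<Rightarrow> ennreal" where
  "weak_gradient_L1_norm S a =
     (INF g\<in>{g. is_weak_gradient S a g \<and> set_integrable lebesgue S g}. L1_norm S g)"

definition weak_divergence_L1_norm :: "(real^'n) set \<Rightarrow> (real^'n \<Rightarrow> complex^'n) \<Rightarrow> ennreal" where
  "weak_divergence_L1_norm S F =
     (INF u\<in>{u. is_weak_divergence S F u \<and> set_integrable lebesgue S u}. L1_norm S u)"

definition rvec :: "int^'n \<Rightarrow> real^'n" where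
  "rvec k = (\<chi> i. real_of_int (k $ i))"

definition l1 :: "int^'n \<Rightarrow> int" where
  "l1 k = (\<Sum>i\<in>UNIV. \<bar>k $ i\<bar>)"

text \<open>A function on \<open>\<Omega> \<times> \<T>\<^sup>n\<close> is a function of \<open>(I, \<theta>)\<close> that is \<open>2\<pi>\<close>-periodic in every
  component of \<open>\<theta>\<close>; integrals over the torus are taken over the fundamental cube.\<close>

definition torus_periodic :: "(real^'n) set \<Rightarrow> ((real^'n) \<times> (real^'n) \<Rightarrow> 'b) \<Rightarrow> bool" where
  "torus_periodic \<Omega> h \<longleftrightarrow> (\<forall>I\<in>\<Omega>. \<forall>\<theta> m. h (I, \<theta> + (2 * pi) *\<^sub>R rvec m) = h (I, \<theta>))"

definition torus_cube :: "(real^'n) set" where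
  "torus_cube = cbox 0 (\<chi> i. 2 * pi)"

definition C_torus ::
    "(real^'n) set \<Rightarrow> ((real^'n) \<times> (real^'n) \<Rightarrow> 'b::real_normed_vector) \<Rightarrow> bool" where
  "C_torus \<Omega> h \<longleftrightarrow> torus_periodic \<Omega> h \<and> continuous_on (\<Omega> \<times> UNIV) h"

text \<open>As the torus is compact, compact support in \<open>\<Omega> \<times> \<T>\<^sup>n\<close> only constrains \<open>I\<close>.\<close>

definition C1c_torus ::
    "(real^'n) set \<Rightarrow> ((real^'n) \<times> (real^'n) \<Rightarrow> 'b::real_normed_vector) \<Rightarrow> bool" where
  "C1c_torus \<Omega> h \<longleftrightarrow> torus_periodic \<Omega> h \<and> Ck_on 1 (\<Omega> \<times> UNIV) h \<and>
     (\<exists>C. compact C \<and> C \<subseteq> \<Omega> \<and> (\<forall>I\<in>\<Omega> - C. \<forall>\<theta>. h (I, \<theta>) = 0))"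

definition fourier_coeff ::
    "((real^'n) \<times> (real^'n) \<Rightarrow> complex) \<Rightarrow> int^'n \<Rightarrow> real^'n \<Rightarrow> complex" where
  "fourier_coeff h k I =
     (LINT \<theta>:torus_cube|lebesgue. h (I, \<theta>) * exp (- \<i> * complex_of_real (rvec k \<bullet> \<theta>)))
       / complex_of_real ((2 * pi) ^ CARD('n))"

definition flow ::
    "(real^'n \<Rightarrow> real^'n) \<Rightarrow> real \<Rightarrow> (real^'n) \<times> (real^'n) \<Rightarrow> (real^'n) \<times> (real^'n)" where
  "flow \<omega> t = (\<lambda>(I, \<theta>). (I, \<theta> + t *\<^sub>R \<omega> I))"

definition time_average ::
    "(real^'n) set \<Rightarrow> (real^'n \<Rightarrow> real^'n) \<Rightarrow> ((real^'n) \<times> (real^'n) \<Rightarrow> real)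
      \<Rightarrow> ((real^'n) \<times> (real^'n) \<Rightarrow> complex) \<Rightarrow> real \<Rightarrow> complex" where
  "time_average \<Omega> \<omega> f0 G t =
     (LINT z:\<Omega> \<times> torus_cube|lebesgue. G (flow \<omega> t z) * complex_of_real (f0 z))"

definition angle_average :: "((real^'n) \<times> (real^'n) \<Rightarrow> complex) \<Rightarrow> real^'n \<Rightarrow> complex" where
  "angle_average G I =
     (LINT \<theta>:torus_cube|lebesgue. G (I, \<theta>)) / complex_of_real ((2 * pi) ^ CARD('n))"

definition initial_average ::
    "(real^'n) set \<Rightarrow> ((real^'n) \<times> (real^'n) \<Rightarrow> real) \<Rightarrow> (real^'n \<Rightarrow> complex) \<Rightarrow> complex" where
  "initial_average \<Omega> f0 g =
     (LINT z:\<Omega> \<times> torus_cube|lebesgue. g (fst z) * complex_of_real (f0 z))"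

definition amplitude ::
    "((real^'n) \<times> (real^'n) \<Rightarrow> complex) \<Rightarrow> ((real^'n) \<times> (real^'n) \<Rightarrow> real)
      \<Rightarrow> int^'n \<Rightarrow> real^'n \<Rightarrow> complex" where
  "amplitude G f0 k I =
     fourier_coeff G k I * fourier_coeff (\<lambda>z. complex_of_real (f0 z)) (- k) I"

definition phase :: "(real^'n \<Rightarrow> real^'n) \<Rightarrow> int^'n \<Rightarrow> real^'n \<Rightarrow> real" where
  "phase \<omega> k I = rvec k \<bullet> \<omega> I"

definition gap :: "(real^'n) set \<Rightarrow> (real^'n \<Rightarrow> real^'n) \<Rightarrow> int^'n \<Rightarrow> ennreal" where
  "gap \<Omega> \<omega> k = (INF I\<in>\<Omega>. ennreal (norm (grad (phase \<omega> k) I)))"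

definition hess_bound :: "(real^'n) set \<Rightarrow> (real^'n \<Rightarrow> real^'n) \<Rightarrow> int^'n \<Rightarrow> ennreal" where
  "hess_bound \<Omega> \<omega> k = Linf_norm \<Omega> (\<lambda>I. onorm ((*v) (hessian (phase \<omega> k) I)))"

definition low_modes :: "real \<Rightarrow> (int^'n) set" where
  "low_modes K = {k. 0 < l1 k \<and> real_of_int (l1 k) \<le> K}"

lemma finite_low_modes: "finite (low_modes K :: (int^'n) set)"
proof -
  let ?B = "{- \<lfloor>K\<rfloor>..\<lfloor>K\<rfloor>}"
  have "low_modes K \<subseteq> (\<lambda>f. \<chi> i. f i) ` (PiE (UNIV :: 'n set) (\<lambda>_. ?B))"
  proof
    fix k :: "int^'n" assume "k \<in> low_modes K"
    then have K: "l1 k \<le> \<lfloor>K\<rfloor>" by (simp add: low_modes_def le_floor_iff)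
    have "\<bar>k $ i\<bar> \<le> l1 k" for i
      unfolding l1_def by (rule member_le_sum) auto
    with K have "\<bar>k $ i\<bar> \<le> \<lfloor>K\<rfloor>" for i
      by (meson order_trans)
    then have "k $ i \<in> ?B" for i
      by (metis abs_le_iff atLeastAtMost_iff minus_le_iff)
    then have "(\<lambda>i. k $ i) \<in> PiE UNIV (\<lambda>_. ?B)" by auto
    moreover have "k = (\<chi> i. k $ i)" by simp
    ultimately show "k \<in> (\<lambda>f. \<chi> i. f i) ` (PiE (UNIV :: 'n set) (\<lambda>_. ?B))" by blast
  qed
  moreover have "finite (PiE (UNIV :: 'n set) (\<lambda>_. ?B))"
    by (intro finite_PiE) auto
  ultimately show ?thesis
    using finite_subset by blast
qed

definition transport_field ::
    "(real^'n \<Rightarrow> real^'n) \<Rightarrow> ((real^'n) \<times> (real^'n) \<Rightarrow> complex)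
      \<Rightarrow> ((real^'n) \<times> (real^'n) \<Rightarrow> real) \<Rightarrow> int^'n \<Rightarrow> real^'n \<Rightarrow> complex^'n" where
  "transport_field \<omega> G f0 k I =
     (\<chi> i. amplitude G f0 k I *
        complex_of_real (grad (phase \<omega> k) I $ i / (norm (grad (phase \<omega> k) I))\<^sup>2))"

definition C_G ::
    "(real^'n) set \<Rightarrow> (real^'n \<Rightarrow> real^'n) \<Rightarrow> ((real^'n) \<times> (real^'n) \<Rightarrow> complex)
      \<Rightarrow> ((real^'n) \<times> (real^'n) \<Rightarrow> real) \<Rightarrow> real \<Rightarrow> ennreal" where
  "C_G \<Omega> \<omega> G f0 K = ennreal ((2 * pi) ^ CARD('n)) *
     (\<Sum>k\<in>low_modes K. weak_divergence_L1_norm \<Omega> (transport_field \<omega> G f0 k))"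

definition tail ::
    "(real^'n) set \<Rightarrow> ((real^'n) \<times> (real^'n) \<Rightarrow> complex)
      \<Rightarrow> ((real^'n) \<times> (real^'n) \<Rightarrow> real) \<Rightarrow> real \<Rightarrow> ennreal" where
  "tail \<Omega> G f0 K = ennreal ((2 * pi) ^ CARD('n)) *
     (\<Sum>\<^sub>\<infinity>k\<in>{k. real_of_int (l1 k) > K}. L1_norm \<Omega> (amplitude G f0 k))"

end

theory Submission
  imports Defs
begin

text \<open>For fixed \<open>I\<close>, Parseval on the torus turns the angular integral of \<open>G \<circ> \<Psi>\<^sub>t\<close> against \<open>f0\<close>
  into \<open>(2 * pi) ^ n\<close> times the sum over \<open>k\<close> of \<open>exp (\<i> * t * \<phi>\<^sub>k) * a\<^sub>k\<close>. The mode \<open>k = 0\<close> integrates to the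
  initial average, the modes beyond \<open>K\<close> are estimated by absolute values, and each remaining mode is an
  oscillatory integral without stationary points: one integration by parts along
  \<open>grad \<phi>\<^sub>k / (norm (grad \<phi>\<^sub>k))\<^sup>2\<close> gains the factor \<open>1 / \<bar>t\<bar>\<close>. As \<open>\<omega>\<close> is only C1, the
  test function for this step is only C1, so the weak divergence identity is first extended from smooth
  test functions by mollification. The explicit bound on the constant follows by expanding the divergence with the
  product rule and bounding trace and quadratic form of the Hessian by its operator norm.\<close>

section \<open>Smooth bump functions\<close>

text \<open>Three obstacles shape the argument. Weak divergences are tested by functions with
  compact support in \<open>\<Omega>\<close>, and \<open>exp (\<i> * t * \<phi>)\<close> has no such
  support. All amplitudes vanish off one compact subset of \<open>\<Omega>\<close>, inherited from
  \<open>f0\<close>. A cutoff equal to 1 on that set repairs the test function, and its gradient is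
  zero wherever an amplitude is not, so neither a boundary term nor a cutoff term survives. The
  norms of weak derivatives are infima over representatives. Each estimate is proved for an
  arbitrary representative and the infimum is taken last; the empty infimum is infinite, which makes
  that case trivial or harmless. The Fourier series of a merely continuous observable need not
  converge uniformly. Parseval is therefore used as an approximation by finite sums, over frequency
  sets that depend on the action \<open>I\<close> and on the accuracy. Comparison with the whole
  tail, an infinite sum in \<open>ennreal\<close> that always has a value, removes this dependence
  before \<open>I\<close> is integrated out.\<close>

definition flat :: "nat \<Rightarrow> real \<Rightarrow> real" where
  "flat k s = (if s > 0 then exp (- 1 / s) / s ^ k else 0)"

lemma flat_nonneg: "0 \<le> flat k s"
  by (simp add: flat_def)

lemma flat_tendsto_0: "(flat k \<longlongrightarrow> 0) (at 0)"
proof -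
  have "((\<lambda>s. inverse s ^ k / exp (inverse s)) \<longlongrightarrow> 0) (at_right (0::real))"
    by (rule filterlim_compose[OF tendsto_power_div_exp_0 filterlim_inverse_at_top_right])
  moreover have "\<forall>\<^sub>F s in at_right (0::real). inverse s ^ k / exp (inverse s) = flat k s"
    by (rule eventually_at_right_less[THEN eventually_mono])
      (simp add: flat_def exp_minus field_simps)
  ultimately have r: "(flat k \<longlongrightarrow> 0) (at_right 0)"
    by (rule Lim_transform_eventually)
  have l: "(flat k \<longlongrightarrow> 0) (at_left 0)"
    by (rule tendsto_eventually)
      (auto simp: flat_def eventually_at_filter)
  from l r show ?thesis by (simp add: filterlim_at_split)
qed

text \<open>The powers of \<open>1 / s\<close> are built into the family because differentiating
  \<open>exp (- 1 / s)\<close> produces them. With the index \<open>k\<close> the family is closed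
  under differentiation up to linear combinations.\<close>

lemma flat_has_real_derivative:
  "(flat k has_real_derivative flat (k + 2) s - real k * flat (Suc k) s) (at s)"
proof -
  consider "s > 0" | "s < 0" | "s = 0" by linarith
  then show ?thesis
  proof cases
    case 1
    have "((\<lambda>s. exp (- 1 / s) / s ^ k) has_real_derivative
        flat (k + 2) s - real k * flat (Suc k) s) (at s)"
      using 1
      by (auto intro!: derivative_eq_intros simp: flat_def field_simps power2_eq_square)
        (cases k; simp)+
    then show ?thesis
      by (rule has_field_derivative_transform_within_open[of _ _ _ "{0<..}"])
        (use 1 in \<open>auto simp: flat_def\<close>)
  next
    case 2
    have "((\<lambda>s. 0) has_real_derivative flat (k + 2) s - real k * flat (Suc k) s) (at s)"
      using 2 by (simp add: flat_def)
    then show ?thesis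
      by (rule has_field_derivative_transform_within_open[of _ _ _ "{..<0}"])
        (use 2 in \<open>auto simp: flat_def\<close>)
  next
    case 3
    \<comment> \<open>The difference quotient at the seam is again a member of the family, so the
      limit already computed for every index gives derivative 0.\<close>
    have eq: "(flat k x - flat k 0) / (x - 0) = flat (Suc k) x" for x
      by (simp add: flat_def)
    have "(flat k has_real_derivative 0) (at 0)"
      unfolding has_field_derivative_iff eq by (rule flat_tendsto_0)
    then show ?thesis using 3 by (simp add: flat_def)
  qed
qed

text \<open>An algebra of functions that contains a bump and is closed under directional derivatives;
  the closure makes its members smooth.\<close>

inductive bump_algebra :: "real \<Rightarrow> ('a::euclidean_space \<Rightarrow> real) \<Rightarrow> bool" for r where
  const: "bump_algebra r (\<lambda>x. c)"
| inner: "bump_algebra r (\<lambda>x. x \<bullet> v)"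
| flat: "bump_algebra r (\<lambda>x. flat k (r\<^sup>2 - x \<bullet> x))"
| add: "bump_algebra r f \<Longrightarrow> bump_algebra r g \<Longrightarrow> bump_algebra r (\<lambda>x. f x + g x)"
| mult: "bump_algebra r f \<Longrightarrow> bump_algebra r g \<Longrightarrow> bump_algebra r (\<lambda>x. f x * g x)"

text \<open>The gradient is carried as an explicit vector field, so that its continuity is that of a
  map between Euclidean spaces and it can be integrated over a parameter directly.\<close>

definition C1_gradient :: "('a::euclidean_space \<Rightarrow> real) \<Rightarrow> ('a \<Rightarrow> 'a) \<Rightarrow> bool" where
  "C1_gradient f D \<longleftrightarrow>
     continuous_on UNIV D \<and> (\<forall>x. (f has_derivative (\<lambda>v. D x \<bullet> v)) (at x))"

lemma C1_gradient_continuous: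
  assumes "C1_gradient f D" shows "continuous_on S f"
  using assms unfolding C1_gradient_def
  by (meson continuous_on_eq_continuous_within has_derivative_continuous
      continuous_on_subset subset_UNIV continuous_at_imp_continuous_on)

lemma C1_gradient_const: "C1_gradient (\<lambda>x. c) (\<lambda>x. 0)"
  by (simp add: C1_gradient_def)

lemma C1_gradient_add:
  "C1_gradient f D \<Longrightarrow> C1_gradient g E \<Longrightarrow> C1_gradient (\<lambda>x. f x + g x) (\<lambda>x. D x + E x)"
  by (auto simp: C1_gradient_def inner_add_left intro!: continuous_intros derivative_intros)

lemma C1_gradient_mult:
  assumes f: "C1_gradient f D" and g: "C1_gradient g E"
  shows "C1_gradient (\<lambda>x. f x * g x) (\<lambda>x. f x *\<^sub>R E x + g x *\<^sub>R D x)"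
  unfolding C1_gradient_def
proof (intro conjI allI)
  show "continuous_on UNIV (\<lambda>x. f x *\<^sub>R E x + g x *\<^sub>R D x)"
    using f g C1_gradient_continuous[OF f] C1_gradient_continuous[OF g]
    by (auto simp: C1_gradient_def intro!: continuous_intros)
  fix x
  have "((\<lambda>x. f x * g x) has_derivative (\<lambda>v. f x * (E x \<bullet> v) + (D x \<bullet> v) * g x)) (at x)"
    using f g by (auto simp: C1_gradient_def intro!: has_derivative_mult)
  then show "((\<lambda>x. f x * g x) has_derivative (\<lambda>v. (f x *\<^sub>R E x + g x *\<^sub>R D x) \<bullet> v)) (at x)"
    by (simp add: inner_add_left mult.commute)
qed

lemma flat_radial_C1_gradient:
  "C1_gradient (\<lambda>x. flat k (r\<^sup>2 - x \<bullet> x))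
     (\<lambda>x. (-2 * (flat (k + 2) (r\<^sup>2 - x \<bullet> x) - real k * flat (Suc k) (r\<^sup>2 - x \<bullet> x))) *\<^sub>R x)"
  unfolding C1_gradient_def
proof (intro conjI allI)
  have c: "continuous_on UNIV (flat k)" for k
    by (meson DERIV_isCont continuous_at_imp_continuous_on flat_has_real_derivative)
  show "continuous_on UNIV (\<lambda>x::'a.
      (-2 * (flat (k + 2) (r\<^sup>2 - x \<bullet> x) - real k * flat (Suc k) (r\<^sup>2 - x \<bullet> x))) *\<^sub>R x)"
    by (intro continuous_intros continuous_on_compose2[OF c]) auto
  fix x :: 'a
  have "((\<lambda>x. r\<^sup>2 - x \<bullet> x) has_derivative (\<lambda>v. - (2 * (x \<bullet> v)))) (at x)"
    by (auto intro!: derivative_eq_intros simp: inner_commute)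
  from has_derivative_compose[OF this
      flat_has_real_derivative[unfolded has_field_derivative_def]]
  show "((\<lambda>x. flat k (r\<^sup>2 - x \<bullet> x)) has_derivative (\<lambda>v.
      ((-2 * (flat (k + 2) (r\<^sup>2 - x \<bullet> x) - real k * flat (Suc k) (r\<^sup>2 - x \<bullet> x))) *\<^sub>R x) \<bullet> v)) (at x)"
    by (rule has_derivative_eq_rhs) (auto simp: algebra_simps)
qed

text \<open>The product rule explains the closure under sums and products. The linear functions are
  among the generators because differentiating \<open>r\<^sup>2 - x \<bullet> x\<close> in direction
  \<open>v\<close> leaves a factor \<open>x \<bullet> v\<close>.\<close>

lemma bump_algebra_gradient:
  assumes "bump_algebra r h"
  shows "\<exists>D. C1_gradient h D \<and> (\<forall>v. bump_algebra r (\<lambda>x. D x \<bullet> v))"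
  using assms
proof induction
  case (const c)
  then show ?case
    using C1_gradient_const bump_algebra.const[of r 0] by (intro exI[of _ "\<lambda>_. 0"]) auto
next
  case (inner w)
  have "C1_gradient (\<lambda>x. x \<bullet> w) (\<lambda>_. w)"
    by (auto simp: C1_gradient_def inner_commute intro!: derivative_eq_intros)
  then show ?case by (intro exI[of _ "\<lambda>_. w"]) (simp add: bump_algebra.const)
next
  case (flat k)
  have "bump_algebra r (\<lambda>x. ((-2 * (flat (k + 2) (r\<^sup>2 - x \<bullet> x)
      - real k * flat (Suc k) (r\<^sup>2 - x \<bullet> x))) *\<^sub>R x) \<bullet> v)" for v :: 'a
  proof -
    have "bump_algebra r (\<lambda>x. ((-2) * flat (k + 2) (r\<^sup>2 - x \<bullet> x)
        + (2 * real k) * flat (Suc k) (r\<^sup>2 - x \<bullet> x)) * (x \<bullet> v))"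
      by (intro bump_algebra.intros)
    then show ?thesis by (simp add: algebra_simps)
  qed
  then show ?case using flat_radial_C1_gradient by blast
next
  case (add f g)
  then obtain D E where "C1_gradient f D" "\<forall>v. bump_algebra r (\<lambda>x. D x \<bullet> v)"
    "C1_gradient g E" "\<forall>v. bump_algebra r (\<lambda>x. E x \<bullet> v)" by blast
  then show ?case
    by (intro exI[of _ "\<lambda>x. D x + E x"])
      (simp add: C1_gradient_add inner_add_left bump_algebra.add)
next
  case (mult f g)
  then obtain D E where DE: "C1_gradient f D" "\<forall>v. bump_algebra r (\<lambda>x. D x \<bullet> v)"
    "C1_gradient g E" "\<forall>v. bump_algebra r (\<lambda>x. E x \<bullet> v)" by blast
  have "bump_algebra r (\<lambda>x. f x * (E x \<bullet> v) + g x * (D x \<bullet> v))" for v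
    using mult.hyps DE by (intro bump_algebra.add bump_algebra.mult) auto
  then show ?case using C1_gradient_mult[OF DE(1,3)]
    by (intro exI[of _ "\<lambda>x. f x *\<^sub>R E x + g x *\<^sub>R D x"]) (simp add: inner_add_left)
qed

section \<open>Mollification\<close>

text \<open>Differentiation under the integral sign: \<open>x\<close> occurs only in the kernel
  \<open>h\<close>, so all the regularity comes from \<open>h\<close>, while \<open>w\<close>
  contributes continuity. Either factor of a convolution can play the role of \<open>h\<close>, and
  both choices are used below.\<close>

lemma convolution_C1_gradient:
  fixes h :: "'a::euclidean_space \<Rightarrow> real"
  assumes h: "C1_gradient h D" and w: "continuous_on (cbox a b) w"
  shows "C1_gradient (\<lambda>x. integral (cbox a b) (\<lambda>z. w z * h (x - z)))
    (\<lambda>x. integral (cbox a b) (\<lambda>z. w z *\<^sub>R D (x - z)))"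
  unfolding C1_gradient_def
proof (intro conjI allI)
  have D: "continuous_on UNIV D" and hc: "continuous_on UNIV h"
    using h C1_gradient_continuous[OF h] by (auto simp: C1_gradient_def)
  have w2: "continuous_on (UNIV \<times> cbox a b) (\<lambda>x. w (snd x))"
    by (intro continuous_on_compose2[OF w] continuous_intros) auto
  show "continuous_on UNIV (\<lambda>x. integral (cbox a b) (\<lambda>z. w z *\<^sub>R D (x - z)))"
    by (rule integral_continuous_on_param)
      (auto simp: split_beta intro!: continuous_intros w2 continuous_on_compose2[OF D])
  fix x0 :: 'a
  \<comment> \<open>\<open>leibniz_rule\<close> takes the derivative as a bounded linear map
    depending continuously on both variables; this is the vector \<open>D (x - z)\<close> seen as a
    functional.\<close>
  define fx where "fx x z = w z *\<^sub>R blinfun_inner_left (D (x - z))" for x z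
  have fxc: "continuous_on (UNIV \<times> cbox a b) (\<lambda>(x, z). fx x z)"
    unfolding fx_def split_beta
    by (intro continuous_intros w2 continuous_on_compose2[OF D]
        bounded_linear.continuous_on[OF bounded_linear_blinfun_inner_left]) auto
  have "((\<lambda>x. integral (cbox a b) (\<lambda>z. w z * h (x - z))) has_derivative
      integral (cbox a b) (fx x0)) (at x0 within UNIV)"
  proof (rule leibniz_rule[where U=UNIV])
    fix x z :: 'a
    have "((\<lambda>x. h (x - z)) has_derivative (\<lambda>v. D (x - z) \<bullet> v)) (at x)"
      using h unfolding C1_gradient_def
      by (intro has_derivative_compose[where f="\<lambda>x. x - z" and g=h, simplified])
        (auto intro!: derivative_eq_intros)
    then show "((\<lambda>x. w z * h (x - z)) has_derivative blinfun_apply (fx x z)) (at x within UNIV)"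
      by (auto simp: fx_def blinfun.scaleR_left fun_eq_iff inner_commute intro!: derivative_eq_intros)
  next
    fix x :: 'a
    show "(\<lambda>z. w z * h (x - z)) integrable_on cbox a b"
      by (intro integrable_continuous continuous_intros w continuous_on_compose2[OF hc]) auto
  qed (use fxc in auto)
  moreover have "blinfun_apply (integral (cbox a b) (fx x0)) v
      = integral (cbox a b) (\<lambda>z. w z *\<^sub>R D (x0 - z)) \<bullet> v" for v
  proof -
    have i1: "fx x0 integrable_on cbox a b"
      unfolding fx_def
      by (intro integrable_continuous continuous_intros w continuous_on_compose2[OF D]
        bounded_linear.continuous_on[OF bounded_linear_blinfun_inner_left]) auto
    have i2: "(\<lambda>z. w z *\<^sub>R D (x0 - z)) integrable_on cbox a b"
      by (intro integrable_continuous continuous_intros w continuous_on_compose2[OF D]) auto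
    have "blinfun_apply (integral (cbox a b) (fx x0)) v = integral (cbox a b) (\<lambda>z. fx x0 z v)"
      using integral_linear[OF i1 blinfun.bounded_linear_left[of v]] by (simp add: o_def)
    also have "\<dots> = integral (cbox a b) (\<lambda>z. (w z *\<^sub>R D (x0 - z)) \<bullet> v)"
      by (simp add: fx_def blinfun.scaleR_left inner_commute)
    also have "\<dots> = integral (cbox a b) (\<lambda>z. w z *\<^sub>R D (x0 - z)) \<bullet> v"
      using integral_linear[OF i2 bounded_linear_inner_left[of v]] by (simp add: o_def)
    finally show ?thesis .
  qed
  ultimately show "((\<lambda>x. integral (cbox a b) (\<lambda>z. w z * h (x - z))) has_derivative
      (\<lambda>v. integral (cbox a b) (\<lambda>z. w z *\<^sub>R D (x0 - z)) \<bullet> v)) (at x0)"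
    by (auto elim!: has_derivative_eq_rhs)
qed

text \<open>A directional derivative of the convolution is the convolution with a directional
  derivative of the kernel. That kernel lies again in the algebra, so the induction on
  \<open>m\<close> must leave \<open>h\<close> arbitrary.\<close>

lemma convolution_smooth:
  assumes "bump_algebra r h" and w: "continuous_on (cbox a b) w"
  shows "Ck_on m UNIV (\<lambda>x. integral (cbox a b) (\<lambda>z. w z * h (x - z)))"
  using assms(1)
proof (induction m arbitrary: h)
  case 0
  then obtain D where "C1_gradient h D" using bump_algebra_gradient by blast
  from C1_gradient_continuous[OF convolution_C1_gradient[OF this w]] show ?case by simp
next
  case (Suc m)
  then obtain D where D: "C1_gradient h D" "\<And>v. bump_algebra r (\<lambda>x. D x \<bullet> v)"
    using bump_algebra_gradient by blast
  let ?F = "\<lambda>x. integral (cbox a b) (\<lambda>z. w z * h (x - z))"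
  have d: "(?F has_derivative (\<lambda>v. integral (cbox a b) (\<lambda>z. w z *\<^sub>R D (x - z)) \<bullet> v)) (at x)" for x
    using convolution_C1_gradient[OF D(1) w] by (simp add: C1_gradient_def)
  have Dc: "continuous_on UNIV D" using D(1) by (simp add: C1_gradient_def)
  have "frechet_derivative ?F (at x) v = integral (cbox a b) (\<lambda>z. w z * (D (x - z) \<bullet> v))" for x v
  proof -
    have i2: "(\<lambda>z. w z *\<^sub>R D (x - z)) integrable_on cbox a b"
      by (intro integrable_continuous continuous_intros w continuous_on_compose2[OF Dc]) auto
    show ?thesis
      using integral_linear[OF i2 bounded_linear_inner_left[of v]]
      by (simp add: frechet_derivative_at[OF d, symmetric] o_def)
  qed
  with Suc.IH[OF D(2)] d show ?case
    by (auto simp: differentiable_def)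
qed
lemma mollifier_exists:
  fixes r :: real
  assumes "r > 0"
  obtains \<eta> :: "'a::euclidean_space \<Rightarrow> real" and b :: 'a
  where "bump_algebra r \<eta>" "\<forall>x. \<eta> x \<ge> 0" "\<forall>x. norm x > r \<longrightarrow> \<eta> x = 0"
    "cball 0 r \<subseteq> cbox (- b) b" "(\<eta> has_integral 1) (cbox (- b) b)"
proof -
  let ?f = "\<lambda>x::'a. flat 0 (r\<^sup>2 - x \<bullet> x)"
  obtain b :: 'a where b: "cball 0 r \<subseteq> cbox (- b) b"
    using bounded_subset_cbox_symmetric[OF bounded_cball] by blast
  have z: "?f x = 0" if "norm x > r" for x
    using that assms power_mono[of r "norm x" 2]
    by (simp add: flat_def power2_norm_eq_inner)
  have cont: "continuous_on S ?f" for S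
    by (rule C1_gradient_continuous[OF flat_radial_C1_gradient])
  define Z where "Z = integral (cbox (- b) b) ?f"
  have hi: "(?f has_integral Z) (cbox (- b) b)"
    unfolding Z_def by (intro integrable_integral integrable_continuous cont)
  have "Z \<ge> 0"
    using hi by (rule has_integral_nonneg) (simp add: flat_nonneg)
  \<comment> \<open>A continuous nonnegative function with zero integral over the box vanishes
    there, but the bump is positive at the origin.\<close>
  moreover have "Z \<noteq> 0"
  proof
    assume "Z = 0"
    have ball: "ball 0 r \<subseteq> box (- b) b"
      using b interior_mono[OF b] by (simp add: interior_cbox)
    then have "box (- b) b \<noteq> {}" using assms by auto
    moreover have "(0::'a) \<in> cbox (- b) b" using b assms by auto
    ultimately have "?f 0 = 0"
      using hi \<open>Z = 0\<close> cont flat_nonneg by (intro has_integral_0_cbox_imp_0[of "- b" b ?f]) auto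
    then show False using assms by (simp add: flat_def)
  qed
  ultimately have Z: "Z > 0" by simp
  show ?thesis
  proof
    show "bump_algebra r (\<lambda>x. (1 / Z) * ?f x)"
      by (intro bump_algebra.intros)
    show "((\<lambda>x. (1 / Z) * ?f x) has_integral 1) (cbox (- b) b)"
      using has_integral_mult_right[OF hi, of "1 / Z"] Z by simp
  qed (use Z flat_nonneg z b in auto)
qed

text \<open>Integration against a probability density is a convex combination, so it cannot leave a
  closed ball that contains all the values it averages.\<close>

lemma mollifier_average_close:
  fixes f :: "'a::euclidean_space \<Rightarrow> 'b::banach"
  assumes \<eta>: "(\<eta> has_integral 1) (cbox a b)" "continuous_on UNIV \<eta>" "\<And>y. \<eta> y \<ge> 0"
    "\<And>y. norm y > r \<Longrightarrow> \<eta> y = 0"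
    and f: "continuous_on UNIV f"
    and close: "\<And>y. norm y \<le> r \<Longrightarrow> norm (f (x - y) - c) \<le> e"
  shows "norm (integral (cbox a b) (\<lambda>y. \<eta> y *\<^sub>R f (x - y)) - c) \<le> e"
proof -
  have i1: "(\<lambda>y. \<eta> y *\<^sub>R f (x - y)) integrable_on cbox a b"
    by (intro integrable_continuous continuous_intros continuous_on_compose2[OF f]
        continuous_on_subset[OF \<eta>(2)]) auto
  have i2: "((\<lambda>y. \<eta> y *\<^sub>R c) has_integral c) (cbox a b)"
    using has_integral_scaleR_left[OF \<eta>(1), of c] by simp
  have i3: "((\<lambda>y. \<eta> y * e) has_integral e) (cbox a b)"
    using has_integral_mult_left[OF \<eta>(1), of e] by simp
  have "integral (cbox a b) (\<lambda>y. \<eta> y *\<^sub>R f (x - y)) - c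
      = integral (cbox a b) (\<lambda>y. \<eta> y *\<^sub>R f (x - y) - \<eta> y *\<^sub>R c)"
    using Henstock_Kurzweil_Integration.integral_diff[OF i1 has_integral_integrable[OF i2]]
      integral_unique[OF i2] by simp
  also have "norm \<dots> \<le> integral (cbox a b) (\<lambda>y. \<eta> y * e)"
  proof (rule Henstock_Kurzweil_Integration.integral_norm_bound_integral)
    show "(\<lambda>y. \<eta> y *\<^sub>R f (x - y) - \<eta> y *\<^sub>R c) integrable_on cbox a b"
      by (rule integrable_diff[OF i1 has_integral_integrable[OF i2]])
    fix y
    have "norm (\<eta> y *\<^sub>R f (x - y) - \<eta> y *\<^sub>R c) = \<eta> y * norm (f (x - y) - c)"
      using \<eta>(3)[of y] by (simp flip: scaleR_right_diff_distrib)
    also have "\<dots> \<le> \<eta> y * e"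
      using \<eta>(3)[of y] \<eta>(4)[of y] close[of y] by (cases "norm y \<le> r") (auto intro: mult_left_mono)
    finally show "norm (\<eta> y *\<^sub>R f (x - y) - \<eta> y *\<^sub>R c) \<le> \<eta> y * e" .
  qed (rule has_integral_integrable[OF i3])
  also have "\<dots> = e" by (rule integral_unique[OF i3])
  finally show ?thesis .
qed

text \<open>The two forms serve different ends. With \<open>x\<close> in the smooth factor the
  convolution is seen to be smooth; with \<open>x\<close> in \<open>w\<close> it is an average of
  nearby values of \<open>w\<close>.\<close>

lemma convolution_commute:
  fixes w \<eta> :: "'a::euclidean_space \<Rightarrow> real"
  assumes w: "continuous_on UNIV w" "\<And>z. z \<notin> cbox a b \<Longrightarrow> w z = 0"
    and \<eta>: "continuous_on UNIV \<eta>" "\<And>y. y \<notin> cbox c d \<Longrightarrow> \<eta> y = 0"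
  shows "integral (cbox a b) (\<lambda>z. w z * \<eta> (x - z)) = integral (cbox c d) (\<lambda>y. \<eta> y * w (x - y))"
proof -
  define g where "g z = w z * \<eta> (x - z)" for z
  define J where "J = integral (cbox a b) g"
  have "(g has_integral J) (cbox a b)"
    unfolding J_def g_def
    by (intro integrable_integral integrable_continuous continuous_intros
        continuous_on_compose2[OF \<eta>(1)] continuous_on_subset[OF w(1)]) auto
  from has_integral_affinity[OF this, of "-1" x]
  have "((\<lambda>y. g (x - y)) has_integral J) ((\<lambda>z. x - z) ` cbox a b)"
    by (simp add: algebra_simps)
  \<comment> \<open>The integral passes through the whole space because the reflected box and
    \<open>cbox c d\<close> need not be comparable; the integrand vanishes outside each of
    them.\<close>
  then have "((\<lambda>y. g (x - y)) has_integral J) UNIV"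
  proof (rule has_integral_on_superset)
    fix y assume "y \<notin> (\<lambda>z. x - z) ` cbox a b"
    then have "x - y \<notin> cbox a b" by (metis diff_diff_eq2 add_diff_cancel_left' imageI)
    then show "g (x - y) = 0" by (simp add: g_def w)
  qed auto
  then have "((\<lambda>y. if y \<in> cbox c d then g (x - y) else 0) has_integral J) UNIV"
    by (rule has_integral_eq[rotated]) (auto simp: g_def \<eta>)
  then have "((\<lambda>y. g (x - y)) has_integral J) (cbox c d)"
    by (simp add: has_integral_restrict_UNIV)
  then have "integral (cbox c d) (\<lambda>y. \<eta> y * w (x - y)) = J"
    by (auto simp: g_def mult.commute)
  then show ?thesis by (simp add: J_def g_def[abs_def])
qed

section \<open>Compactly supported C1 functions: smooth approximation and cutoffs\<close>

definition C1_compact :: "'a::euclidean_space set \<Rightarrow> ('a \<Rightarrow> real) \<Rightarrow> ('a \<Rightarrow> 'a) \<Rightarrow> bool" where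
  "C1_compact S f D \<longleftrightarrow> C1_gradient f D \<and>
     (\<exists>C. compact C \<and> C \<subseteq> S \<and> (\<forall>x. x \<notin> C \<longrightarrow> f x = 0 \<and> D x = 0))"

lemma C1_gradient_unique:
  assumes "C1_gradient f D" "(f has_derivative (\<lambda>v. g \<bullet> v)) (at x)"
  shows "D x = g"
proof -
  have "(\<lambda>v. D x \<bullet> v) = (\<lambda>v. g \<bullet> v)"
    using assms has_derivative_unique unfolding C1_gradient_def by blast
  then show ?thesis by (metis inner_commute vector_eq_rdot)
qed

lemma C1_compactI:
  assumes f: "C1_gradient f D" and C: "compact C" "C \<subseteq> S" "\<And>x. x \<notin> C \<Longrightarrow> f x = 0"
  shows "C1_compact S f D"
proof -
  have "D x = 0" if "x \<notin> C" for x
  proof (rule C1_gradient_unique[OF f])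
    have "((\<lambda>_. 0) has_derivative (\<lambda>v. 0 \<bullet> v)) (at x)" by simp
    then show "(f has_derivative (\<lambda>v. 0 \<bullet> v)) (at x)"
      by (rule has_derivative_transform_within_open[of _ _ _ _ "- C"])
        (use that C in \<open>auto simp: compact_imp_closed open_Compl\<close>)
  qed
  with assms show ?thesis by (auto simp: C1_compact_def)
qed

lemma grad_eqI: "(f has_derivative (\<lambda>v. g \<bullet> v)) (at x) \<Longrightarrow> grad f x = g"
  using frechet_derivative_at[of f "\<lambda>v. g \<bullet> v" x]
  by (auto simp: grad_def vec_eq_iff inner_axis dest!: sym[of "\<lambda>v. g \<bullet> v"])

text \<open>The centre \<open>c\<close> and radius \<open>e\<close> are free so that one estimate
  has several uses: \<open>c\<close> the value at \<open>x\<close> gives uniform approximation,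
  \<open>c = e = 0\<close> controls the support, \<open>c = 1\<close> with \<open>e = 0\<close>
  gives the plateau of a cutoff, and \<open>c = e = 1 / 2\<close> keeps values between 0 and 1. The
  gradient estimate is conditional on a gradient \<open>E\<close> of \<open>w\<close>, since cutoffs
  arise from a \<open>w\<close> that is only continuous.\<close>

lemma mollify:
  fixes w :: "real^'n \<Rightarrow> real"
  assumes w: "continuous_on UNIV w" "compact C" "\<And>x. x \<notin> C \<Longrightarrow> w x = 0" and r: "r > 0"
  obtains W D where "\<forall>m. Ck_on m UNIV W" "C1_gradient W D"
    "\<forall>x c e. (\<forall>y. norm y \<le> r \<longrightarrow> \<bar>w (x - y) - c\<bar> \<le> e) \<longrightarrow> \<bar>W x - c\<bar> \<le> e"
    "\<forall>E x c e. C1_gradient w E \<longrightarrow> (\<forall>y. norm y \<le> r \<longrightarrow> norm (E (x - y) - c) \<le> e) \<longrightarrow>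
       norm (D x - c) \<le> e"
proof -
  obtain \<eta> :: "real^'n \<Rightarrow> real" and b where \<eta>0:
    "bump_algebra r \<eta>" "\<forall>x. \<eta> x \<ge> 0" "\<forall>x. norm x > r \<longrightarrow> \<eta> x = 0"
    "cball 0 r \<subseteq> cbox (- b) b" "(\<eta> has_integral 1) (cbox (- b) b)"
    by (rule mollifier_exists[OF r]) (rule that; assumption)
  note \<eta> = \<eta>0[rule_format]
  obtain H where H: "C1_gradient \<eta> H" using bump_algebra_gradient[OF \<eta>(1)] by blast
  have \<eta>c: "continuous_on S \<eta>" for S by (rule C1_gradient_continuous[OF H])
  obtain c where c: "C \<subseteq> cbox (- c) c"
    using bounded_subset_cbox_symmetric[OF compact_imp_bounded[OF w(2)]] by blast
  define W where "W x = integral (cbox (- c) c) (\<lambda>z. w z * \<eta> (x - z))" for x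
  define D where "D x = integral (cbox (- c) c) (\<lambda>z. w z *\<^sub>R H (x - z))" for x
  have W_alt: "W x = integral (cbox (- b) b) (\<lambda>y. \<eta> y * w (x - y))" for x
    unfolding W_def
  proof (rule convolution_commute[OF w(1) _ \<eta>c])
    show "w z = 0" if "z \<notin> cbox (- c) c" for z using c w(3) that by blast
    show "\<eta> y = 0" if "y \<notin> cbox (- b) b" for y
    proof -
      have "y \<notin> cball 0 r" using that \<eta>(4) by blast
      then show ?thesis using \<eta>(3) by auto
    qed
  qed
  have wc: "continuous_on (cbox (- c) c) w" using w(1) continuous_on_subset by blast
  show ?thesis
  proof
    show "\<forall>m. Ck_on m UNIV W"
      unfolding W_def using convolution_smooth[OF \<eta>(1) wc] by blast
    show CW: "C1_gradient W D"
      unfolding W_def D_def by (rule convolution_C1_gradient[OF H wc])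
    have "\<bar>W x - c\<bar> \<le> e" if "\<And>y. norm y \<le> r \<Longrightarrow> \<bar>w (x - y) - c\<bar> \<le> e" for x c e
      using mollifier_average_close[OF \<eta>(5) \<eta>c \<eta>(2,3) w(1), where x=x and c=c and e=e] that by (simp add: W_alt)
    then show "\<forall>x c e. (\<forall>y. norm y \<le> r \<longrightarrow> \<bar>w (x - y) - c\<bar> \<le> e) \<longrightarrow> \<bar>W x - c\<bar> \<le> e"
      by blast
    have "norm (D x - c) \<le> e" if E: "C1_gradient w E"
      and le: "\<And>y. norm y \<le> r \<Longrightarrow> norm (E (x - y) - c) \<le> e" for E x c e
    proof -
      \<comment> \<open>Differentiating the other form of the convolution puts the derivative on
        \<open>w\<close>. Uniqueness of the gradient then identifies \<open>D\<close> with an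
        average of \<open>E\<close>.\<close>
      have "C1_gradient W (\<lambda>x. integral (cbox (- b) b) (\<lambda>y. \<eta> y *\<^sub>R E (x - y)))"
        unfolding W_alt by (rule convolution_C1_gradient[OF E \<eta>c])
      then have "D x = integral (cbox (- b) b) (\<lambda>y. \<eta> y *\<^sub>R E (x - y))"
        using C1_gradient_unique[OF CW] by (simp add: C1_gradient_def)
      moreover have "continuous_on UNIV E" using E by (simp add: C1_gradient_def)
      ultimately show ?thesis
        using mollifier_average_close[where f=E and x=x and c=c and e=e, OF \<eta>(5) \<eta>c \<eta>(2,3) _ le]
        by simp
    qed
    then show "\<forall>E x c e. C1_gradient w E \<longrightarrow> (\<forall>y. norm y \<le> r \<longrightarrow> norm (E (x - y) - c) \<le> e) \<longrightarrow>
       norm (D x - c) \<le> e" by blast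
  qed
qed

lemma compact_support_uniformly_continuous:
  fixes f :: "'a::euclidean_space \<Rightarrow> 'b::real_normed_vector"
  assumes f: "continuous_on UNIV f" and C: "compact C" "\<And>x. x \<notin> C \<Longrightarrow> f x = 0" and e: "e > 0"
  obtains d where "d > 0" "\<forall>x y. norm y \<le> d \<longrightarrow> norm (f (x - y) - f x) \<le> e"
proof -
  obtain R where R: "\<And>x. x \<in> C \<Longrightarrow> norm x \<le> R"
    using compact_imp_bounded[OF C(1)] by (auto simp: bounded_iff)
  \<comment> \<open>\<open>R\<close> bounds \<open>C\<close>, and shifts will have length at most 1.
    A point of norm at most \<open>R + 1\<close> thus stays in the ball of radius
    \<open>R + 2\<close>, and any other point lies outside \<open>C\<close> both before and after
    the shift.\<close>
  have "uniformly_continuous_on (cball 0 (R + 2)) f"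
    using f continuous_on_subset by (intro compact_uniformly_continuous) auto
  then obtain d where d: "d > 0"
    "\<And>x y. x \<in> cball 0 (R + 2) \<Longrightarrow> y \<in> cball 0 (R + 2) \<Longrightarrow> dist y x < d \<Longrightarrow> dist (f y) (f x) < e"
    using e unfolding uniformly_continuous_on_def by metis
  show ?thesis
  proof
    show "min (d / 2) 1 > 0" using d(1) by simp
    have "norm (f (x - y) - f x) \<le> e" if y: "norm y \<le> min (d / 2) 1" for x y
    proof (cases "norm x \<le> R + 1")
      case True
      then have "norm (x - y) \<le> R + 2" using y norm_triangle_ineq4[of x y] by simp
      then have "dist (f (x - y)) (f x) < e"
        using d(1) y True by (intro d(2)) (auto simp: dist_norm norm_minus_commute)
      then show ?thesis by (simp add: dist_norm)
    next
      case False
      then have "norm (x - y) > R" using y norm_triangle_ineq2[of x y] by simp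
      then have "x \<notin> C" "x - y \<notin> C" using R False by fastforce+
      then show ?thesis using C(2) e by simp
    qed
    then show "\<forall>x y. norm y \<le> min (d / 2) 1 \<longrightarrow> norm (f (x - y) - f x) \<le> e" by blast
  qed
qed

lemma compact_neighbourhood:
  fixes C :: "'a::euclidean_space set"
  assumes "compact C" "open S" "C \<subseteq> S"
  obtains d C' where "d > 0" "compact C'" "C \<subseteq> C'" "C' \<subseteq> S"
    "\<forall>x y. x \<in> C \<longrightarrow> norm y \<le> d \<longrightarrow> x + y \<in> C'"
proof -
  obtain e where e: "e > 0" "(\<Union>x\<in>C. ball x e) \<subseteq> S"
    using compact_subset_open_imp_ball_epsilon_subset[OF assms] by blast
  show ?thesis
  proof
    show "e / 2 > 0" using e by simp
    show "compact {x + y |x y. x \<in> C \<and> y \<in> cball 0 (e / 2)}"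
      by (intro compact_sums assms(1) compact_cball)
    show "C \<subseteq> {x + y |x y. x \<in> C \<and> y \<in> cball 0 (e / 2)}"
    proof
      fix x assume "x \<in> C"
      then have "x + 0 \<in> {x + y |x y. x \<in> C \<and> y \<in> cball 0 (e / 2)}"
        using e by (intro CollectI exI conjI) (rule refl, auto)
      then show "x \<in> {x + y |x y. x \<in> C \<and> y \<in> cball 0 (e / 2)}" by simp
    qed
    show "{x + y |x y. x \<in> C \<and> y \<in> cball 0 (e / 2)} \<subseteq> S"
    proof clarify
      fix x y :: 'a assume "x \<in> C" "y \<in> cball 0 (e / 2)"
      then have "x + y \<in> ball x e" using e by (auto simp: dist_norm)
      then show "x + y \<in> S" using e \<open>x \<in> C\<close> by blast
    qed
  qed auto
qed

text \<open>The set \<open>C\<close> is fixed before the accuracy \<open>e\<close>. A common compact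
  support is what lets a function that is only locally integrable be paired with all approximants at
  once.\<close>

lemma test_function_approximation:
  fixes S :: "(real^'n) set"
  assumes S: "open S" and f: "C1_compact S f D"
  obtains C where "compact C" "C \<subseteq> S" "\<forall>x. x \<notin> C \<longrightarrow> f x = 0 \<and> D x = 0"
    "\<forall>e>0. \<exists>g. test_function S g \<and> C1_gradient g (grad g) \<and>
       (\<forall>x. \<bar>g x - f x\<bar> \<le> e \<and> norm (grad g x - D x) \<le> e) \<and> (\<forall>x. x \<notin> C \<longrightarrow> g x = 0 \<and> grad g x = 0)"
proof -
  obtain C where C: "compact C" "C \<subseteq> S" "\<And>x. x \<notin> C \<Longrightarrow> f x = 0 \<and> D x = 0"
    and fD: "C1_gradient f D" using f by (auto simp: C1_compact_def)
  have fc: "continuous_on UNIV f" "continuous_on UNIV D"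
    using C1_gradient_continuous[OF fD] fD by (auto simp: C1_gradient_def)
  have fz: "f x = 0" and Dz: "D x = 0" if "x \<notin> C" for x using C(3) that by auto
  obtain d C' where d0: "d > 0" "compact C'" "C \<subseteq> C'" "C' \<subseteq> S"
    "\<forall>x y. x \<in> C \<longrightarrow> norm y \<le> d \<longrightarrow> x + y \<in> C'"
    by (rule compact_neighbourhood[OF C(1) S C(2)]) (rule that; assumption)
  note d = d0[rule_format]
  show ?thesis
  proof
    show "compact C'" "C' \<subseteq> S" by fact+
    show "\<forall>x. x \<notin> C' \<longrightarrow> f x = 0 \<and> D x = 0" using C d(3) by blast
    show "\<forall>e>0. \<exists>g. test_function S g \<and> C1_gradient g (grad g) \<and>
       (\<forall>x. \<bar>g x - f x\<bar> \<le> e \<and> norm (grad g x - D x) \<le> e) \<and> (\<forall>x. x \<notin> C' \<longrightarrow> g x = 0 \<and> grad g x = 0)"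
    proof (intro allI impI)
      fix e :: real assume e: "e > 0"
      obtain d1 where d1: "d1 > 0" "\<forall>x y. norm y \<le> d1 \<longrightarrow> norm (f (x - y) - f x) \<le> e"
        by (rule compact_support_uniformly_continuous[OF fc(1) C(1) fz e]) (assumption, (rule that; assumption))
      obtain d2 where d2: "d2 > 0" "\<forall>x y. norm y \<le> d2 \<longrightarrow> norm (D (x - y) - D x) \<le> e"
        by (rule compact_support_uniformly_continuous[OF fc(2) C(1) Dz e]) (assumption, (rule that; assumption))
      \<comment> \<open>\<open>d\<close> keeps the mollified function supported in
        \<open>C'\<close>; \<open>d1\<close> and \<open>d2\<close> are the moduli of continuity of
        \<open>f\<close> and of its gradient.\<close>
      define r where "r = min d (min d1 d2)"
      have r: "r > 0" using d d1 d2 by (simp add: r_def)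
      obtain g G where g0: "\<forall>m. Ck_on m UNIV g" "C1_gradient g G"
        "\<forall>x c e. (\<forall>y. norm y \<le> r \<longrightarrow> \<bar>f (x - y) - c\<bar> \<le> e) \<longrightarrow> \<bar>g x - c\<bar> \<le> e"
        "\<forall>E x c e. C1_gradient f E \<longrightarrow> (\<forall>y. norm y \<le> r \<longrightarrow> norm (E (x - y) - c) \<le> e) \<longrightarrow>
           norm (G x - c) \<le> e"
        by (rule mollify[OF fc(1) C(1) fz r]) (assumption, (rule that; assumption))
      note g = g0[rule_format]
      have Gg: "grad g x = G x" for x
        using g(2) by (intro grad_eqI) (simp add: C1_gradient_def)
      have z: "g x = 0" "G x = 0" if "x \<notin> C'" for x
      proof -
        have *: "x - y \<notin> C" if "norm y \<le> r" for y
          using d(5)[of "x - y" y] that \<open>x \<notin> C'\<close> by (auto simp: r_def)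
        have "\<bar>g x - 0\<bar> \<le> 0" using * C(3) by (intro g(3)) auto
        then show "g x = 0" by simp
        have "norm (G x - 0) \<le> 0" using * C(3) by (intro g(4)[OF fD]) auto
        then show "G x = 0" by simp
      qed
      have "test_function S g"
        unfolding test_function_def using g(1) d z by blast
      moreover have "\<bar>g x - f x\<bar> \<le> e" for x
        using d1(2) by (intro g(3)) (auto simp: r_def)
      moreover have "norm (G x - D x) \<le> e" for x
        using d2(2) by (intro g(4)[OF fD]) (auto simp: r_def)
      moreover have "grad g = G" using Gg by blast
      ultimately show "\<exists>g. test_function S g \<and> C1_gradient g (grad g) \<and>
         (\<forall>x. \<bar>g x - f x\<bar> \<le> e \<and> norm (grad g x - D x) \<le> e) \<and> (\<forall>x. x \<notin> C' \<longrightarrow> g x = 0 \<and> grad g x = 0)"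
        using z g(2) by blast
    qed
  qed
qed

lemma cutoff_exists:
  fixes S :: "(real^'n) set"
  assumes "compact C" "open S" "C \<subseteq> S"
  obtains \<kappa> D where "C1_compact S \<kappa> D" "\<forall>x. 0 \<le> \<kappa> x \<and> \<kappa> x \<le> 1" "\<forall>x\<in>C. \<kappa> x = 1"
proof (cases "C = {}")
  case True
  show ?thesis
    by (rule that[of "\<lambda>_. 0" "\<lambda>_. 0"]) (auto simp: C1_compact_def C1_gradient_const True)
next
  case False
  obtain d C' where d0: "d > 0" "compact C'" "C \<subseteq> C'" "C' \<subseteq> S"
    "\<forall>x y. x \<in> C \<longrightarrow> norm y \<le> d \<longrightarrow> x + y \<in> C'"
    by (rule compact_neighbourhood[OF assms]) (rule that; assumption)
  note d = d0[rule_format]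
  \<comment> \<open>This profile is 1 up to distance \<open>d / 4\<close> from \<open>C\<close> and
    0 from distance \<open>d / 2\<close> on. Averaging over radius \<open>d / 4\<close> therefore
    leaves the value 1 on \<open>C\<close>, and the value 0 off \<open>C'\<close>, where the
    distance exceeds \<open>d\<close>.\<close>
  define w where "w x = max 0 (min 1 (2 - 4 * infdist x C / d))" for x
  have wc: "continuous_on UNIV w"
    unfolding w_def using d(1) by (intro continuous_intros) auto
  have inf: "infdist x C > d" if "x \<notin> C'" for x
  proof (rule ccontr)
    assume "\<not> infdist x C > d"
    moreover obtain y where "y \<in> C" "infdist x C = dist x y"
      using infdist_attains_inf[OF compact_imp_closed[OF assms(1)] False] by blast
    ultimately show False using d(5)[of y "x - y"] that by (auto simp: dist_norm)
  qed
  have wz: "w x = 0" if "x \<notin> C'" for x using inf[OF that] d(1) by (simp add: w_def field_simps)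
  have r: "d / 4 > 0" using d by simp
  obtain \<kappa> D where \<kappa>0: "C1_gradient \<kappa> D"
      "\<forall>x c e. (\<forall>y. norm y \<le> d / 4 \<longrightarrow> \<bar>w (x - y) - c\<bar> \<le> e) \<longrightarrow> \<bar>\<kappa> x - c\<bar> \<le> e"
    by (rule mollify[OF wc d(2) wz r]) (assumption, (rule that; assumption))
  note \<kappa> = \<kappa>0[rule_format]
  have near: "\<bar>infdist (x - y) C - infdist x C\<bar> \<le> norm y" for x y
    using infdist_triangle_abs[of "x - y" C x] by (simp add: dist_norm)
  show ?thesis
  proof
    show "C1_compact S \<kappa> D"
    proof (rule C1_compactI[OF \<kappa>(1) d(2,4)])
      fix x assume "x \<notin> C'"
      have "w (x - y) = 0" if "norm y \<le> d / 4" for y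
        using near[of x y] that inf[OF \<open>x \<notin> C'\<close>] d(1) by (simp add: w_def field_simps)
      then have "\<bar>\<kappa> x - 0\<bar> \<le> 0" by (intro \<kappa>(2)) auto
      then show "\<kappa> x = 0" by simp
    qed
    have "\<bar>w x - 1 / 2\<bar> \<le> 1 / 2" for x
      unfolding w_def by linarith
    then have "\<bar>\<kappa> x - 1 / 2\<bar> \<le> 1 / 2" for x by (intro \<kappa>(2))
    then show "\<forall>x. 0 \<le> \<kappa> x \<and> \<kappa> x \<le> 1" by (smt (verit) field_sum_of_halves)
    show "\<forall>x\<in>C. \<kappa> x = 1"
    proof
      fix x assume "x \<in> C"
      have "w (x - y) = 1" if "norm y \<le> d / 4" for y
        using near[of x y] that infdist_zero[OF \<open>x \<in> C\<close>] d(1) by (simp add: w_def field_simps)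
      then have "\<bar>\<kappa> x - 1\<bar> \<le> 0" by (intro \<kappa>(2)) auto
      then show "\<kappa> x = 1" by simp
    qed
  qed
qed
section \<open>Weak derivatives tested against compactly supported C1 functions\<close>

lemma pairing_integrable:
  fixes u :: "'a::euclidean_space \<Rightarrow> 'b::{banach, second_countable_topology}"
  assumes u: "set_integrable lebesgue C u" and C: "compact C" and f: "continuous_on C f"
  shows "set_integrable lebesgue C (\<lambda>x. f x *\<^sub>R u x)"
proof -
  have "bounded (f ` C)" by (intro compact_imp_bounded compact_continuous_image f C)
  then obtain M where M: "\<And>x. x \<in> C \<Longrightarrow> \<bar>f x\<bar> \<le> M"
    unfolding bounded_iff by auto
  have "(\<lambda>x. indicat_real C x *\<^sub>R f x) \<in> borel_measurable borel"
    by (rule borel_measurable_continuous_on_indicator[OF borel_compact[OF C] f])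
  then have fm: "(\<lambda>x. indicat_real C x *\<^sub>R f x) \<in> borel_measurable lebesgue"
    by (intro measurable_completion) simp
  have um: "(\<lambda>x. indicat_real C x *\<^sub>R u x) \<in> borel_measurable lebesgue"
    using u unfolding set_integrable_def by (rule borel_measurable_integrable)
  have "integrable lebesgue (\<lambda>x. indicat_real C x *\<^sub>R (f x *\<^sub>R u x))"
  proof (rule Bochner_Integration.integrable_bound)
    show "integrable lebesgue (\<lambda>x. M *\<^sub>R (indicat_real C x *\<^sub>R u x))"
      using u unfolding set_integrable_def by (rule integrable_scaleR_right)
    have "(\<lambda>x. (indicat_real C x *\<^sub>R f x) *\<^sub>R (indicat_real C x *\<^sub>R u x)) \<in> borel_measurable lebesgue"
      by (rule borel_measurable_scaleR[OF fm um])
    also have "(\<lambda>x. (indicat_real C x *\<^sub>R f x) *\<^sub>R (indicat_real C x *\<^sub>R u x))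
        = (\<lambda>x. indicat_real C x *\<^sub>R (f x *\<^sub>R u x))"
      by (auto simp: indicator_def fun_eq_iff)
    finally show "(\<lambda>x. indicat_real C x *\<^sub>R (f x *\<^sub>R u x)) \<in> borel_measurable lebesgue" .
    show "AE x in lebesgue. norm (indicat_real C x *\<^sub>R (f x *\<^sub>R u x))
        \<le> norm (M *\<^sub>R (indicat_real C x *\<^sub>R u x))"
    proof (rule AE_I2)
      fix x
      show "norm (indicat_real C x *\<^sub>R (f x *\<^sub>R u x)) \<le> norm (M *\<^sub>R (indicat_real C x *\<^sub>R u x))"
      proof (cases "x \<in> C")
        case True
        then have "\<bar>f x\<bar> \<le> \<bar>M\<bar>" using M[of x] by linarith
        then show ?thesis using True by (simp add: mult_right_mono)
      qed simp
    qed
  qed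
  then show ?thesis by (simp add: set_integrable_def)
qed

lemma set_integral_support:
  assumes "C \<subseteq> S" "\<And>x. x \<notin> C \<Longrightarrow> h x = 0"
  shows "(LINT x:S|M. h x) = (LINT x:C|M. h x)"
  unfolding set_lebesgue_integral_def
  by (rule Bochner_Integration.integral_cong) (use assms in \<open>auto simp: indicator_def\<close>)

lemma set_integrable_support:
  assumes "C \<subseteq> S" "\<And>x. x \<notin> C \<Longrightarrow> h x = 0"
  shows "set_integrable M S h \<longleftrightarrow> set_integrable M C h"
  unfolding set_integrable_def
  by (rule Bochner_Integration.integrable_cong) (use assms in \<open>auto simp: indicator_def\<close>)

lemma pairing_close:
  fixes u :: "'a::euclidean_space \<Rightarrow> 'b::{banach, second_countable_topology}"
  assumes u: "set_integrable lebesgue C u" and C: "compact C" "C \<subseteq> S"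
    and f: "continuous_on UNIV f" "\<And>x. x \<notin> C \<Longrightarrow> f x = 0"
    and g: "continuous_on UNIV g" "\<And>x. x \<notin> C \<Longrightarrow> g x = 0"
    and e: "\<And>x. \<bar>g x - f x\<bar> \<le> e"
  shows "norm ((LINT x:S|lebesgue. g x *\<^sub>R u x) - (LINT x:S|lebesgue. f x *\<^sub>R u x))
    \<le> e * (LINT x:C|lebesgue. norm (u x))"
proof -
  have "(LINT x:S|lebesgue. g x *\<^sub>R u x) - (LINT x:S|lebesgue. f x *\<^sub>R u x)
      = (LINT x:C|lebesgue. g x *\<^sub>R u x) - (LINT x:C|lebesgue. f x *\<^sub>R u x)"
    using f(2) g(2) C(2) by (simp add: set_integral_support[of C S])
  also have "\<dots> = (LINT x:C|lebesgue. g x *\<^sub>R u x - f x *\<^sub>R u x)"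
    by (rule set_integral_diff(2)[symmetric]; rule pairing_integrable[OF u C(1)]; rule continuous_on_subset[OF _ subset_UNIV]; fact)
  also have "norm \<dots> \<le> (LINT x:C|lebesgue. norm (g x *\<^sub>R u x - f x *\<^sub>R u x))"
    by (rule set_integral_norm_bound, rule set_integral_diff(1); rule pairing_integrable[OF u C(1)]; rule continuous_on_subset[OF _ subset_UNIV]; fact)
  also have "\<dots> \<le> (LINT x:C|lebesgue. e * norm (u x))"
  proof (rule set_integral_mono)
    show "set_integrable lebesgue C (\<lambda>x. norm (g x *\<^sub>R u x - f x *\<^sub>R u x))"
      by (rule set_integrable_norm, rule set_integral_diff(1); rule pairing_integrable[OF u C(1)]; rule continuous_on_subset[OF _ subset_UNIV]; fact)
    show "set_integrable lebesgue C (\<lambda>x. e * norm (u x))"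
      using set_integrable_norm[OF u] by simp
    fix x
    have "norm (g x *\<^sub>R u x - f x *\<^sub>R u x) = \<bar>g x - f x\<bar> * norm (u x)"
      by (simp flip: scaleR_left_diff_distrib)
    also have "\<dots> \<le> e * norm (u x)" using e by (simp add: mult_right_mono)
    finally show "norm (g x *\<^sub>R u x - f x *\<^sub>R u x) \<le> e * norm (u x)" .
  qed
  finally show ?thesis by simp
qed

lemma set_integrable_vec_nth:
  fixes F :: "'a::euclidean_space \<Rightarrow> 'b::euclidean_space^'n"
  shows "set_integrable M C F \<Longrightarrow> set_integrable M C (\<lambda>x. F x $ i)"
  unfolding set_integrable_def
  by (drule integrable_bounded_linear[OF bounded_linear_vec_nth[of i]]) simp

lemma zero_if_norm_le_mult_all:
  fixes a :: "'b::real_normed_vector"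
  assumes "\<And>e. e > 0 \<Longrightarrow> norm a \<le> e * M"
  shows "a = 0"
proof (rule ccontr)
  assume "a \<noteq> 0"
  then have "norm a > 0" by simp
  moreover define e where "e = norm a / (2 * (\<bar>M\<bar> + 1))"
  ultimately have "e > 0" by (simp add: divide_pos_pos)
  have "e * M \<le> e * (\<bar>M\<bar> + 1)" using \<open>e > 0\<close> by simp
  also have "\<dots> = norm a / 2" by (simp add: e_def field_simps)
  finally show False using assms[OF \<open>e > 0\<close>] \<open>norm a > 0\<close> by linarith
qed

text \<open>Both sides depend continuously on the test function in the C1 norm once its support is
  confined to a fixed compact set, because \<open>a\<close> and \<open>g\<close> are integrable
  there. The defining identity thus passes to limits of smooth test functions.\<close>

lemma weak_gradient_C1_compact:
  fixes g :: "real^'n \<Rightarrow> complex^'n"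
  assumes S: "open S" and a: "is_weak_gradient S a g" and f: "C1_compact S f D"
  shows "(LINT x:S|lebesgue. f x *\<^sub>R g x $ i) = - (LINT x:S|lebesgue. (D x $ i) *\<^sub>R a x)"
proof -
  obtain C where C: "compact C" "C \<subseteq> S" "\<forall>x. x \<notin> C \<longrightarrow> f x = 0 \<and> D x = 0"
    and ap: "\<forall>e>0. \<exists>g. test_function S g \<and> C1_gradient g (grad g) \<and>
       (\<forall>x. \<bar>g x - f x\<bar> \<le> e \<and> norm (grad g x - D x) \<le> e) \<and> (\<forall>x. x \<notin> C \<longrightarrow> g x = 0 \<and> grad g x = 0)"
    by (rule test_function_approximation[OF S f]) (rule that; assumption)
  have fD: "C1_gradient f D" using f by (simp add: C1_compact_def)
  have ai: "set_integrable lebesgue C a" and gi: "set_integrable lebesgue C (\<lambda>x. g x $ i)"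
    using a C by (auto simp: is_weak_gradient_def locally_integrable_on_def intro: set_integrable_vec_nth)
  let ?A = "\<lambda>f. LINT x:S|lebesgue. f x *\<^sub>R g x $ i"
  let ?B = "\<lambda>D. LINT x:S|lebesgue. (D x $ i) *\<^sub>R a x"
  have "?A f + ?B D = 0"
  proof (rule zero_if_norm_le_mult_all)
    fix e :: real assume "e > 0"
    then obtain h where h: "test_function S h" "C1_gradient h (grad h)"
      "\<And>x. \<bar>h x - f x\<bar> \<le> e" "\<And>x. norm (grad h x - D x) \<le> e"
      "\<And>x. x \<notin> C \<Longrightarrow> h x = 0 \<and> grad h x = 0" using ap by blast
    have 1: "norm (?A h - ?A f) \<le> e * (LINT x:C|lebesgue. norm (g x $ i))"
      using C h by (intro pairing_close[OF gi] C1_gradient_continuous[OF fD] C1_gradient_continuous[OF h(2)]) auto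
    have 2: "norm (?B (grad h) - ?B D) \<le> e * (LINT x:C|lebesgue. norm (a x))"
    proof (rule pairing_close[OF ai C(1,2)])
      show "continuous_on UNIV (\<lambda>x. D x $ i)" "continuous_on UNIV (\<lambda>x. grad h x $ i)"
        using fD h(2) unfolding C1_gradient_def by (auto intro!: continuous_intros)
      show "\<bar>grad h x $ i - D x $ i\<bar> \<le> e" for x
        using component_le_norm_cart[of "grad h x - D x" i] h(4)[of x] by simp
    qed (use C(3) h(5) in auto)
    have "?A h = - ?B (grad h)" using a h(1) by (auto simp: is_weak_gradient_def)
    then have "?A f + ?B D = - ((?A h - ?A f) + (?B (grad h) - ?B D))" by simp
    also have "norm \<dots> \<le> norm (?A h - ?A f) + norm (?B (grad h) - ?B D)"
      unfolding norm_minus_cancel by (rule norm_triangle_ineq)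
    finally show "norm (?A f + ?B D)
        \<le> e * ((LINT x:C|lebesgue. norm (g x $ i)) + (LINT x:C|lebesgue. norm (a x)))"
      using 1 2 by (simp add: distrib_left)
  qed
  then show ?thesis by (simp add: eq_neg_iff_add_eq_0)
qed

lemma weak_divergence_C1_compact:
  fixes F :: "real^'n \<Rightarrow> complex^'n"
  assumes S: "open S" and u: "is_weak_divergence S F u" and f: "C1_compact S f D"
  shows "(LINT x:S|lebesgue. f x *\<^sub>R u x)
    = - (LINT x:S|lebesgue. (\<Sum>i\<in>UNIV. (D x $ i) *\<^sub>R F x $ i))"
proof -
  obtain C where C: "compact C" "C \<subseteq> S" "\<forall>x. x \<notin> C \<longrightarrow> f x = 0 \<and> D x = 0"
    and ap: "\<forall>e>0. \<exists>g. test_function S g \<and> C1_gradient g (grad g) \<and>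
       (\<forall>x. \<bar>g x - f x\<bar> \<le> e \<and> norm (grad g x - D x) \<le> e) \<and> (\<forall>x. x \<notin> C \<longrightarrow> g x = 0 \<and> grad g x = 0)"
    by (rule test_function_approximation[OF S f]) (rule that; assumption)
  have fD: "C1_gradient f D" using f by (simp add: C1_compact_def)
  have ui: "set_integrable lebesgue C u" and Fi: "set_integrable lebesgue C (\<lambda>x. F x $ i)" for i
    using u C by (auto simp: is_weak_divergence_def locally_integrable_on_def intro: set_integrable_vec_nth)
  let ?A = "\<lambda>f. LINT x:S|lebesgue. f x *\<^sub>R u x"
  let ?B = "\<lambda>D i. LINT x:S|lebesgue. (D x $ i) *\<^sub>R F x $ i"
  \<comment> \<open>\<open>pairing_close\<close> compares scalar pairings, so the flux integral is
    split into its components.\<close>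
  have sum: "(LINT x:S|lebesgue. (\<Sum>i\<in>UNIV. (E x $ i) *\<^sub>R F x $ i)) = (\<Sum>i\<in>UNIV. ?B E i)"
    if E: "continuous_on UNIV E" "\<And>x. x \<notin> C \<Longrightarrow> E x = 0" for E :: "real^'n \<Rightarrow> real^'n"
  proof -
    have Ec: "continuous_on UNIV (\<lambda>x. E x $ i)" for i using E(1) by (intro continuous_intros)
    have "set_integrable lebesgue S (\<lambda>x. (E x $ i) *\<^sub>R F x $ i)" for i
      using pairing_integrable[OF Fi C(1) continuous_on_subset[OF Ec subset_UNIV]]
      by (subst set_integrable_support[OF C(2)]) (use E(2) in auto)
    then show ?thesis
      unfolding set_integrable_def set_lebesgue_integral_def scaleR_sum_right
      by (intro Bochner_Integration.integral_sum) blast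
  qed
  have "?A f + (\<Sum>i\<in>UNIV. ?B D i) = 0"
  proof (rule zero_if_norm_le_mult_all)
    fix e :: real assume "e > 0"
    then obtain h where h: "test_function S h" "C1_gradient h (grad h)"
      "\<And>x. \<bar>h x - f x\<bar> \<le> e" "\<And>x. norm (grad h x - D x) \<le> e"
      "\<And>x. x \<notin> C \<Longrightarrow> h x = 0 \<and> grad h x = 0" using ap by blast
    have hc: "continuous_on UNIV (grad h)" using h(2) by (simp add: C1_gradient_def)
    have 1: "norm (?A h - ?A f) \<le> e * (LINT x:C|lebesgue. norm (u x))"
      using C h by (intro pairing_close[OF ui] C1_gradient_continuous[OF fD] C1_gradient_continuous[OF h(2)]) auto
    have 2: "norm (?B (grad h) i - ?B D i) \<le> e * (LINT x:C|lebesgue. norm (F x $ i))" for i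
    proof (rule pairing_close[OF Fi C(1,2)])
      show "continuous_on UNIV (\<lambda>x. D x $ i)" "continuous_on UNIV (\<lambda>x. grad h x $ i)"
        using fD h(2) unfolding C1_gradient_def by (auto intro!: continuous_intros)
      show "\<bar>grad h x $ i - D x $ i\<bar> \<le> e" for x
        using component_le_norm_cart[of "grad h x - D x" i] h(4)[of x] by simp
    qed (use C(3) h(5) in auto)
    have "?A h = - (\<Sum>i\<in>UNIV. ?B (grad h) i)"
      using u h(1) sum[OF hc] h(5) by (auto simp: is_weak_divergence_def)
    then have "?A f + (\<Sum>i\<in>UNIV. ?B D i)
        = - ((?A h - ?A f) + (\<Sum>i\<in>UNIV. ?B (grad h) i - ?B D i))" by (simp add: sum_subtractf)
    also have "norm \<dots> \<le> norm (?A h - ?A f) + norm (\<Sum>i\<in>UNIV. ?B (grad h) i - ?B D i)"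
      unfolding norm_minus_cancel by (rule norm_triangle_ineq)
    also have "\<dots> \<le> e * (LINT x:C|lebesgue. norm (u x))
        + (\<Sum>i\<in>UNIV. e * (LINT x:C|lebesgue. norm (F x $ i)))"
      by (intro add_mono 1 sum_norm_le 2)
    finally show "norm (?A f + (\<Sum>i\<in>UNIV. ?B D i))
        \<le> e * ((LINT x:C|lebesgue. norm (u x)) + (\<Sum>i\<in>UNIV. LINT x:C|lebesgue. norm (F x $ i)))"
      by (simp add: distrib_left sum_distrib_left)
  qed
  moreover have "continuous_on UNIV D" using fD by (simp add: C1_gradient_def)
  ultimately show ?thesis using sum[of D] C(3) by (simp add: eq_neg_iff_add_eq_0)
qed
section \<open>Fourier series on the torus\<close>

definition torus_char :: "int^'n \<Rightarrow> real^'n \<Rightarrow> complex" where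
  "torus_char k \<theta> = exp (\<i> * complex_of_real (rvec k \<bullet> \<theta>))"

lemma rvec_simps [simp]:
  "rvec 0 = 0" "rvec (- k) = - rvec k" "rvec (k + l) = rvec k + rvec l" "rvec (k - l) = rvec k - rvec l"
  by (simp_all add: rvec_def vec_eq_iff)

lemma rvec_inner_Ints: "rvec k \<bullet> rvec m \<in> \<int>"
  by (auto simp: rvec_def inner_vec_def intro!: Ints_sum Ints_mult)

lemma torus_char_simps:
  "torus_char 0 \<theta> = 1"
  "torus_char (k + l) \<theta> = torus_char k \<theta> * torus_char l \<theta>"
  "torus_char (- k) \<theta> = cnj (torus_char k \<theta>)"
  "torus_char k (\<theta> + \<phi>) = torus_char k \<theta> * torus_char k \<phi>"
  "norm (torus_char k \<theta>) = 1"
  by (simp_all add: torus_char_def inner_add_left inner_add_right distrib_left exp_add exp_cnj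
      flip: exp_minus)

lemma torus_char_diff: "torus_char (k - l) \<theta> = torus_char k \<theta> * torus_char (- l) \<theta>"
  using torus_char_simps(2)[of k "- l"] by simp

lemma continuous_on_torus_char [continuous_intros]:
  "continuous_on S f \<Longrightarrow> continuous_on S (\<lambda>x. torus_char k (f x))"
  unfolding torus_char_def by (intro continuous_intros)

definition torus_function :: "(real^'n \<Rightarrow> complex) \<Rightarrow> bool" where
  "torus_function f \<longleftrightarrow> continuous_on UNIV f \<and> (\<forall>\<theta> m. f (\<theta> + (2 * pi) *\<^sub>R rvec m) = f \<theta>)"

lemma torus_function_char: "torus_function (torus_char k)"
proof -
  have "torus_char k ((2 * pi) *\<^sub>R rvec m) = 1" for m
  proof -
    obtain j where "rvec k \<bullet> rvec m = of_int j"
      using rvec_inner_Ints[of k m] by (auto elim: Ints_cases)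
    then have "torus_char k ((2 * pi) *\<^sub>R rvec m) = exp (2 * of_int j * pi * \<i>)"
      by (simp add: torus_char_def algebra_simps)
    then show ?thesis using exp_integer_2pi[of "of_int j"] by simp
  qed
  then show ?thesis
    unfolding torus_function_def by (auto simp: torus_char_simps(4) intro!: continuous_intros)
qed

text \<open>By \<open>lborel_eq\<close>, Lebesgue measure on a Euclidean space is the image of the
  product of one-dimensional measures under the coordinate expansion, which reduces the claim to
  Fubini for finite products.\<close>

lemma lborel_integral_prod:
  fixes f :: "'a::euclidean_space \<Rightarrow> real \<Rightarrow> complex"
  assumes "\<And>b. b \<in> Basis \<Longrightarrow> integrable lborel (f b)"
  shows "(LINT x|lborel. (\<Prod>b\<in>Basis. f b (x \<bullet> b))) = (\<Prod>b\<in>Basis. LINT x|lborel. f b x)"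
proof -
  interpret product_sigma_finite "\<lambda>_::'a. lborel :: real measure" ..
  have m: "f b \<in> borel_measurable borel" if "b \<in> Basis" for b
    using borel_measurable_integrable[OF assms[OF that]] by simp
  have "(LINT x|lborel. (\<Prod>b\<in>Basis. f b (x \<bullet> b)))
      = (LINT g|(\<Pi>\<^sub>M b\<in>Basis. lborel). (\<Prod>b\<in>Basis. f b ((\<Sum>c\<in>Basis. g c *\<^sub>R c) \<bullet> b)))"
  proof (subst lborel_eq, rule integral_distr)
    show "(\<lambda>g. \<Sum>b\<in>Basis. g b *\<^sub>R b) \<in> (\<Pi>\<^sub>M b\<in>Basis. lborel) \<rightarrow>\<^sub>M borel" by measurable
    show "(\<lambda>x. \<Prod>b\<in>Basis. f b (x \<bullet> b)) \<in> borel_measurable borel"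
      by (intro borel_measurable_prod measurable_compose[OF _ m]) auto
  qed
  also have "\<dots> = (LINT g|(\<Pi>\<^sub>M b\<in>Basis. lborel). (\<Prod>b\<in>Basis. f b (g b)))"
    by (simp add: inner_sum_left_Basis)
  also have "\<dots> = (\<Prod>b\<in>Basis. LINT x|lborel. f b x)"
    by (rule product_integral_prod) (use assms in auto)
  finally show ?thesis .
qed

lemma integral_exp_int:
  fixes m :: int
  shows "(LINT x|lborel. indicator {0..2 * pi} x *\<^sub>R exp (\<i> * of_real (of_int m * x)))
    = (if m = 0 then complex_of_real (2 * pi) else 0)"
proof (cases "m = 0")
  case False
  have "((\<lambda>x. exp (\<i> * of_real (of_int m * x))) has_integral
      exp (\<i> * of_real (of_int m * (2 * pi))) / (\<i> * of_int m)
        - exp (\<i> * of_real (of_int m * 0)) / (\<i> * of_int m)) {0..2 * pi}"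
  proof (rule fundamental_theorem_of_calculus)
    fix x :: real
    have "((\<lambda>z. exp (\<i> * (of_int m * z)) / (\<i> * of_int m)) has_field_derivative
        exp (\<i> * (of_int m * of_real x))) (at (of_real x))"
      using False by (auto intro!: derivative_eq_intros simp: algebra_simps)
    from has_vector_derivative_real_field[OF this]
    show "((\<lambda>x. exp (\<i> * of_real (of_int m * x)) / (\<i> * of_int m)) has_vector_derivative
        exp (\<i> * of_real (of_int m * x))) (at x within {0..2 * pi})" by simp
  qed simp
  moreover have "exp (\<i> * of_real (of_int m * (2 * pi))) = 1"
    using exp_integer_2pi[of "of_int m"] by (simp add: algebra_simps)
  ultimately have "integral {0..2 * pi} (\<lambda>x. exp (\<i> * of_real (of_int m * x))) = 0"
    by (simp add: integral_unique)
  moreover have "set_integrable lborel {0..2 * pi} (\<lambda>x. exp (\<i> * of_real (of_int m * x)))"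
    unfolding set_integrable_def by (intro borel_integrable_compact continuous_intros) auto
  ultimately have "(LINT x:{0..2 * pi}|lborel. exp (\<i> * of_real (of_int m * x))) = 0"
    by (simp add: set_borel_integral_eq_integral)
  then show ?thesis
    using False by (simp add: set_lebesgue_integral_def)
qed (simp add: of_real_def)

lemma torus_cube_mem: "x \<in> torus_cube \<longleftrightarrow> (\<forall>b\<in>Basis. x \<bullet> b \<in> {0..2 * pi})"
  by (auto simp: torus_cube_def mem_box Basis_vec_def inner_axis)

lemma compact_torus_cube: "compact torus_cube" by (simp add: torus_cube_def)

lemma torus_set_integrable:
  fixes f :: "real^'n \<Rightarrow> 'b::{banach, second_countable_topology}"
  shows "continuous_on torus_cube f \<Longrightarrow> set_integrable lborel torus_cube f"
  unfolding set_integrable_def by (intro borel_integrable_compact compact_torus_cube)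

lemma torus_integrable:
  fixes f :: "real^'n \<Rightarrow> 'b::banach"
  shows "continuous_on UNIV f \<Longrightarrow> f integrable_on torus_cube"
  unfolding torus_cube_def by (rule integrable_continuous) (auto intro: continuous_on_subset)

text \<open>Orthogonality of the characters. The indicator of the cube and the character both factor
  over the coordinates, and a single nonzero component of \<open>k\<close> makes one factor
  vanish.\<close>

lemma integral_torus_char:
  "integral torus_cube (torus_char k) = (if k = 0 then complex_of_real ((2 * pi) ^ CARD('n)) else 0)"
  for k :: "int^'n"
proof -
  define h where "h b x = indicat_real {0..2 * pi} x *\<^sub>R exp (\<i> * complex_of_real (rvec k \<bullet> b * x))"
    for b :: "real^'n" and x
  have hi: "integrable lborel (h b)" for b
    unfolding h_def by (intro borel_integrable_compact continuous_intros) auto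
  have ind: "indicat_real torus_cube x = (\<Prod>b\<in>Basis. indicat_real {0..2 * pi} (x \<bullet> b))" for x :: "real^'n"
  proof (cases "x \<in> torus_cube")
    case True then show ?thesis by (simp add: torus_cube_mem)
  next
    case False
    then show ?thesis by (force simp: prod_zero_iff torus_cube_mem indicator_def)
  qed
  have ex: "torus_char k x = (\<Prod>b\<in>Basis. exp (\<i> * complex_of_real (rvec k \<bullet> b * (x \<bullet> b))))" for x
    unfolding torus_char_def euclidean_inner[of "rvec k" x]
    by (simp add: sum_distrib_left exp_sum)
  have "integral torus_cube (torus_char k) = (LINT x:torus_cube|lborel. torus_char k x)"
    by (rule set_borel_integral_eq_integral(2)[symmetric],
        rule torus_set_integrable, rule continuous_on_torus_char, rule continuous_on_id)
  also have "\<dots> = (LINT x|lborel. (\<Prod>b\<in>Basis. h b (x \<bullet> b)))"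
    unfolding set_lebesgue_integral_def h_def ind ex
    by (simp add: scaleR_conv_of_real prod.distrib)
  also have "\<dots> = (\<Prod>b\<in>Basis. LINT x|lborel. h b x)"
    by (rule lborel_integral_prod) (rule hi)
  also have "\<dots> = (\<Prod>i\<in>UNIV. LINT x|lborel. h (axis i 1) x)"
  proof -
    have B: "(Basis :: (real^'n) set) = (\<lambda>i. axis i 1) ` UNIV" by (auto simp: Basis_vec_def)
    show ?thesis unfolding B by (subst prod.reindex) (auto simp: inj_on_def axis_eq_axis)
  qed
  also have "\<dots> = (\<Prod>i\<in>UNIV. if k $ i = 0 then complex_of_real (2 * pi) else 0)"
  proof (rule prod.cong[OF refl])
    fix i
    have "rvec k \<bullet> axis i 1 = of_int (k $ i)" by (simp add: inner_axis rvec_def)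
    then show "(LINT x|lborel. h (axis i 1) x) = (if k $ i = 0 then complex_of_real (2 * pi) else 0)"
      unfolding h_def using integral_exp_int[of "k $ i"] by simp
  qed
  also have "\<dots> = (if k = 0 then complex_of_real ((2 * pi) ^ CARD('n)) else 0)"
  proof (cases "k = 0")
    case False
    then obtain i where "k $ i \<noteq> 0" by (auto simp: vec_eq_iff)
    then show ?thesis using False by (auto simp: prod_zero_iff)
  qed simp
  finally show ?thesis .
qed

section \<open>Uniform density of trigonometric polynomials\<close>

inductive trig_poly :: "(real^'n \<Rightarrow> complex) \<Rightarrow> bool" where
  char: "trig_poly (\<lambda>\<theta>. c * torus_char k \<theta>)"
| add: "trig_poly p \<Longrightarrow> trig_poly q \<Longrightarrow> trig_poly (\<lambda>\<theta>. p \<theta> + q \<theta>)"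

lemma trig_poly_const: "trig_poly (\<lambda>\<theta>. c)"
  using trig_poly.char[of c 0] by (simp add: torus_char_simps)

lemma trig_poly_cmult: "trig_poly p \<Longrightarrow> trig_poly (\<lambda>\<theta>. c * p \<theta>)"
proof (induction rule: trig_poly.induct)
  case (char d k) then show ?case using trig_poly.char[of "c * d" k] by (simp add: mult.assoc)
next
  case (add p q) then show ?case by (simp add: distrib_left trig_poly.add)
qed

lemma trig_poly_mult:
  assumes "trig_poly p" "trig_poly q" shows "trig_poly (\<lambda>\<theta>. p \<theta> * q \<theta>)"
  using assms(1)
proof (induction rule: trig_poly.induct)
  case (char c k)
  from assms(2) have "trig_poly (\<lambda>\<theta>. torus_char k \<theta> * q \<theta>)"
  proof (induction rule: trig_poly.induct)
    case (char d l)
    then show ?case using trig_poly.char[of d "k + l"] by (simp add: torus_char_simps ac_simps)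
  next
    case (add p q) then show ?case by (simp add: distrib_left trig_poly.add)
  qed
  from trig_poly_cmult[OF this, of c] show ?case by (simp add: mult.assoc)
next
  case (add p r) then show ?case by (simp add: distrib_right trig_poly.add)
qed

lemma trig_poly_sum:
  "finite A \<Longrightarrow> (\<And>i. i \<in> A \<Longrightarrow> trig_poly (p i)) \<Longrightarrow> trig_poly (\<lambda>\<theta>. \<Sum>i\<in>A. p i \<theta>)"
  by (induction A rule: finite_induct) (auto intro: trig_poly_const trig_poly.add)

lemma trig_poly_expansion:
  assumes "trig_poly p"
  shows "\<exists>F c. finite F \<and> p = (\<lambda>\<theta>. \<Sum>k\<in>F. c k * torus_char k \<theta>)"
  using assms
proof (induction rule: trig_poly.induct)
  case (char c k)
  show ?case by (intro exI[of _ "{k}"] exI[of _ "\<lambda>_. c"]) simp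
next
  case (add p q)
  then obtain F c G d where F: "finite F" "p = (\<lambda>\<theta>. \<Sum>k\<in>F. c k * torus_char k \<theta>)"
    and G: "finite G" "q = (\<lambda>\<theta>. \<Sum>k\<in>G. d k * torus_char k \<theta>)" by blast
  let ?c = "\<lambda>k. (if k \<in> F then c k else 0) + (if k \<in> G then d k else 0)"
  have "(\<Sum>k\<in>F \<union> G. ?c k * torus_char k \<theta>) = p \<theta> + q \<theta>" for \<theta>
  proof -
    have "(\<Sum>k\<in>F \<union> G. ?c k * torus_char k \<theta>)
        = (\<Sum>k\<in>F \<union> G. if k \<in> F then c k * torus_char k \<theta> else 0)
          + (\<Sum>k\<in>F \<union> G. if k \<in> G then d k * torus_char k \<theta> else 0)"
      by (subst sum.distrib[symmetric], rule sum.cong) (auto simp: distrib_right)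
    also have "\<dots> = p \<theta> + q \<theta>"
    proof -
      have "(F \<union> G) \<inter> F = F" "(F \<union> G) \<inter> G = G" by auto
      then show ?thesis
        using F G sum.inter_restrict[of "F \<union> G" "\<lambda>k. c k * torus_char k \<theta>" F]
          sum.inter_restrict[of "F \<union> G" "\<lambda>k. d k * torus_char k \<theta>" G] by simp
    qed
    finally show ?thesis .
  qed
  then show ?case using F(1) G(1) by (intro exI[of _ "F \<union> G"] exI[of _ ?c]) auto
qed

text \<open>The torus as a product of unit circles, a compact subset of a real Euclidean space.
  Stone-Weierstrass for real polynomials applies to the image, and polynomials restricted to it
  become trigonometric.\<close>

definition torus_embed :: "real^'n \<Rightarrow> complex^'n" where
  "torus_embed \<theta> = (\<chi> i. exp (\<i> * complex_of_real (\<theta> $ i)))"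

lemma trig_poly_of_polynomial:
  assumes "real_polynomial_function h"
  shows "trig_poly (\<lambda>\<theta>. complex_of_real (h (torus_embed \<theta>)))"
  using assms
proof (induction rule: real_polynomial_function.induct)
  case (linear h)
  interpret bounded_linear h by fact
  have z: "h z = (\<Sum>i\<in>UNIV. Re (z $ i) * h (axis i 1) + Im (z $ i) * h (axis i \<i>))" for z
  proof -
    have "z = (\<Sum>i\<in>UNIV. Re (z $ i) *\<^sub>R axis i 1 + Im (z $ i) *\<^sub>R axis i \<i>)"
      by (simp add: vec_eq_iff axis_def complex_eq_iff if_distrib cong: if_cong)
    then have "h z = h (\<Sum>i\<in>UNIV. Re (z $ i) *\<^sub>R axis i 1 + Im (z $ i) *\<^sub>R axis i \<i>)" by simp
    then show ?thesis by (simp add: sum add scaleR)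
  qed
  have k: "torus_char (axis i 1) \<theta> = exp (\<i> * complex_of_real (\<theta> $ i))" for i and \<theta> :: "real^'n"
  proof -
    have "rvec (axis i 1) = axis i (1::real)" by (simp add: rvec_def vec_eq_iff axis_def)
    then show ?thesis by (simp add: torus_char_def inner_axis inner_commute[of "axis i 1"])
  qed
  \<comment> \<open>Real coordinates are combinations of \<open>w\<close> and \<open>cnj w\<close>.
    On the unit circles conjugation negates the frequency, so both terms are multiples of
    characters.\<close>
  have ri: "complex_of_real (Re w * a + Im w * b)
      = (of_real a / 2 + of_real b / (2 * \<i>)) * w + (of_real a / 2 - of_real b / (2 * \<i>)) * cnj w"
    for w a b
    by (simp add: complex_eq_iff)
  have eq: "complex_of_real (h (torus_embed \<theta>)) = (\<Sum>i\<in>UNIV.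
       (of_real (h (axis i 1)) / 2 + of_real (h (axis i \<i>)) / (2 * \<i>)) * torus_char (axis i 1) \<theta>
     + (of_real (h (axis i 1)) / 2 - of_real (h (axis i \<i>)) / (2 * \<i>)) * torus_char (- axis i 1) \<theta>)" for \<theta>
    by (subst z, subst of_real_sum, rule sum.cong[OF refl])
      (simp only: ri torus_embed_def vec_lambda_beta torus_char_simps(3) k)
  show ?case unfolding eq by (intro trig_poly_sum trig_poly.add trig_poly.char) auto
next
  case (const c) then show ?case by (rule trig_poly_const)
next
  case (add f g) then show ?case by (simp add: trig_poly.add)
next
  case (mult f g) then show ?case by (simp add: trig_poly_mult)
qed

lemma torus_embed_eq_imp:
  assumes f: "torus_function f" and eq: "torus_embed \<theta> = torus_embed \<phi>"
  shows "f \<theta> = f \<phi>"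
proof -
  have "\<forall>i. \<exists>n::int. \<theta> $ i = \<phi> $ i + 2 * pi * of_int n"
  proof
    fix i
    have "exp (\<i> * complex_of_real (\<theta> $ i)) = exp (\<i> * complex_of_real (\<phi> $ i))"
      using eq by (simp add: torus_embed_def vec_eq_iff)
    then obtain n :: int where "\<i> * complex_of_real (\<theta> $ i)
        = \<i> * complex_of_real (\<phi> $ i) + (of_int (2 * n) * pi) * \<i>"
      unfolding exp_eq by blast
    then have "\<theta> $ i = \<phi> $ i + 2 * pi * of_int n" by (simp add: complex_eq_iff)
    then show "\<exists>n::int. \<theta> $ i = \<phi> $ i + 2 * pi * of_int n" ..
  qed
  then obtain n where n: "\<And>i. \<theta> $ i = \<phi> $ i + 2 * pi * of_int (n i)" by metis
  have "\<theta> = \<phi> + (2 * pi) *\<^sub>R rvec (\<chi> i. n i)" by (simp add: vec_eq_iff n rvec_def)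
  then show ?thesis using f by (simp add: torus_function_def)
qed

lemma trig_poly_dense:
  fixes f :: "real^'n \<Rightarrow> complex"
  assumes f: "torus_function f" and e: "e > 0"
  obtains p where "trig_poly p" "\<forall>\<theta>. norm (f \<theta> - p \<theta>) < e"
proof -
  define T where "T = torus_embed ` (torus_cube :: (real^'n) set)"
  have ec: "continuous_on S torus_embed" for S :: "(real^'n) set"
    unfolding torus_embed_def by (intro continuous_intros)
  have onT: "\<exists>\<phi>\<in>torus_cube. torus_embed \<theta> = torus_embed \<phi>" for \<theta> :: "real^'n"
  proof (intro bexI)
    let ?\<phi> = "\<chi> i. Arg2pi (exp (\<i> * complex_of_real (\<theta> $ i)))"
    show "torus_embed \<theta> = torus_embed ?\<phi>"
      using Arg2pi_eq[of "exp (\<i> * complex_of_real (\<theta> $ i))" for i]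
      by (simp add: torus_embed_def vec_eq_iff)
    show "?\<phi> \<in> torus_cube"
      using Arg2pi less_imp_le by (auto simp: torus_cube_mem Basis_vec_def inner_axis)
  qed
  \<comment> \<open>\<open>f\<close> descends to the image of the torus: angles with equal image
    differ by periods, so the choice does not affect the value.\<close>
  define F where "F z = f (SOME \<phi>. torus_embed \<phi> = z)" for z
  have F: "F (torus_embed \<theta>) = f \<theta>" for \<theta>
    unfolding F_def by (rule torus_embed_eq_imp[OF f]) (metis (mono_tags) someI)
  have Tc: "compact T" unfolding T_def by (intro compact_continuous_image ec compact_torus_cube)
  \<comment> \<open>This is the quotient map argument. The preimage of a closed set under
    \<open>F\<close> is the image of a closed part of the compact cube, hence compact.\<close>
  have Fc: "continuous_on T F"
    unfolding continuous_on_closed_vimage[OF compact_imp_closed[OF Tc]]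
  proof (intro allI impI)
    fix B :: "complex set" assume "closed B"
    have "F -` B \<inter> T = torus_embed ` (f -` B \<inter> torus_cube)" by (auto simp: T_def F)
    moreover have "compact (f -` B \<inter> torus_cube)"
    proof -
      have "closed (f -` B)" using f \<open>closed B\<close> unfolding torus_function_def
        by (auto intro: closed_vimage)
      then show ?thesis by (intro closed_Int_compact compact_torus_cube)
    qed
    ultimately show "closed (F -` B \<inter> T)"
      by (simp add: compact_imp_closed compact_continuous_image ec)
  qed
  have e2: "e / 2 > 0" using e by simp
  have "continuous_on T (\<lambda>z. Re (F z))" "continuous_on T (\<lambda>z. Im (F z))"
    using Fc by (auto intro!: continuous_intros)
  note c = this
  obtain g where g: "real_polynomial_function g" "\<And>z. z \<in> T \<Longrightarrow> \<bar>Re (F z) - g z\<bar> < e / 2"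
    by (rule Stone_Weierstrass_real_polynomial_function[OF Tc c(1) e2]) blast
  obtain h where h: "real_polynomial_function h" "\<And>z. z \<in> T \<Longrightarrow> \<bar>Im (F z) - h z\<bar> < e / 2"
    by (rule Stone_Weierstrass_real_polynomial_function[OF Tc c(2) e2]) blast
  show ?thesis
  proof
    show "trig_poly (\<lambda>\<theta>. of_real (g (torus_embed \<theta>)) + \<i> * of_real (h (torus_embed \<theta>)))"
      by (intro trig_poly.add trig_poly_cmult trig_poly_of_polynomial g h)
    show "\<forall>\<theta>. norm (f \<theta> - (of_real (g (torus_embed \<theta>)) + \<i> * of_real (h (torus_embed \<theta>)))) < e"
    proof
      fix \<theta> :: "real^'n"
      have "torus_embed \<theta> \<in> T" using onT[of \<theta>] by (auto simp: T_def)
      from g(2)[OF this] h(2)[OF this]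
      have "\<bar>Re (f \<theta>) - g (torus_embed \<theta>)\<bar> + \<bar>Im (f \<theta>) - h (torus_embed \<theta>)\<bar> < e" by (simp add: F)
      moreover have "norm (f \<theta> - (of_real (g (torus_embed \<theta>)) + \<i> * of_real (h (torus_embed \<theta>))))
          \<le> \<bar>Re (f \<theta>) - g (torus_embed \<theta>)\<bar> + \<bar>Im (f \<theta>) - h (torus_embed \<theta>)\<bar>"
        using cmod_le[of "f \<theta> - (of_real (g (torus_embed \<theta>)) + \<i> * of_real (h (torus_embed \<theta>)))"]
        by simp
      ultimately show "norm (f \<theta> - (of_real (g (torus_embed \<theta>)) + \<i> * of_real (h (torus_embed \<theta>)))) < e"
        by simp
    qed
  qed
qed

section \<open>Translation invariance of the torus integral\<close>

lemma torus_functionD: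
  assumes "torus_function f"
  shows "continuous_on S f" "f (\<theta> + (2 * pi) *\<^sub>R rvec m) = f \<theta>"
  using assms by (auto simp: torus_function_def intro: continuous_on_subset)

lemma torus_function_mult:
  "torus_function f \<Longrightarrow> torus_function g \<Longrightarrow> torus_function (\<lambda>\<theta>. f \<theta> * g \<theta>)"
  by (auto simp: torus_function_def intro!: continuous_intros)

lemma torus_function_shift:
  assumes "torus_function f" shows "torus_function (\<lambda>\<theta>. f (\<theta> + \<phi>))"
proof -
  have "f (\<theta> + (2 * pi) *\<^sub>R rvec m + \<phi>) = f (\<theta> + \<phi>)" for \<theta> m
    using torus_functionD(2)[OF assms, of "\<theta> + \<phi>" m] by (simp add: ac_simps)
  moreover have "continuous_on UNIV (\<lambda>\<theta>. f (\<theta> + \<phi>))"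
    by (intro continuous_on_compose2[OF torus_functionD(1)[OF assms, of UNIV]] continuous_intros) auto
  ultimately show ?thesis by (simp add: torus_function_def)
qed

lemma measure_torus_cube: "measure lborel (torus_cube :: (real^'n) set) = (2 * pi) ^ CARD('n)"
proof -
  have "of_real (measure lborel (torus_cube :: (real^'n) set))
      = integral (torus_cube :: (real^'n) set) (\<lambda>_. 1 :: complex)"
    by (simp add: torus_cube_def scaleR_conv_of_real)
  also have "\<dots> = integral (torus_cube :: (real^'n) set) (torus_char 0)"
    by (simp add: torus_char_simps(1)[abs_def])
  also have "\<dots> = of_real ((2 * pi) ^ CARD('n))" by (simp add: integral_torus_char)
  finally show ?thesis by (simp only: of_real_eq_iff)
qed

lemma torus_integral_norm_le:
  fixes f :: "real^'n \<Rightarrow> complex"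
  assumes "continuous_on UNIV f" "\<And>\<theta>. norm (f \<theta>) \<le> B"
  shows "norm (integral torus_cube f) \<le> B * (2 * pi) ^ CARD('n)"
proof -
  have "norm (integral torus_cube f) \<le> integral (torus_cube :: (real^'n) set) (\<lambda>_. B)"
    by (rule Henstock_Kurzweil_Integration.integral_norm_bound_integral)
      (use assms torus_integrable[of f] in \<open>auto simp: torus_cube_def\<close>)
  also have "\<dots> = B * (2 * pi) ^ CARD('n)"
    using measure_torus_cube[where 'n='n] by (simp add: torus_cube_def)
  finally show ?thesis .
qed

lemma integral_trig_sum:
  fixes g :: "real^'n \<Rightarrow> complex"
  assumes "continuous_on UNIV g" "finite F"
  shows "integral torus_cube (\<lambda>\<theta>. g \<theta> * (\<Sum>k\<in>F. c k * torus_char (\<sigma> k) \<theta>))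
    = (\<Sum>k\<in>F. c k * integral torus_cube (\<lambda>\<theta>. g \<theta> * torus_char (\<sigma> k) \<theta>))"
proof -
  have i: "(\<lambda>\<theta>. c k * (g \<theta> * torus_char (\<sigma> k) \<theta>)) integrable_on torus_cube" for k
    by (intro torus_integrable continuous_intros assms)
  have "integral torus_cube (\<lambda>\<theta>. g \<theta> * (\<Sum>k\<in>F. c k * torus_char (\<sigma> k) \<theta>))
      = integral torus_cube (\<lambda>\<theta>. \<Sum>k\<in>F. c k * (g \<theta> * torus_char (\<sigma> k) \<theta>))"
    by (simp add: sum_distrib_left ac_simps)
  also have "\<dots> = (\<Sum>k\<in>F. integral torus_cube (\<lambda>\<theta>. c k * (g \<theta> * torus_char (\<sigma> k) \<theta>)))"
    by (rule Henstock_Kurzweil_Integration.integral_sum[OF assms(2)]) (rule i)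
  also have "\<dots> = (\<Sum>k\<in>F. c k * integral torus_cube (\<lambda>\<theta>. g \<theta> * torus_char (\<sigma> k) \<theta>))"
    by (simp add: Henstock_Kurzweil_Integration.integral_mult_right)
  finally show ?thesis .
qed

text \<open>On a character the shift acts as the factor \<open>torus_char k \<phi>\<close>, which is
  1 for \<open>k = 0\<close>, and for all other frequencies the integral is 0 anyway. Linearity
  gives trigonometric polynomials and uniform density the general case; the periodicity of
  \<open>f\<close> enters through density.\<close>

lemma torus_integral_shift:
  fixes f :: "real^'n \<Rightarrow> complex"
  assumes f: "torus_function f"
  shows "integral torus_cube (\<lambda>\<theta>. f (\<theta> + \<phi>)) = integral torus_cube f"
proof -
  have p: "integral torus_cube (\<lambda>\<theta>. p (\<theta> + \<phi>)) = integral torus_cube p"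
    if tp: "trig_poly p" for p :: "real^'n \<Rightarrow> complex"
  proof -
    obtain F c where F: "finite F" "p = (\<lambda>\<theta>. \<Sum>k\<in>F. c k * torus_char k \<theta>)"
      using trig_poly_expansion[OF tp] by blast
    have "integral torus_cube (\<lambda>\<theta>. p (\<theta> + \<phi>))
        = integral torus_cube (\<lambda>\<theta>. 1 * (\<Sum>k\<in>F. (c k * torus_char k \<phi>) * torus_char k \<theta>))"
      by (simp add: F torus_char_simps(4) ac_simps)
    also have "\<dots> = (\<Sum>k\<in>F. (c k * torus_char k \<phi>) * integral torus_cube (\<lambda>\<theta>. 1 * torus_char k \<theta>))"
      by (rule integral_trig_sum) (use F in auto)
    also have "\<dots> = (\<Sum>k\<in>F. c k * integral torus_cube (\<lambda>\<theta>. 1 * torus_char k \<theta>))"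
      by (rule sum.cong) (auto simp: integral_torus_char torus_char_simps(1))
    also have "\<dots> = integral torus_cube (\<lambda>\<theta>. 1 * (\<Sum>k\<in>F. c k * torus_char k \<theta>))"
      by (rule integral_trig_sum[symmetric]) (use F in auto)
    finally show ?thesis by (simp add: F)
  qed
  have "integral torus_cube (\<lambda>\<theta>. f (\<theta> + \<phi>)) - integral torus_cube f = 0"
  proof (rule zero_if_norm_le_mult_all)
    fix e :: real assume "e > 0"
    then obtain p where tp: "trig_poly p" and pe: "\<forall>\<theta>. norm (f \<theta> - p \<theta>) < e"
      by (rule trig_poly_dense[OF f]) (rule that; assumption)
    obtain F c where F: "finite F" "p = (\<lambda>\<theta>. \<Sum>k\<in>F. c k * torus_char k \<theta>)"
      using trig_poly_expansion[OF tp] by blast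
    have pc: "continuous_on S p" for S unfolding F by (intro continuous_intros)
    have fs: "continuous_on UNIV (\<lambda>\<theta>. f (\<theta> + \<phi>))"
      using torus_function_shift[OF f] by (simp add: torus_function_def)
    have ps: "continuous_on UNIV (\<lambda>\<theta>. p (\<theta> + \<phi>))"
      unfolding F by (intro continuous_intros)
    let ?I = "integral (torus_cube :: (real^'n) set)"
    have "?I (\<lambda>\<theta>. f (\<theta> + \<phi>)) - ?I f
        = ?I (\<lambda>\<theta>. f (\<theta> + \<phi>) - p (\<theta> + \<phi>)) - ?I (\<lambda>\<theta>. f \<theta> - p \<theta>)"
      using p[OF tp] torus_functionD(1)[OF f] pc fs ps
      by (simp add: Henstock_Kurzweil_Integration.integral_diff torus_integrable)
    also have "norm \<dots> \<le> norm (?I (\<lambda>\<theta>. f (\<theta> + \<phi>) - p (\<theta> + \<phi>))) + norm (?I (\<lambda>\<theta>. f \<theta> - p \<theta>))"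
      by (rule norm_triangle_ineq4)
    also have "\<dots> \<le> e * (2 * pi) ^ CARD('n) + e * (2 * pi) ^ CARD('n)"
      by (intro add_mono torus_integral_norm_le continuous_intros fs ps pc torus_functionD(1)[OF f])
        (use pe less_imp_le in auto)
    finally show "norm (?I (\<lambda>\<theta>. f (\<theta> + \<phi>)) - ?I f) \<le> e * (2 * (2 * pi) ^ CARD('n))"
      by (simp add: ac_simps)
  qed
  then show ?thesis by simp
qed

section \<open>Fourier coefficients and Parseval with a remainder\<close>

definition torus_coeff :: "(real^'n \<Rightarrow> complex) \<Rightarrow> int^'n \<Rightarrow> complex" where
  "torus_coeff f k = integral torus_cube (\<lambda>\<theta>. f \<theta> * torus_char (- k) \<theta>)
     / complex_of_real ((2 * pi) ^ CARD('n))"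

lemma torus_coeff_integral:
  "integral torus_cube (\<lambda>\<theta>. f \<theta> * torus_char k \<theta>)
     = complex_of_real ((2 * pi) ^ CARD('n)) * torus_coeff f (- k)" for f :: "real^'n \<Rightarrow> complex"
  by (simp add: torus_coeff_def)

text \<open>For fixed action the flow is a translation of the angles. This is how the oscillating
  factor \<open>exp (\<i> * t * \<phi>\<^sub>k)\<close> enters the problem.\<close>

lemma torus_coeff_shift:
  fixes f :: "real^'n \<Rightarrow> complex"
  assumes f: "torus_function f"
  shows "torus_coeff (\<lambda>\<theta>. f (\<theta> + \<phi>)) k = torus_char k \<phi> * torus_coeff f k"
proof -
  have "integral torus_cube (\<lambda>\<theta>. f (\<theta> + \<phi>) * torus_char (- k) \<theta>)
      = integral torus_cube (\<lambda>\<theta>. torus_char k \<phi> * (f (\<theta> + \<phi>) * torus_char (- k) (\<theta> + \<phi>)))"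
  proof (rule arg_cong[where f="integral torus_cube"], rule ext)
    fix \<theta> :: "real^'n"
    have "torus_char k \<phi> * torus_char (- k) \<phi> = 1"
      using torus_char_simps(2)[of k "- k" \<phi>] by (simp add: torus_char_simps(1))
    then show "f (\<theta> + \<phi>) * torus_char (- k) \<theta>
        = torus_char k \<phi> * (f (\<theta> + \<phi>) * torus_char (- k) (\<theta> + \<phi>))"
      by (simp add: torus_char_simps(4) ac_simps)
  qed
  also have "\<dots> = torus_char k \<phi> * integral torus_cube (\<lambda>\<theta>. f \<theta> * torus_char (- k) \<theta>)"
    using torus_integral_shift[OF torus_function_mult[OF f torus_function_char[of "- k"]], of \<phi>]
    by (simp add: Henstock_Kurzweil_Integration.integral_mult_right)
  finally show ?thesis by (simp add: torus_coeff_def)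
qed

text \<open>The Fourier sum is the orthogonal projection onto the span of the characters in
  \<open>F\<close>. Its error \<open>r\<close> is orthogonal to that span, which contains the
  difference \<open>q\<close> between the Fourier sum and its competitor. As \<open>r + q\<close> is
  the competitor's error, Pythagoras gives the comparison.\<close>

lemma fourier_sum_best_approximation:
  fixes f :: "real^'n \<Rightarrow> complex" and c :: "int^'n \<Rightarrow> complex"
  assumes f: "continuous_on UNIV f" and F: "finite F"
  defines "S \<equiv> \<lambda>\<theta>. \<Sum>k\<in>F. torus_coeff f k * torus_char k \<theta>"
  shows "integral torus_cube (\<lambda>\<theta>. (norm (f \<theta> - S \<theta>))\<^sup>2)
    \<le> integral torus_cube (\<lambda>\<theta>. (norm (f \<theta> - (\<Sum>k\<in>F. c k * torus_char k \<theta>)))\<^sup>2)"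
proof -
  let ?I = "integral (torus_cube :: (real^'n) set)"
  let ?N = "complex_of_real ((2 * pi) ^ CARD('n))"
  define r where "r \<theta> = f \<theta> - S \<theta>" for \<theta>
  define d where "d k = torus_coeff f k - c k" for k
  define q where "q \<theta> = (\<Sum>k\<in>F. d k * torus_char k \<theta>)" for \<theta>
  have Sc: "continuous_on UNIV S" unfolding S_def by (intro continuous_intros)
  have rc: "continuous_on UNIV r" unfolding r_def by (intro continuous_intros f Sc)
  have qc: "continuous_on UNIV q" unfolding q_def by (intro continuous_intros)
  have orth: "?I (\<lambda>\<theta>. r \<theta> * torus_char (- k) \<theta>) = 0" if k: "k \<in> F" for k
  proof -
    have "?I (\<lambda>\<theta>. S \<theta> * torus_char (- k) \<theta>)
        = ?I (\<lambda>\<theta>. torus_char (- k) \<theta> * (\<Sum>l\<in>F. torus_coeff f l * torus_char l \<theta>))"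
      by (simp add: S_def mult.commute)
    also have "\<dots> = (\<Sum>l\<in>F. torus_coeff f l * ?I (\<lambda>\<theta>. torus_char (- k) \<theta> * torus_char l \<theta>))"
      by (rule integral_trig_sum) (intro continuous_intros F)+
    also have "\<dots> = (\<Sum>l\<in>F. if l = k then torus_coeff f k * ?N else 0)"
    proof (rule sum.cong[OF refl])
      fix l
      have "?I (\<lambda>\<theta>. torus_char (- k) \<theta> * torus_char l \<theta>) = ?I (torus_char (l - k))"
        by (simp add: torus_char_diff[abs_def] mult.commute)
      then show "torus_coeff f l * ?I (\<lambda>\<theta>. torus_char (- k) \<theta> * torus_char l \<theta>)
          = (if l = k then torus_coeff f k * ?N else 0)" by (simp add: integral_torus_char)
    qed
    also have "\<dots> = torus_coeff f k * ?N" using k F by simp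
    also have "\<dots> = ?I (\<lambda>\<theta>. f \<theta> * torus_char (- k) \<theta>)" by (simp add: torus_coeff_def)
    finally have "?I (\<lambda>\<theta>. f \<theta> * torus_char (- k) \<theta>) - ?I (\<lambda>\<theta>. S \<theta> * torus_char (- k) \<theta>) = 0"
      by simp
    moreover have "?I (\<lambda>\<theta>. f \<theta> * torus_char (- k) \<theta> - S \<theta> * torus_char (- k) \<theta>)
        = ?I (\<lambda>\<theta>. f \<theta> * torus_char (- k) \<theta>) - ?I (\<lambda>\<theta>. S \<theta> * torus_char (- k) \<theta>)"
      by (intro Henstock_Kurzweil_Integration.integral_diff torus_integrable continuous_intros f Sc)
    ultimately show ?thesis by (simp add: r_def left_diff_distrib)
  qed
  have "?I (\<lambda>\<theta>. r \<theta> * cnj (q \<theta>)) = ?I (\<lambda>\<theta>. r \<theta> * (\<Sum>k\<in>F. cnj (d k) * torus_char (- k) \<theta>))"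
    by (simp add: q_def torus_char_simps(3))
  also have "\<dots> = (\<Sum>k\<in>F. cnj (d k) * ?I (\<lambda>\<theta>. r \<theta> * torus_char (- k) \<theta>))"
    by (rule integral_trig_sum[OF rc F])
  also have "\<dots> = 0" using orth by simp
  finally have z: "?I (\<lambda>\<theta>. r \<theta> * cnj (q \<theta>)) = 0" .
  have ci: "(\<lambda>\<theta>. r \<theta> * cnj (q \<theta>)) integrable_on torus_cube"
    by (intro torus_integrable continuous_intros rc qc)
  have "?I (\<lambda>\<theta>. Re (r \<theta> * cnj (q \<theta>))) = 0"
    using integral_linear[OF ci bounded_linear_Re] z by (simp add: o_def)
  have r2: "(\<lambda>\<theta>. (norm (r \<theta>))\<^sup>2) integrable_on torus_cube"
    "(\<lambda>\<theta>. 2 * Re (r \<theta> * cnj (q \<theta>))) integrable_on torus_cube"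
    "(\<lambda>\<theta>. (norm (r \<theta> + q \<theta>))\<^sup>2) integrable_on torus_cube"
    by (intro torus_integrable continuous_intros rc qc)+
  have "?I (\<lambda>\<theta>. (norm (r \<theta>))\<^sup>2) = ?I (\<lambda>\<theta>. (norm (r \<theta>))\<^sup>2) + ?I (\<lambda>\<theta>. 2 * Re (r \<theta> * cnj (q \<theta>)))"
    using \<open>?I (\<lambda>\<theta>. Re (r \<theta> * cnj (q \<theta>))) = 0\<close>
    by (simp only: Henstock_Kurzweil_Integration.integral_mult_right)
  also have "\<dots> = ?I (\<lambda>\<theta>. (norm (r \<theta>))\<^sup>2 + 2 * Re (r \<theta> * cnj (q \<theta>)))"
    by (rule Henstock_Kurzweil_Integration.integral_add[OF r2(1,2), symmetric])
  also have "\<dots> \<le> ?I (\<lambda>\<theta>. (norm (r \<theta> + q \<theta>))\<^sup>2)"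
  proof (rule Henstock_Kurzweil_Integration.integral_le)
    fix \<theta>
    have "(norm (r \<theta> + q \<theta>))\<^sup>2 = (norm (r \<theta>))\<^sup>2 + 2 * Re (r \<theta> * cnj (q \<theta>)) + (norm (q \<theta>))\<^sup>2"
      unfolding cmod_power2 by (simp add: power2_eq_square algebra_simps)
    then show "(norm (r \<theta>))\<^sup>2 + 2 * Re (r \<theta> * cnj (q \<theta>)) \<le> (norm (r \<theta> + q \<theta>))\<^sup>2" by simp
  qed (use r2 in \<open>auto intro: Henstock_Kurzweil_Integration.integrable_add\<close>)
  also have "(\<lambda>\<theta>. (norm (r \<theta> + q \<theta>))\<^sup>2)
      = (\<lambda>\<theta>. (norm (f \<theta> - (\<Sum>k\<in>F. c k * torus_char k \<theta>)))\<^sup>2)"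
  proof
    fix \<theta>
    have "r \<theta> + q \<theta> = f \<theta> - (\<Sum>k\<in>F. c k * torus_char k \<theta>)"
      by (simp add: r_def q_def S_def d_def left_diff_distrib sum_subtractf)
    then show "(norm (r \<theta> + q \<theta>))\<^sup>2 = (norm (f \<theta> - (\<Sum>k\<in>F. c k * torus_char k \<theta>)))\<^sup>2" by simp
  qed
  finally show ?thesis by (simp add: r_def)
qed

text \<open>A trigonometric polynomial is bounded by the sum of the moduli of its coefficients, and
  some such polynomial lies within distance 1 of \<open>f\<close>.\<close>

lemma torus_function_bounded:
  assumes "torus_function f" obtains M where "M > 0" "\<forall>\<theta>. norm (f \<theta>) \<le> M"
proof -
  obtain p where tp: "trig_poly p" and pe: "\<forall>\<theta>. norm (f \<theta> - p \<theta>) < 1"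
    by (rule trig_poly_dense[OF assms zero_less_one]) (rule that; assumption)
  obtain F c where F: "finite F" "p = (\<lambda>\<theta>. \<Sum>k\<in>F. c k * torus_char k \<theta>)"
    using trig_poly_expansion[OF tp] by blast
  have "norm (f \<theta>) \<le> 1 + (\<Sum>k\<in>F. norm (c k))" for \<theta>
  proof -
    have "norm (p \<theta>) \<le> (\<Sum>k\<in>F. norm (c k))"
      unfolding F by (rule sum_norm_le) (simp add: norm_mult torus_char_simps(5))
    moreover have "norm (f \<theta>) \<le> norm (f \<theta> - p \<theta>) + norm (p \<theta>)"
      using norm_triangle_ineq[of "f \<theta> - p \<theta>" "p \<theta>"] by simp
    ultimately show ?thesis using pe[rule_format, of \<theta>] by linarith
  qed
  moreover have "1 + (\<Sum>k\<in>F. norm (c k)) > 0" by (intro add_pos_nonneg sum_nonneg) auto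
  ultimately show ?thesis using that by blast
qed

text \<open>Parseval as a statement about finite sums: every finite \<open>A\<close> has a finite
  superset whose partial sum is as close as desired. The superset form is what isolates the terms
  beyond \<open>A\<close> in the tail estimate.\<close>

lemma torus_parseval_approx:
  fixes f g :: "real^'n \<Rightarrow> complex"
  assumes f: "torus_function f" and g: "torus_function g" and A: "finite A" and e: "e > 0"
  obtains F where "finite F" "A \<subseteq> F"
    "norm (integral torus_cube (\<lambda>\<theta>. g \<theta> * f \<theta>)
       - complex_of_real ((2 * pi) ^ CARD('n)) * (\<Sum>k\<in>F. torus_coeff g k * torus_coeff f (- k))) \<le> e"
proof -
  let ?I = "integral (torus_cube :: (real^'n) set)"
  let ?N = "(2 * pi) ^ CARD('n)"
  obtain M where M: "M > 0" "\<forall>\<theta>. norm (g \<theta>) \<le> M"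
    by (rule torus_function_bounded[OF g]) (rule that; assumption)
  \<comment> \<open>With this \<open>s\<close> each of the two terms of the bound below integrates
    to at most \<open>e / 2\<close>.\<close>
  define s where "s = e / (M * ?N)"
  have N: "?N > (0::real)" by simp
  have s: "s > 0" using e M N by (simp add: s_def)
  obtain p where tp: "trig_poly p" and pe: "\<forall>\<theta>. norm (f \<theta> - p \<theta>) < s"
    by (rule trig_poly_dense[OF f s]) (rule that; assumption)
  obtain F0 c0 where F0: "finite F0" "p = (\<lambda>\<theta>. \<Sum>k\<in>F0. c0 k * torus_char k \<theta>)"
    using trig_poly_expansion[OF tp] by blast
  \<comment> \<open>\<open>F\<close> indexes the frequencies of \<open>f\<close>, which enter the
    product with sign opposite to those of \<open>g\<close>. Hence \<open>A\<close> is reflected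
    here, and the final frequency set is \<open>uminus\<close> applied to \<open>F\<close> as an
    image.\<close>
  define F where "F = F0 \<union> uminus ` A"
  define c where "c k = (if k \<in> F0 then c0 k else 0)" for k
  have F: "finite F" using F0 A by (simp add: F_def)
  have p: "p \<theta> = (\<Sum>k\<in>F. c k * torus_char k \<theta>)" for \<theta>
    unfolding F0 by (rule sum.mono_neutral_cong_left) (use F in \<open>auto simp: F_def c_def\<close>)
  define S where "S \<theta> = (\<Sum>k\<in>F. torus_coeff f k * torus_char k \<theta>)" for \<theta>
  have fc: "continuous_on UNIV f" and gc: "continuous_on UNIV g"
    using f g by (auto simp: torus_function_def)
  have Sc: "continuous_on UNIV S" unfolding S_def by (intro continuous_intros)
  have pc: "continuous_on UNIV p" unfolding F0 by (intro continuous_intros)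
  \<comment> \<open>\<open>p\<close> is uniformly close to \<open>f\<close>, but its coefficients
    are not those of \<open>f\<close>. The Fourier sum \<open>S\<close> has the right coefficients
    and may fail to be uniformly close; optimality hands it the mean square bound of
    \<open>p\<close>.\<close>
  have "?I (\<lambda>\<theta>. (norm (f \<theta> - S \<theta>))\<^sup>2) \<le> ?I (\<lambda>\<theta>. (norm (f \<theta> - p \<theta>))\<^sup>2)"
    unfolding S_def p by (rule fourier_sum_best_approximation[OF fc F])
  also have "\<dots> \<le> ?I (\<lambda>\<theta>. s\<^sup>2)"
  proof (rule Henstock_Kurzweil_Integration.integral_le)
    show "(norm (f \<theta> - p \<theta>))\<^sup>2 \<le> s\<^sup>2" for \<theta>
      using pe[rule_format, of \<theta>] by (intro power_mono) auto
  qed (auto intro!: torus_integrable continuous_intros fc pc)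
  also have "\<dots> = s\<^sup>2 * ?N" using measure_torus_cube[where 'n='n] by (simp add: torus_cube_def)
  finally have L2: "?I (\<lambda>\<theta>. (norm (f \<theta> - S \<theta>))\<^sup>2) \<le> s\<^sup>2 * ?N" .
  have "norm (?I (\<lambda>\<theta>. g \<theta> * (f \<theta> - S \<theta>))) \<le> ?I (\<lambda>\<theta>. M * s / 2 + (M / (2 * s)) * (norm (f \<theta> - S \<theta>))\<^sup>2)"
  proof (rule Henstock_Kurzweil_Integration.integral_norm_bound_integral)
    fix \<theta>
    \<comment> \<open>AM-GM replaces the Cauchy-Schwarz inequality, so that only the mean square of \<open>f - S\<close> enters.\<close>
    have "2 * norm (f \<theta> - S \<theta>) * s \<le> s\<^sup>2 + (norm (f \<theta> - S \<theta>))\<^sup>2"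
      using sum_squares_bound[of "norm (f \<theta> - S \<theta>)" s] by simp
    then have "norm (f \<theta> - S \<theta>) \<le> s / 2 + (norm (f \<theta> - S \<theta>))\<^sup>2 / (2 * s)"
      using s by (simp add: field_simps power2_eq_square)
    then have "M * norm (f \<theta> - S \<theta>) \<le> M * (s / 2 + (norm (f \<theta> - S \<theta>))\<^sup>2 / (2 * s))"
      using M(1) by (intro mult_left_mono) auto
    moreover have "norm (g \<theta> * (f \<theta> - S \<theta>)) \<le> M * norm (f \<theta> - S \<theta>)"
      using M(2) by (simp add: norm_mult mult_right_mono)
    ultimately show "norm (g \<theta> * (f \<theta> - S \<theta>)) \<le> M * s / 2 + (M / (2 * s)) * (norm (f \<theta> - S \<theta>))\<^sup>2"
      by (simp add: distrib_left)
  qed (use s in \<open>auto intro!: torus_integrable continuous_intros fc gc Sc\<close>)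
  also have "\<dots> = ?I (\<lambda>\<theta>. M * s / 2) + (M / (2 * s)) * ?I (\<lambda>\<theta>. (norm (f \<theta> - S \<theta>))\<^sup>2)"
    by (subst Henstock_Kurzweil_Integration.integral_add)
      (use s in \<open>auto intro!: torus_integrable continuous_intros fc gc Sc\<close>)
  also have "\<dots> \<le> M * s / 2 * ?N + (M / (2 * s)) * (s\<^sup>2 * ?N)"
    using measure_torus_cube[where 'n='n] M s L2
    by (intro add_mono mult_left_mono) (auto simp: torus_cube_def)
  also have "\<dots> = e" using s M N by (simp add: s_def field_simps power2_eq_square)
  finally have b: "norm (?I (\<lambda>\<theta>. g \<theta> * (f \<theta> - S \<theta>))) \<le> e" .
  have "?I (\<lambda>\<theta>. g \<theta> * S \<theta>) = (\<Sum>k\<in>F. torus_coeff f k * ?I (\<lambda>\<theta>. g \<theta> * torus_char k \<theta>))"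
    unfolding S_def by (rule integral_trig_sum[OF gc F])
  also have "\<dots> = complex_of_real ?N * (\<Sum>k\<in>F. torus_coeff g (- k) * torus_coeff f k)"
    unfolding torus_coeff_integral by (simp add: sum_distrib_left ac_simps)
  also have "(\<Sum>k\<in>F. torus_coeff g (- k) * torus_coeff f k)
      = (\<Sum>k\<in>uminus ` F. torus_coeff g k * torus_coeff f (- k))"
    by (subst sum.reindex) auto
  finally have Sg: "?I (\<lambda>\<theta>. g \<theta> * S \<theta>)
      = complex_of_real ?N * (\<Sum>k\<in>uminus ` F. torus_coeff g k * torus_coeff f (- k))" .
  have "?I (\<lambda>\<theta>. g \<theta> * (f \<theta> - S \<theta>)) = ?I (\<lambda>\<theta>. g \<theta> * f \<theta>) - ?I (\<lambda>\<theta>. g \<theta> * S \<theta>)"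
    unfolding right_diff_distrib
    by (intro Henstock_Kurzweil_Integration.integral_diff torus_integrable continuous_intros fc gc Sc)
  with b Sg show ?thesis
    by (intro that[of "uminus ` F"]) (use F A in \<open>auto simp: F_def image_Un image_image\<close>)
qed

text \<open>For every \<open>e\<close> the excess of a suitable finite sum over \<open>A\<close> is
  a partial sum of the tail, hence bounded by the whole tail whichever frequency set was chosen. In
  \<open>ennreal\<close> this covers a divergent tail as well.\<close>

lemma torus_parseval_tail:
  fixes f g :: "real^'n \<Rightarrow> complex"
  assumes f: "torus_function f" and g: "torus_function g" and A: "finite A"
  shows "ennreal (norm (integral torus_cube (\<lambda>\<theta>. g \<theta> * f \<theta>)
       - complex_of_real ((2 * pi) ^ CARD('n)) * (\<Sum>k\<in>A. torus_coeff g k * torus_coeff f (- k))))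
    \<le> ennreal ((2 * pi) ^ CARD('n))
        * (\<Sum>\<^sub>\<infinity>k\<in>- A. ennreal (norm (torus_coeff g k * torus_coeff f (- k))))" (is "ennreal ?L \<le> ennreal ?N * ?R")
proof (rule ennreal_le_epsilon)
  fix e :: real assume e: "0 < e"
  let ?h = "\<lambda>k. torus_coeff g k * torus_coeff f (- k)"
  obtain F where F: "finite F" "A \<subseteq> F"
    "norm (integral torus_cube (\<lambda>\<theta>. g \<theta> * f \<theta>) - complex_of_real ?N * sum ?h F) \<le> e"
    by (rule torus_parseval_approx[OF f g A e]) (rule that; assumption)
  have "integral torus_cube (\<lambda>\<theta>. g \<theta> * f \<theta>) - complex_of_real ?N * sum ?h A
      = (integral torus_cube (\<lambda>\<theta>. g \<theta> * f \<theta>) - complex_of_real ?N * sum ?h F)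
        + complex_of_real ?N * sum ?h (F - A)"
    using F by (simp add: sum_diff algebra_simps)
  also have "norm \<dots> \<le> e + ?N * (\<Sum>k\<in>F - A. norm (?h k))"
  proof (rule norm_triangle_mono[OF F(3)])
    have "norm (complex_of_real ?N * sum ?h (F - A)) = ?N * norm (sum ?h (F - A))"
      by (simp add: norm_mult norm_power)
    also have "\<dots> \<le> ?N * (\<Sum>k\<in>F - A. norm (?h k))" by (intro mult_left_mono norm_sum) simp
    finally show "norm (complex_of_real ?N * sum ?h (F - A)) \<le> ?N * (\<Sum>k\<in>F - A. norm (?h k))" .
  qed
  finally have "ennreal ?L \<le> ennreal (e + ?N * (\<Sum>k\<in>F - A. norm (?h k)))" by (rule ennreal_leI)
  also have "\<dots> = ennreal e + ennreal ?N * (\<Sum>k\<in>F - A. ennreal (norm (?h k)))"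
    using e by (simp add: ennreal_plus ennreal_mult sum_nonneg sum_ennreal)
  also have "(\<Sum>k\<in>F - A. ennreal (norm (?h k))) \<le> ?R"
  proof -
    have "(\<Sum>k\<in>F - A. ennreal (norm (?h k))) = (\<Sum>\<^sub>\<infinity>k\<in>F - A. ennreal (norm (?h k)))"
      using F by simp
    also have "\<dots> \<le> ?R"
      by (rule infsum_mono_neutral) (use F in \<open>auto intro: nonneg_summable_on_complete\<close>)
    finally show ?thesis .
  qed
  finally show "ennreal ?L \<le> ennreal ?N * ?R + ennreal e"
    by (simp add: add.commute mult_left_mono)
qed
section \<open>Oscillatory integrals\<close>

text \<open>Outside \<open>S\<close> nothing is known about \<open>g\<close>. There the product
  vanishes near every point, and the open sets \<open>S\<close> and \<open>- C\<close> cover the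
  space, so regularity can be checked on each of them.\<close>

lemma C1_compact_mult:
  fixes g :: "'a::euclidean_space \<Rightarrow> real"
  assumes S: "open S" and f: "C1_compact S f D"
    and g: "\<And>x. x \<in> S \<Longrightarrow> (g has_derivative (\<lambda>v. E x \<bullet> v)) (at x)" "continuous_on S E"
  shows "C1_compact S (\<lambda>x. f x * g x) (\<lambda>x. f x *\<^sub>R E x + g x *\<^sub>R D x)"
proof -
  obtain C where C: "compact C" "C \<subseteq> S" "\<And>x. x \<notin> C \<Longrightarrow> f x = 0 \<and> D x = 0"
    and fD: "C1_gradient f D" using f by (auto simp: C1_compact_def)
  have fc: "continuous_on T f" for T by (rule C1_gradient_continuous[OF fD])
  have Dc: "continuous_on T D" for T using fD by (auto simp: C1_gradient_def intro: continuous_on_subset)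
  have gc: "continuous_on S g"
    using g(1) by (meson continuous_at_imp_continuous_on has_derivative_continuous)
  have UN: "S \<union> - C = UNIV" using C by auto
  have oC: "open (- C)" using C(1) by (simp add: compact_imp_closed open_Compl)
  have "C1_gradient (\<lambda>x. f x * g x) (\<lambda>x. f x *\<^sub>R E x + g x *\<^sub>R D x)"
    unfolding C1_gradient_def
  proof (intro conjI allI)
    have "continuous_on S (\<lambda>x. f x *\<^sub>R E x + g x *\<^sub>R D x)"
      by (intro continuous_intros fc Dc gc g)
    moreover have "continuous_on (- C) (\<lambda>x. f x *\<^sub>R E x + g x *\<^sub>R D x)"
      by (rule continuous_on_eq[OF continuous_on_const[of _ 0]]) (use C(3) in auto)
    ultimately show "continuous_on UNIV (\<lambda>x. f x *\<^sub>R E x + g x *\<^sub>R D x)"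
      using continuous_on_open_Un[OF S oC] UN by metis
    fix x
    show "((\<lambda>x. f x * g x) has_derivative (\<lambda>v. (f x *\<^sub>R E x + g x *\<^sub>R D x) \<bullet> v)) (at x)"
    proof (cases "x \<in> S")
      case True
      have "((\<lambda>x. f x * g x) has_derivative (\<lambda>v. f x * (E x \<bullet> v) + (D x \<bullet> v) * g x)) (at x)"
        using fD g(1)[OF True] by (auto simp: C1_gradient_def intro!: has_derivative_mult)
      then show ?thesis by (simp add: inner_add_left mult.commute)
    next
      case False
      then have x: "x \<in> - C" using C(2) by auto
      have "((\<lambda>_. 0) has_derivative (\<lambda>v. 0)) (at x)" by simp
      then have "((\<lambda>x. f x * g x) has_derivative (\<lambda>v. 0)) (at x)"
        by (rule has_derivative_transform_within_open[OF _ oC x]) (use C(3) in auto)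
      then show ?thesis using C(3) x by simp
    qed
  qed
  then show ?thesis by (rule C1_compactI[OF _ C(1,2)]) (use C(3) in auto)
qed

lemma L1_norm_eq_integral:
  fixes u :: "real^'n \<Rightarrow> 'b::{banach, second_countable_topology}"
  assumes "set_integrable lebesgue S u"
  shows "L1_norm S u = ennreal (LINT x:S|lebesgue. norm (u x))"
proof -
  have "L1_norm S u = (\<integral>\<^sup>+x. ennreal (indicat_real S x *\<^sub>R norm (u x)) \<partial>lebesgue)"
    unfolding L1_norm_def by (rule nn_integral_cong) (simp add: indicator_def)
  also have "\<dots> = ennreal (LINT x|lebesgue. indicat_real S x *\<^sub>R norm (u x))"
    by (rule nn_integral_eq_integral)
      (use set_integrable_norm[OF assms] in \<open>auto simp: set_integrable_def\<close>)
  finally show ?thesis by (simp add: set_lebesgue_integral_def)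
qed

lemma C1_compact_pairing_integrable:
  fixes u :: "real^'n \<Rightarrow> 'b::{banach, second_countable_topology}"
  assumes f: "C1_compact S f D" and u: "locally_integrable_on S u"
  shows "set_integrable lebesgue S (\<lambda>x. f x *\<^sub>R u x)"
proof -
  obtain C where C: "compact C" "C \<subseteq> S" "\<And>x. x \<notin> C \<Longrightarrow> f x = 0" and fD: "C1_gradient f D"
    using f by (auto simp: C1_compact_def)
  have "set_integrable lebesgue C (\<lambda>x. f x *\<^sub>R u x)"
    using u C(1,2) C1_gradient_continuous[OF fD]
    by (intro pairing_integrable) (auto simp: locally_integrable_on_def)
  then show ?thesis using set_integrable_support[of C S "\<lambda>x. f x *\<^sub>R u x" lebesgue] C by auto
qed

text \<open>On the support of \<open>a\<close>, where the cutoff equals one, \<open>F\<close> pairs with the gradients of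
  \<open>cos (t * \<phi>)\<close> and \<open>sin (t * \<phi>)\<close> to \<open>- t * sin (t * \<phi>) * a\<close> and \<open>t * cos (t * \<phi>) * a\<close>:
  this is one integration by parts in the direction of \<open>E\<close>.\<close>

lemma oscillatory_integral_bound:
  fixes a u :: "real^'n \<Rightarrow> complex" and \<phi> :: "real^'n \<Rightarrow> real" and F :: "real^'n \<Rightarrow> complex^'n"
  assumes S: "open S"
    and \<phi>: "\<And>x. x \<in> S \<Longrightarrow> (\<phi> has_derivative (\<lambda>v. E x \<bullet> v)) (at x)" "continuous_on S E"
      "\<And>x. x \<in> S \<Longrightarrow> E x \<noteq> 0"
    and a: "locally_integrable_on S a" "compact C" "C \<subseteq> S" "\<And>x. x \<in> S - C \<Longrightarrow> a x = 0"
    and F: "\<And>x i. x \<in> S \<Longrightarrow> F x $ i = a x * complex_of_real (E x $ i / (norm (E x))\<^sup>2)"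
    and u: "is_weak_divergence S F u" "set_integrable lebesgue S u"
  shows "ennreal \<bar>t\<bar> * ennreal (cmod (LINT x:S|lebesgue. a x * exp (\<i> * complex_of_real (t * \<phi> x))))
    \<le> L1_norm S u"
proof -
  obtain \<kappa> D where \<kappa>: "C1_compact S \<kappa> D" "\<forall>x. 0 \<le> \<kappa> x \<and> \<kappa> x \<le> 1" "\<forall>x\<in>C. \<kappa> x = 1"
    by (rule cutoff_exists[OF a(2) S a(3)]) (rule that; assumption)
  \<comment> \<open>Since \<open>C\<close> may have empty interior, constancy of the cutoff on
    \<open>C\<close> does not determine its gradient there. Instead every point of \<open>C\<close>
    is a maximum of the cutoff.\<close>
  have D0: "D x = 0" if "x \<in> C" for x
  proof -
    have d: "(\<kappa> has_derivative (\<lambda>v. D x \<bullet> v)) (at x)"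
      using \<kappa>(1) by (simp add: C1_compact_def C1_gradient_def)
    have "(\<lambda>v. D x \<bullet> v) = (\<lambda>v. 0)"
      by (rule differential_zero_maxmin[OF UNIV_I open_UNIV d]) (use \<kappa>(2,3) that in auto)
    then show ?thesis by (metis inner_eq_zero_iff)
  qed
  \<comment> \<open>Test functions are real, so the complex exponential is tested through its cosine
    and sine parts.\<close>
  define f1 where "f1 x = \<kappa> x * cos (t * \<phi> x)" for x
  define f2 where "f2 x = \<kappa> x * sin (t * \<phi> x)" for x
  define D1 where "D1 x = \<kappa> x *\<^sub>R ((- t * sin (t * \<phi> x)) *\<^sub>R E x) + cos (t * \<phi> x) *\<^sub>R D x" for x
  define D2 where "D2 x = \<kappa> x *\<^sub>R ((t * cos (t * \<phi> x)) *\<^sub>R E x) + sin (t * \<phi> x) *\<^sub>R D x" for x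
  have \<phi>c: "continuous_on S \<phi>"
    using \<phi>(1) by (meson continuous_at_imp_continuous_on has_derivative_continuous)
  have C1: "C1_compact S f1 D1" unfolding f1_def D1_def
    by (rule C1_compact_mult[OF S \<kappa>(1)])
      (auto intro!: derivative_eq_intros \<phi> continuous_intros \<phi>c)
  have C2: "C1_compact S f2 D2" unfolding f2_def D2_def
    by (rule C1_compact_mult[OF S \<kappa>(1)])
      (auto intro!: derivative_eq_intros \<phi> continuous_intros \<phi>c)
  have ul: "locally_integrable_on S u" using u(1) by (simp add: is_weak_divergence_def)
  note int = C1_compact_pairing_integrable[OF C1 a(1)] C1_compact_pairing_integrable[OF C2 a(1)]
    C1_compact_pairing_integrable[OF C1 ul] C1_compact_pairing_integrable[OF C2 ul]
  define A1 where "A1 = (LINT x:S|lebesgue. f1 x *\<^sub>R a x)"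
  define A2 where "A2 = (LINT x:S|lebesgue. f2 x *\<^sub>R a x)"
  define U1 where "U1 = (LINT x:S|lebesgue. f1 x *\<^sub>R u x)"
  define U2 where "U2 = (LINT x:S|lebesgue. f2 x *\<^sub>R u x)"
  have on_supp: "a x = 0 \<or> \<kappa> x = 1 \<and> D x = 0" if "x \<in> S" for x
    using a(4) \<kappa>(3) D0 that by blast
  have flux: "(\<Sum>i\<in>UNIV. (c *\<^sub>R E x) $ i *\<^sub>R F x $ i) = c *\<^sub>R a x" if x: "x \<in> S" for c x
  proof -
    have "(\<Sum>i\<in>UNIV. (c *\<^sub>R E x) $ i *\<^sub>R F x $ i)
        = (\<Sum>i\<in>UNIV. complex_of_real (c * (E x $ i * E x $ i) / (norm (E x))\<^sup>2) * a x)"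
      by (rule sum.cong[OF refl]) (use x in \<open>simp add: F scaleR_conv_of_real[where 'a=complex]\<close>)
    also have "\<dots> = complex_of_real (c * (\<Sum>i\<in>UNIV. E x $ i * E x $ i) / (norm (E x))\<^sup>2) * a x"
      by (simp add: sum_distrib_left sum_distrib_right sum_divide_distrib)
    also have "(\<Sum>i\<in>UNIV. E x $ i * E x $ i) = (norm (E x))\<^sup>2"
      by (simp add: power2_norm_eq_inner inner_vec_def)
    finally show ?thesis using \<phi>(3)[OF x] by (simp add: scaleR_conv_of_real)
  qed
  have flux': "(\<Sum>i\<in>UNIV. (\<kappa> x *\<^sub>R (c *\<^sub>R E x) + d *\<^sub>R D x) $ i *\<^sub>R F x $ i) = (\<kappa> x * c) *\<^sub>R a x"
    if x: "x \<in> S" for c d x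
  proof (cases "a x = 0")
    case True then show ?thesis using x by (simp add: F)
  next
    case False
    then have "\<kappa> x = 1" "D x = 0" using on_supp[OF x] by auto
    then show ?thesis using flux[OF x, of c] by simp
  qed
  have e1: "(\<Sum>i\<in>UNIV. D1 x $ i *\<^sub>R F x $ i) = (- t) *\<^sub>R (f2 x *\<^sub>R a x)"
    and e2: "(\<Sum>i\<in>UNIV. D2 x $ i *\<^sub>R F x $ i) = t *\<^sub>R (f1 x *\<^sub>R a x)" if "x \<in> S" for x
    unfolding D1_def D2_def flux'[OF that] by (simp_all add: f1_def f2_def ac_simps)
  have "U1 = - (LINT x:S|lebesgue. (\<Sum>i\<in>UNIV. (D1 x $ i) *\<^sub>R F x $ i))"
    unfolding U1_def by (rule weak_divergence_C1_compact[OF S u(1) C1])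
  also have "\<dots> = - (LINT x:S|lebesgue. (- t) *\<^sub>R (f2 x *\<^sub>R a x))"
    using S by (subst set_lebesgue_integral_cong[of S lebesgue _ "\<lambda>x. (- t) *\<^sub>R (f2 x *\<^sub>R a x)"]) (auto simp: e1)
  also have "\<dots> = t *\<^sub>R A2" unfolding A2_def by (subst set_integral_scaleR_right) simp
  finally have U1: "U1 = t *\<^sub>R A2" .
  have "U2 = - (LINT x:S|lebesgue. (\<Sum>i\<in>UNIV. (D2 x $ i) *\<^sub>R F x $ i))"
    unfolding U2_def by (rule weak_divergence_C1_compact[OF S u(1) C2])
  also have "\<dots> = - (LINT x:S|lebesgue. t *\<^sub>R (f1 x *\<^sub>R a x))"
    using S by (subst set_lebesgue_integral_cong[of S lebesgue _ "\<lambda>x. t *\<^sub>R (f1 x *\<^sub>R a x)"]) (auto simp: e2)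
  also have "\<dots> = - (t *\<^sub>R A1)" unfolding A1_def by (subst set_integral_scaleR_right) simp
  finally have U2: "U2 = - (t *\<^sub>R A1)" .
  have "(LINT x:S|lebesgue. a x * exp (\<i> * complex_of_real (t * \<phi> x)))
      = (LINT x:S|lebesgue. f1 x *\<^sub>R a x + \<i> * (f2 x *\<^sub>R a x))"
  proof (rule set_lebesgue_integral_cong)
    show "\<forall>x. x \<in> S \<longrightarrow> a x * exp (\<i> * complex_of_real (t * \<phi> x)) = f1 x *\<^sub>R a x + \<i> * (f2 x *\<^sub>R a x)"
    proof (intro allI impI)
      fix x assume x: "x \<in> S"
      have "exp (\<i> * complex_of_real (t * \<phi> x)) = of_real (cos (t * \<phi> x)) + \<i> * of_real (sin (t * \<phi> x))"
        using cis_conv_exp[of "t * \<phi> x", symmetric] by (simp add: complex_eq_iff)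
      then show "a x * exp (\<i> * complex_of_real (t * \<phi> x)) = f1 x *\<^sub>R a x + \<i> * (f2 x *\<^sub>R a x)"
        using on_supp[OF x] by (auto simp: f1_def f2_def scaleR_conv_of_real algebra_simps)
    qed
  qed (use S in auto)
  also have "\<dots> = A1 + \<i> * A2"
    using int(1,2) by (subst set_integral_add(2)) (auto simp: A1_def A2_def simp del: mult_scaleR_right)
  \<comment> \<open>From \<open>U1 = t *\<^sub>R A2\<close> and
    \<open>U2 = - (t *\<^sub>R A1)\<close> the combination \<open>\<i> * (U1 + \<i> * U2)\<close> is
    \<open>t\<close> times \<open>A1 + \<i> * A2\<close>.\<close>
  finally have eq: "t *\<^sub>R (LINT x:S|lebesgue. a x * exp (\<i> * complex_of_real (t * \<phi> x))) = \<i> * (U1 + \<i> * U2)"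
    using U1 U2 by (simp add: scaleR_conv_of_real algebra_simps)
  \<comment> \<open>The two parts are recombined before norms are taken: the integrand is
    \<open>u\<close> times a number of modulus at most 1, so the bound has constant 1, which
    separate estimates of \<open>U1\<close> and \<open>U2\<close> would lose.\<close>
  have "U1 + \<i> * U2 = (LINT x:S|lebesgue. f1 x *\<^sub>R u x + \<i> * (f2 x *\<^sub>R u x))"
    using int(3,4) by (subst set_integral_add(2)) (auto simp: U1_def U2_def simp del: mult_scaleR_right)
  also have "norm \<dots> \<le> (LINT x:S|lebesgue. norm (f1 x *\<^sub>R u x + \<i> * (f2 x *\<^sub>R u x)))"
    using int(3,4) by (intro set_integral_norm_bound set_integral_add(1)) (auto simp del: mult_scaleR_right)
  also have "\<dots> \<le> (LINT x:S|lebesgue. norm (u x))"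
  proof (rule set_integral_mono)
    show "set_integrable lebesgue S (\<lambda>x. norm (f1 x *\<^sub>R u x + \<i> * (f2 x *\<^sub>R u x)))"
      using int(3,4) by (intro set_integrable_norm set_integral_add(1)) (auto simp del: mult_scaleR_right)
    fix x
    have "f1 x *\<^sub>R u x + \<i> * (f2 x *\<^sub>R u x) = (complex_of_real (\<kappa> x) * cis (t * \<phi> x)) * u x"
      by (simp add: f1_def f2_def complex_eq_iff algebra_simps)
    then have "norm (f1 x *\<^sub>R u x + \<i> * (f2 x *\<^sub>R u x)) = \<kappa> x * norm (u x)"
      using \<kappa>(2) by (simp add: norm_mult)
    then show "norm (f1 x *\<^sub>R u x + \<i> * (f2 x *\<^sub>R u x)) \<le> norm (u x)"
      using \<kappa>(2) mult_right_mono[of "\<kappa> x" 1 "norm (u x)"] by simp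
  qed (rule set_integrable_norm[OF u(2)])
  finally have "norm (U1 + \<i> * U2) \<le> (LINT x:S|lebesgue. norm (u x))" .
  moreover have "\<bar>t\<bar> * cmod (LINT x:S|lebesgue. a x * exp (\<i> * complex_of_real (t * \<phi> x))) = norm (U1 + \<i> * U2)"
    using arg_cong[OF eq, of norm] by (simp add: norm_mult)
  ultimately show ?thesis
    unfolding L1_norm_eq_integral[OF u(2)] by (simp flip: ennreal_mult add: ennreal_leI)
qed
section \<open>Averages over action-angle space\<close>

lemma supported_integrable:
  fixes h :: "real^'n \<Rightarrow> 'b::{banach, second_countable_topology}"
  assumes "continuous_on S h" "compact C" "C \<subseteq> S" "\<And>x. x \<in> S - C \<Longrightarrow> h x = 0"
  shows "set_integrable lebesgue S h"
proof -
  have "integrable lborel (\<lambda>x. indicat_real C x *\<^sub>R h x)"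
    using assms by (intro borel_integrable_compact) (auto intro: continuous_on_subset)
  then have "integrable lebesgue (\<lambda>x. indicat_real C x *\<^sub>R h x)"
    by (simp add: integrable_completion borel_measurable_integrable)
  moreover have "(\<lambda>x. indicat_real C x *\<^sub>R h x) = (\<lambda>x. indicat_real S x *\<^sub>R h x)"
    using assms(3,4) by (auto simp: indicator_def fun_eq_iff)
  ultimately show ?thesis by (simp add: set_integrable_def)
qed

lemma torus_integral_continuous:
  fixes h :: "(real^'n) \<times> (real^'n) \<Rightarrow> complex"
  assumes "continuous_on (S \<times> UNIV) h"
  shows "continuous_on S (\<lambda>I. integral torus_cube (\<lambda>\<theta>. h (I, \<theta>)))"
  unfolding torus_cube_def
  by (rule integral_continuous_on_param) (auto simp: split_beta' intro: continuous_on_subset[OF assms])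

lemma torus_lebesgue_integral:
  fixes f :: "real^'n \<Rightarrow> complex"
  assumes "continuous_on torus_cube f"
  shows "(LINT \<theta>:torus_cube|lebesgue. f \<theta>) = integral torus_cube f"
proof (rule set_lebesgue_integral_eq_integral(2))
  show "set_integrable lebesgue torus_cube f"
    using torus_set_integrable[OF assms]
    by (simp add: set_integrable_def integrable_completion borel_measurable_integrable)
qed

text \<open>Fubini is applied to the product of two copies of \<open>lborel\<close>, whose
  completion is the measure in the statement. Cutting down to the compact set
  \<open>C \<times> torus_cube\<close> makes the integrand Borel and integrable, and on Borel
  functions completed and uncompleted integrals agree.\<close>

lemma torus_fubini:
  fixes h :: "(real^'n) \<times> (real^'n) \<Rightarrow> complex"
  assumes h: "continuous_on (S \<times> UNIV) h" and C: "compact C" "C \<subseteq> S"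
    and z: "\<And>I \<theta>. I \<in> S - C \<Longrightarrow> h (I, \<theta>) = 0"
  shows "(LINT z:S \<times> torus_cube|lebesgue. h z)
    = (LINT I:S|lebesgue. integral torus_cube (\<lambda>\<theta>. h (I, \<theta>)))"
proof -
  define J where "J I = integral torus_cube (\<lambda>\<theta>. h (I, \<theta>))" for I
  have hC: "continuous_on (C \<times> torus_cube) h"
    using C(2) by (intro continuous_on_subset[OF h]) auto
  have i: "integrable lborel (\<lambda>z. indicat_real (C \<times> torus_cube) z *\<^sub>R h z)"
    using hC C(1) compact_torus_cube by (intro borel_integrable_compact compact_Times)
  then have i2: "integrable (lborel \<Otimes>\<^sub>M lborel) (\<lambda>z. indicat_real (C \<times> torus_cube) z *\<^sub>R h z)"
    by (simp add: lborel_prod)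
  have inner: "(LINT \<theta>|lborel. indicat_real (C \<times> torus_cube) (I, \<theta>) *\<^sub>R h (I, \<theta>)) = indicat_real C I *\<^sub>R J I" for I
  proof (cases "I \<in> C")
    case True
    have "continuous_on torus_cube (\<lambda>\<theta>. h (I, \<theta>))"
      using True by (intro continuous_on_compose2[OF hC] continuous_intros) auto
    from set_borel_integral_eq_integral(2)[OF torus_set_integrable[OF this]] show ?thesis
      using True by (simp add: J_def set_lebesgue_integral_def indicator_times)
  qed (simp add: indicator_times)
  have "(LINT z:S \<times> torus_cube|lebesgue. h z)
      = (LINT z|lebesgue. indicat_real (C \<times> torus_cube) z *\<^sub>R h z)"
    unfolding set_lebesgue_integral_def
    by (rule Bochner_Integration.integral_cong) (use z C(2) in \<open>auto simp: indicator_def\<close>)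
  also have "\<dots> = (LINT z|lborel. indicat_real (C \<times> torus_cube) z *\<^sub>R h z)"
    using i by (simp add: integral_completion borel_measurable_integrable)
  also have "\<dots> = (LINT z|(lborel \<Otimes>\<^sub>M lborel). indicat_real (C \<times> torus_cube) z *\<^sub>R h z)"
    by (simp add: lborel_prod)
  also have "\<dots> = (LINT I|lborel. (LINT \<theta>|lborel. indicat_real (C \<times> torus_cube) (I, \<theta>) *\<^sub>R h (I, \<theta>)))"
    by (rule lborel_pair.integral_fst'[OF i2, symmetric])
  also have "\<dots> = (LINT I|lborel. indicat_real C I *\<^sub>R J I)" by (simp add: inner)
  also have "\<dots> = (LINT I|lebesgue. indicat_real C I *\<^sub>R J I)"
  proof (rule integral_completion[symmetric])
    have "integrable lborel (\<lambda>I. indicat_real C I *\<^sub>R J I)"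
      unfolding J_def using C
      by (intro borel_integrable_compact continuous_on_subset[OF torus_integral_continuous[OF h]])
    then show "(\<lambda>I. indicat_real C I *\<^sub>R J I) \<in> borel_measurable lborel"
      by (rule borel_measurable_integrable)
  qed
  also have "\<dots> = (LINT I:S|lebesgue. J I)"
    unfolding set_lebesgue_integral_def
    by (rule Bochner_Integration.integral_cong) (use z C(2) in \<open>auto simp: indicator_def J_def\<close>)
  finally show ?thesis by (simp add: J_def)
qed

section \<open>Integration of countable sums of nonnegative functions\<close>

lemma infsum_nat_eq_SUP:
  fixes f :: "nat \<Rightarrow> ennreal"
  shows "infsum f UNIV = (SUP n. sum f {..<n})"
proof -
  have "infsum f UNIV = (SUP F\<in>{F. finite F \<and> F \<subseteq> UNIV}. sum f F)"
    by (rule nonneg_infsum_complete) simp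
  also have "\<dots> = (SUP n. sum f {..<n})"
  proof (rule antisym)
    show "(SUP F\<in>{F. finite F \<and> F \<subseteq> UNIV}. sum f F) \<le> (SUP n. sum f {..<n})"
    proof (rule SUP_least)
      fix F :: "nat set" assume "F \<in> {F. finite F \<and> F \<subseteq> UNIV}"
      then obtain n where "F \<subseteq> {..<n}" using finite_nat_bounded by auto
      then have "sum f F \<le> sum f {..<n}" by (intro sum_mono2) auto
      then show "sum f F \<le> (SUP n. sum f {..<n})" by (meson SUP_upper UNIV_I order_trans)
    qed
    show "(SUP n. sum f {..<n}) \<le> (SUP F\<in>{F. finite F \<and> F \<subseteq> UNIV}. sum f F)"
      by (rule SUP_least, rule SUP_upper) auto
  qed
  finally show ?thesis .
qed

text \<open>One exhausting sequence \<open>F\<close> serves every summand \<open>h\<close>. It can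
  thus be fixed before \<open>h\<close> varies with the integration variable, and reused for the sum
  of the integrals.\<close>

lemma infsum_countable_eq_SUP:
  fixes B :: "'k::countable set"
  obtains F where "incseq F" "\<forall>n::nat. finite (F n)" "\<forall>h::'k \<Rightarrow> ennreal. infsum h B = (SUP n. sum h (F n))"
proof (cases "finite B")
  case True
  then show ?thesis by (intro that[of "\<lambda>_. B"]) (auto simp: incseq_def)
next
  case False
  define e where "e = from_nat_into B"
  have e: "bij_betw e UNIV B"
    unfolding e_def using False by (intro bij_betw_from_nat_into) auto
  have "infsum h B = (SUP n. sum h (e ` {..<n}))" for h :: "'k \<Rightarrow> ennreal"
  proof -
    have "sum h (e ` {..<n}) = sum (\<lambda>i. h (e i)) {..<n}" for n
      by (subst sum.reindex) (use e in \<open>auto simp: bij_betw_def intro: inj_on_subset\<close>)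
    then show ?thesis by (simp add: infsum_reindex_bij_betw[OF e, symmetric] infsum_nat_eq_SUP)
  qed
  then show ?thesis by (intro that[of "\<lambda>n. e ` {..<n}"]) (auto simp: incseq_def)
qed

text \<open>Tonelli for a countable sum: monotone convergence along an exhaustion of
  \<open>B\<close> that does not depend on \<open>x\<close>.\<close>

lemma
  fixes f :: "'k::countable \<Rightarrow> 'a \<Rightarrow> ennreal"
  assumes [measurable]: "\<And>k. f k \<in> borel_measurable M"
  shows nn_integral_infsum:
      "(\<integral>\<^sup>+x. (\<Sum>\<^sub>\<infinity>k\<in>B. f k x) \<partial>M) = (\<Sum>\<^sub>\<infinity>k\<in>B. \<integral>\<^sup>+x. f k x \<partial>M)"
    and borel_measurable_infsum_ennreal: "(\<lambda>x. \<Sum>\<^sub>\<infinity>k\<in>B. f k x) \<in> borel_measurable M"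
proof -
  obtain F where F: "incseq F" "\<forall>n::nat. finite (F n)"
    "\<forall>h::'k \<Rightarrow> ennreal. infsum h B = (SUP n. sum h (F n))"
    by (rule infsum_countable_eq_SUP) (rule that; assumption)
  note r = F(3)[rule_format]
  have "(\<integral>\<^sup>+x. (\<Sum>\<^sub>\<infinity>k\<in>B. f k x) \<partial>M) = (\<integral>\<^sup>+x. (SUP n. \<Sum>k\<in>F n. f k x) \<partial>M)"
    by (simp add: r)
  also have "\<dots> = (SUP n. \<integral>\<^sup>+x. (\<Sum>k\<in>F n. f k x) \<partial>M)"
    by (rule nn_integral_monotone_convergence_SUP)
      (use F(1,2) in \<open>auto simp: incseq_def le_fun_def intro!: sum_mono2\<close>)
  also have "\<dots> = (\<Sum>\<^sub>\<infinity>k\<in>B. \<integral>\<^sup>+x. f k x \<partial>M)" by (simp add: r nn_integral_sum)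
  finally show "(\<integral>\<^sup>+x. (\<Sum>\<^sub>\<infinity>k\<in>B. f k x) \<partial>M) = (\<Sum>\<^sub>\<infinity>k\<in>B. \<integral>\<^sup>+x. f k x \<partial>M)" .
  show "(\<lambda>x. \<Sum>\<^sub>\<infinity>k\<in>B. f k x) \<in> borel_measurable M"
    unfolding r by measurable
qed

section \<open>Fourier coefficients as functions of the action, and the splitting of the averages
  into modes\<close>

lemma C_torus_slice:
  assumes "C_torus \<Omega> h" "I \<in> \<Omega>"
  shows "torus_function (\<lambda>\<theta>. h (I, \<theta>))"
proof -
  have "continuous_on (\<Omega> \<times> UNIV) h" using assms by (simp add: C_torus_def)
  then have "continuous_on UNIV (\<lambda>\<theta>. h (I, \<theta>))"
    by (rule continuous_on_compose2) (use assms(2) in \<open>auto intro!: continuous_intros\<close>)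
  then show ?thesis using assms by (auto simp: torus_function_def C_torus_def torus_periodic_def)
qed

lemma fourier_coeff_eq:
  assumes "C_torus \<Omega> h" "I \<in> \<Omega>"
  shows "fourier_coeff h k I = torus_coeff (\<lambda>\<theta>. h (I, \<theta>)) k"
proof -
  have c: "continuous_on torus_cube (\<lambda>\<theta>. h (I, \<theta>) * torus_char (- k) \<theta>)"
    by (intro continuous_intros torus_functionD(1)[OF C_torus_slice[OF assms]])
  have "exp (- \<i> * complex_of_real (rvec k \<bullet> \<theta>)) = torus_char (- k) \<theta>" for \<theta>
    by (simp add: torus_char_def)
  then show ?thesis
    using torus_lebesgue_integral[OF c] by (simp add: fourier_coeff_def torus_coeff_def)
qed

lemma fourier_coeff_continuous:
  assumes "C_torus \<Omega> h"
  shows "continuous_on \<Omega> (fourier_coeff h k)"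
proof -
  have "continuous_on (\<Omega> \<times> UNIV) (\<lambda>z. h z * torus_char (- k) (snd z))"
    using assms unfolding C_torus_def by (intro continuous_intros) auto
  from torus_integral_continuous[OF this]
  have "continuous_on \<Omega> (\<lambda>I. torus_coeff (\<lambda>\<theta>. h (I, \<theta>)) k)"
    unfolding torus_coeff_def by (intro continuous_intros) auto
  then show ?thesis
    by (rule continuous_on_eq) (simp add: fourier_coeff_eq[OF assms])
qed

lemma Ck_on_1D:
  assumes "Ck_on 1 S f"
  shows "\<And>x. x \<in> S \<Longrightarrow> f differentiable (at x)"
    "continuous_on S (\<lambda>x. frechet_derivative f (at x) v)" "continuous_on S f"
  using assms by (auto intro!: continuous_at_imp_continuous_on differentiable_imp_continuous_within)

lemma C1c_torus_imp_C_torus: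
  assumes "C1c_torus \<Omega> f0"
  shows "C_torus \<Omega> (\<lambda>z. complex_of_real (f0 z))"
  using assms Ck_on_1D(3)[of "\<Omega> \<times> UNIV" f0]
  by (auto simp: C1c_torus_def C_torus_def torus_periodic_def simp del: Ck_on.simps intro!: continuous_intros)

lemma l1_eq_0_iff: "l1 k = 0 \<longleftrightarrow> k = 0"
  by (simp add: l1_def sum_nonneg_eq_0_iff vec_eq_iff)

lemma low_modes_partition:
  assumes "K \<ge> 1"
  shows "- insert 0 (low_modes K) = {k :: int^'n. real_of_int (l1 k) > K}" "0 \<notin> low_modes K"
proof -
  have nn: "l1 k \<ge> 0" for k :: "int^'n" by (simp add: l1_def sum_nonneg)
  show "- insert 0 (low_modes K) = {k :: int^'n. real_of_int (l1 k) > K}"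
  proof (rule set_eqI)
    fix k :: "int^'n"
    show "k \<in> - insert 0 (low_modes K) \<longleftrightarrow> k \<in> {k. real_of_int (l1 k) > K}"
      using nn[of k] l1_eq_0_iff[of k] assms by (cases "k = 0") (auto simp: low_modes_def)
  qed
  show "0 \<notin> low_modes K" by (simp add: low_modes_def l1_def)
qed

text \<open>A single compact set works for all frequencies, since it comes from \<open>f0\<close>
  alone: where \<open>f0\<close> vanishes for all angles, so do all its coefficients.\<close>

lemma amplitude_properties:
  assumes f0: "C1c_torus \<Omega> f0" and G: "C_torus \<Omega> G"
  shows "continuous_on \<Omega> (amplitude G f0 k)"
    "\<exists>C. compact C \<and> C \<subseteq> \<Omega> \<and> (\<forall>I\<in>\<Omega> - C. \<forall>\<theta>. f0 (I, \<theta>) = 0) \<and> (\<forall>k. \<forall>I\<in>\<Omega> - C. amplitude G f0 k I = 0)"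
proof -
  note fC = C1c_torus_imp_C_torus[OF f0]
  show "continuous_on \<Omega> (amplitude G f0 k)"
    unfolding amplitude_def by (intro continuous_intros fourier_coeff_continuous G fC)
  obtain C where C: "compact C" "C \<subseteq> \<Omega>" "\<forall>I\<in>\<Omega> - C. \<forall>\<theta>. f0 (I, \<theta>) = 0"
    using f0 by (auto simp: C1c_torus_def)
  then show "\<exists>C. compact C \<and> C \<subseteq> \<Omega> \<and> (\<forall>I\<in>\<Omega> - C. \<forall>\<theta>. f0 (I, \<theta>) = 0) \<and> (\<forall>k. \<forall>I\<in>\<Omega> - C. amplitude G f0 k I = 0)"
    by (intro exI[of _ C]) (auto simp: amplitude_def fourier_coeff_def)
qed

lemma averages_difference_bound:
  fixes \<Omega> :: "(real^'n) set" and G :: "(real^'n) \<times> (real^'n) \<Rightarrow> complex"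
  assumes \<Omega>: "open \<Omega>" and \<omega>: "continuous_on \<Omega> \<omega>" and f0: "C1c_torus \<Omega> f0" and G: "C_torus \<Omega> G"
    and K: "K \<ge> 1"
  shows "ennreal (cmod (time_average \<Omega> \<omega> f0 G t - initial_average \<Omega> f0 (angle_average G)))
    \<le> ennreal ((2 * pi) ^ CARD('n)) * (\<Sum>k\<in>low_modes K. ennreal (cmod (LINT I:\<Omega>|lebesgue.
          amplitude G f0 k I * exp (\<i> * complex_of_real (t * phase \<omega> k I)))))
      + tail \<Omega> G f0 K"
proof -
  let ?N = "(2 * pi) ^ CARD('n)"
  let ?a = "amplitude G f0"
  let ?f = "\<lambda>z. complex_of_real (f0 z)"
  let ?A = "insert 0 (low_modes K) :: (int^'n) set"
  note fC = C1c_torus_imp_C_torus[OF f0]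
  note ac = amplitude_properties(1)[OF f0 G]
  obtain C where C: "compact C" "C \<subseteq> \<Omega>" "\<And>I \<theta>. I \<in> \<Omega> - C \<Longrightarrow> f0 (I, \<theta>) = 0"
    "\<And>k I. I \<in> \<Omega> - C \<Longrightarrow> ?a k I = 0"
    using amplitude_properties(2)[OF f0 G] by blast
  define E where "E k I = ?a k I * exp (\<i> * complex_of_real (t * phase \<omega> k I))" for k I
  define T where "T I = integral torus_cube (\<lambda>\<theta>. G (I, \<theta> + t *\<^sub>R \<omega> I) * ?f (I, \<theta>))" for I
  \<comment> \<open>The pointwise Parseval remainder, after removal of the zero mode and of the low
    modes. Its integral over \<open>\<Omega>\<close> is the contribution that the tail has to
    absorb.\<close>
  define R where "R I = T I - complex_of_real ?N * (\<Sum>k\<in>?A. E k I)" for I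
  have Gc: "continuous_on (\<Omega> \<times> UNIV) G" and fc: "continuous_on (\<Omega> \<times> UNIV) ?f"
    using G fC by (auto simp: C_torus_def)
  have \<omega>2: "continuous_on (\<Omega> \<times> UNIV) (\<lambda>z. \<omega> (fst z))"
    by (intro continuous_on_compose2[OF \<omega>] continuous_intros) auto
  have hc: "continuous_on (\<Omega> \<times> UNIV) (\<lambda>z. G (flow \<omega> t z) * ?f z)"
    unfolding flow_def split_beta'
    by (intro continuous_intros fc continuous_on_compose2[OF Gc] \<omega>2) auto
  have ta: "time_average \<Omega> \<omega> f0 G t = (LINT I:\<Omega>|lebesgue. T I)"
    unfolding time_average_def
    by (subst torus_fubini[OF hc C(1,2)]) (auto simp: C(3) T_def[abs_def] flow_def)
  have Tc: "continuous_on \<Omega> T"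
    using torus_integral_continuous[OF hc] by (simp add: T_def[abs_def] flow_def)
  have Ec: "continuous_on \<Omega> (E k)" for k
    unfolding E_def phase_def by (intro continuous_intros ac \<omega>)
  have Tz: "T I = 0" if "I \<in> \<Omega> - C" for I using C(3)[OF that] by (simp add: T_def)
  have Ez: "E k I = 0" if "I \<in> \<Omega> - C" for k I using C(4)[OF that] by (simp add: E_def)
  have Ti: "set_integrable lebesgue \<Omega> T" by (rule supported_integrable[OF Tc C(1,2) Tz])
  have Ei: "set_integrable lebesgue \<Omega> (E k)" for k by (rule supported_integrable[OF Ec C(1,2) Ez])
  have ang: "angle_average G I = torus_coeff (\<lambda>\<theta>. G (I, \<theta>)) 0" if "I \<in> \<Omega>" for I
    using fourier_coeff_eq[OF G that, of 0] by (simp add: angle_average_def fourier_coeff_def)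
  have angc: "continuous_on \<Omega> (angle_average G)"
    by (rule continuous_on_eq[OF fourier_coeff_continuous[OF G, of 0]])
      (simp add: fourier_coeff_def angle_average_def)
  have ic: "continuous_on (\<Omega> \<times> UNIV) (\<lambda>z. angle_average G (fst z) * ?f z)"
    by (intro continuous_intros fc continuous_on_compose2[OF angc]) auto
  \<comment> \<open>The angle average is the coefficient of frequency 0, and the phase of that
    frequency is 0. The zero mode is therefore independent of time and cancels in the difference of
    the two averages.\<close>
  have "initial_average \<Omega> f0 (angle_average G)
      = (LINT I:\<Omega>|lebesgue. integral torus_cube (\<lambda>\<theta>. angle_average G I * ?f (I, \<theta>)))"
    unfolding initial_average_def by (subst torus_fubini[OF ic C(1,2)]) (auto simp: C(3))
  also have "\<dots> = (LINT I:\<Omega>|lebesgue. complex_of_real ?N * E 0 I)"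
  proof (rule set_lebesgue_integral_cong)
    show "\<forall>I. I \<in> \<Omega> \<longrightarrow> integral torus_cube (\<lambda>\<theta>. angle_average G I * ?f (I, \<theta>)) = complex_of_real ?N * E 0 I"
    proof (intro allI impI)
      fix I assume I: "I \<in> \<Omega>"
      have "integral torus_cube (\<lambda>\<theta>. angle_average G I * ?f (I, \<theta>))
          = angle_average G I * integral torus_cube (\<lambda>\<theta>. ?f (I, \<theta>) * torus_char 0 \<theta>)"
        by (simp add: torus_char_simps(1) Henstock_Kurzweil_Integration.integral_mult_right)
      also have "\<dots> = complex_of_real ?N * E 0 I"
        using I by (subst torus_coeff_integral)
          (simp add: ang E_def amplitude_def phase_def fourier_coeff_eq[OF G I] fourier_coeff_eq[OF fC I])
      finally show "integral torus_cube (\<lambda>\<theta>. angle_average G I * ?f (I, \<theta>)) = complex_of_real ?N * E 0 I" .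
    qed
  qed (use \<Omega> in auto)
  also have "\<dots> = complex_of_real ?N * (LINT I:\<Omega>|lebesgue. E 0 I)" by simp
  finally have ia: "initial_average \<Omega> f0 (angle_average G) = complex_of_real ?N * (LINT I:\<Omega>|lebesgue. E 0 I)" .
  have Si: "set_integrable lebesgue \<Omega> (\<lambda>I. \<Sum>k\<in>?A. E k I)"
    using Ei unfolding set_integrable_def scaleR_sum_right by (intro Bochner_Integration.integrable_sum) blast
  have "(LINT I:\<Omega>|lebesgue. (\<Sum>k\<in>?A. E k I)) = (\<Sum>k\<in>?A. LINT I:\<Omega>|lebesgue. E k I)"
    using Ei unfolding set_integrable_def set_lebesgue_integral_def scaleR_sum_right
    by (intro Bochner_Integration.integral_sum) blast
  then have "(LINT I:\<Omega>|lebesgue. R I)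
      = (LINT I:\<Omega>|lebesgue. T I) - complex_of_real ?N * (\<Sum>k\<in>?A. LINT I:\<Omega>|lebesgue. E k I)"
    unfolding R_def using Ti Si by (subst set_integral_diff(2)) auto
  moreover have "(\<Sum>k\<in>?A. LINT I:\<Omega>|lebesgue. E k I)
      = (LINT I:\<Omega>|lebesgue. E 0 I) + (\<Sum>k\<in>low_modes K. LINT I:\<Omega>|lebesgue. E k I)"
    by (rule sum.insert[OF finite_low_modes low_modes_partition(2)[OF K]])
  ultimately have "time_average \<Omega> \<omega> f0 G t - initial_average \<Omega> f0 (angle_average G)
      = complex_of_real ?N * (\<Sum>k\<in>low_modes K. LINT I:\<Omega>|lebesgue. E k I) + (LINT I:\<Omega>|lebesgue. R I)"
    unfolding ta ia by (simp add: algebra_simps)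
  also have "norm \<dots> \<le> ?N * (\<Sum>k\<in>low_modes K. cmod (LINT I:\<Omega>|lebesgue. E k I))
      + norm (LINT I:\<Omega>|lebesgue. R I)"
  proof (rule norm_triangle_mono)
    have "norm (complex_of_real ?N * (\<Sum>k\<in>low_modes K. LINT I:\<Omega>|lebesgue. E k I))
        = ?N * norm (\<Sum>k\<in>low_modes K. LINT I:\<Omega>|lebesgue. E k I)"
      by (simp add: norm_mult norm_power)
    also have "\<dots> \<le> ?N * (\<Sum>k\<in>low_modes K. cmod (LINT I:\<Omega>|lebesgue. E k I))"
      by (intro mult_left_mono norm_sum) simp
    finally show "norm (complex_of_real ?N * (\<Sum>k\<in>low_modes K. LINT I:\<Omega>|lebesgue. E k I))
        \<le> ?N * (\<Sum>k\<in>low_modes K. cmod (LINT I:\<Omega>|lebesgue. E k I))" .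
  qed simp
  finally have "ennreal (cmod (time_average \<Omega> \<omega> f0 G t - initial_average \<Omega> f0 (angle_average G)))
      \<le> ennreal (?N * (\<Sum>k\<in>low_modes K. cmod (LINT I:\<Omega>|lebesgue. E k I))
        + norm (LINT I:\<Omega>|lebesgue. R I))" by (rule ennreal_leI)
  also have "\<dots> = ennreal ?N * (\<Sum>k\<in>low_modes K. ennreal (cmod (LINT I:\<Omega>|lebesgue. E k I)))
      + ennreal (norm (LINT I:\<Omega>|lebesgue. R I))"
    by (simp add: ennreal_plus ennreal_mult sum_nonneg sum_ennreal)
  also have "ennreal (norm (LINT I:\<Omega>|lebesgue. R I)) \<le> tail \<Omega> G f0 K"
  proof -
    have Rc: "continuous_on \<Omega> R" unfolding R_def by (intro continuous_intros Tc Ec)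
    have Ri: "set_integrable lebesgue \<Omega> R"
      by (rule supported_integrable[OF Rc C(1,2)]) (simp add: R_def Tz Ez)
    have Rle: "ennreal (norm (R I)) \<le> ennreal ?N * (\<Sum>\<^sub>\<infinity>k\<in>- ?A. ennreal (norm (?a k I)))" if I: "I \<in> \<Omega>" for I
    proof -
      \<comment> \<open>Read backwards, \<open>E k I\<close> is a product of coefficients of the
        translated observable and of \<open>f0\<close>, which is the form that the Parseval estimate
        expects.\<close>
      have E_eq: "E k I = torus_coeff (\<lambda>\<theta>. G (I, \<theta> + t *\<^sub>R \<omega> I)) k * torus_coeff (\<lambda>\<theta>. ?f (I, \<theta>)) (- k)" for k
        unfolding torus_coeff_shift[OF C_torus_slice[OF G I], of "t *\<^sub>R \<omega> I"]
        by (simp add: E_def amplitude_def phase_def fourier_coeff_eq[OF G I] fourier_coeff_eq[OF fC I]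
            torus_char_def)
      \<comment> \<open>The oscillating factor has modulus 1, so the tail bound is the same for all
        times.\<close>
      have "norm (E k I) = norm (?a k I)" for k by (simp add: E_def norm_mult)
      moreover have "ennreal (norm (R I)) \<le> ennreal ?N * (\<Sum>\<^sub>\<infinity>k\<in>- ?A. ennreal (norm (E k I)))"
        unfolding R_def T_def E_eq
        by (rule torus_parseval_tail[OF C_torus_slice[OF fC I] torus_function_shift[OF C_torus_slice[OF G I]]])
          (simp add: finite_low_modes)
      ultimately show ?thesis by simp
    qed
    have m: "(\<lambda>I. ennreal (norm (?a k I)) * indicator \<Omega> I) \<in> borel_measurable lebesgue" for k
    proof -
      have "(\<lambda>I. indicat_real \<Omega> I *\<^sub>R norm (?a k I)) \<in> borel_measurable borel"
        using \<Omega> by (intro borel_measurable_continuous_on_indicator continuous_intros ac) auto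
      then have "(\<lambda>I. ennreal (indicat_real \<Omega> I *\<^sub>R norm (?a k I))) \<in> borel_measurable lebesgue"
        by (intro measurable_completion) auto
      moreover have "(\<lambda>I. ennreal (indicat_real \<Omega> I *\<^sub>R norm (?a k I))) = (\<lambda>I. ennreal (norm (?a k I)) * indicator \<Omega> I)"
        by (auto simp: indicator_def fun_eq_iff)
      ultimately show ?thesis by (simp only:)
    qed
    \<comment> \<open>The pointwise bound is integrated over the actions, and Tonelli moves the
      integral inside the sum, whose terms become the \<open>L1_norm\<close> values in
      \<open>tail\<close>.\<close>
    have "ennreal (norm (LINT I:\<Omega>|lebesgue. R I)) \<le> L1_norm \<Omega> R"
      unfolding L1_norm_eq_integral[OF Ri] by (intro ennreal_leI set_integral_norm_bound Ri)
    also have "\<dots> \<le> (\<integral>\<^sup>+I. ennreal ?N * (\<Sum>\<^sub>\<infinity>k\<in>- ?A. ennreal (norm (?a k I)) * indicator \<Omega> I) \<partial>lebesgue)"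
      unfolding L1_norm_def by (rule nn_integral_mono) (use Rle in \<open>auto simp: indicator_def\<close>)
    also have "\<dots> = ennreal ?N * (\<integral>\<^sup>+I. (\<Sum>\<^sub>\<infinity>k\<in>- ?A. ennreal (norm (?a k I)) * indicator \<Omega> I) \<partial>lebesgue)"
      by (rule nn_integral_cmult[OF borel_measurable_infsum_ennreal[OF m]])
    also have "\<dots> = ennreal ?N * (\<Sum>\<^sub>\<infinity>k\<in>- ?A. L1_norm \<Omega> (?a k))"
      unfolding nn_integral_infsum[OF m] L1_norm_def ..
    also have "\<dots> = tail \<Omega> G f0 K"
      unfolding tail_def low_modes_partition(1)[OF K] ..
    finally show ?thesis .
  qed
  finally show ?thesis unfolding E_def by (simp add: add_left_mono)
qed
section \<open>The explicit bound on the flux divergence\<close>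

lemma linear_functional_eq_inner:
  fixes f :: "real^'n \<Rightarrow> real"
  assumes "bounded_linear f"
  shows "f v = (\<chi> j. f (axis j 1)) \<bullet> v"
proof -
  interpret bounded_linear f by fact
  have "f v = f (\<Sum>j\<in>UNIV. v $ j *\<^sub>R axis j 1)"
    using basis_expansion[of v] by (simp add: scalar_mult_eq_scaleR)
  then have "f v = (\<Sum>j\<in>UNIV. v $ j *\<^sub>R f (axis j 1))" by (simp add: sum scaleR)
  then show ?thesis by (simp add: inner_vec_def mult.commute)
qed

text \<open>Used at two levels: with \<open>w\<close> the frequency map it yields the gradient of
  the phase, and with \<open>w\<close> a directional derivative of the frequency map it yields the
  rows of the Hessian. At the second level \<open>f\<close> is a component of a gradient, known in
  this form only on \<open>S\<close>, hence the hypothesis on \<open>f\<close>.\<close>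

lemma inner_Ck_on_1_gradient:
  fixes w :: "real^'n \<Rightarrow> real^'m"
  assumes S: "open S" and w: "Ck_on 1 S w" and f: "\<And>x. x \<in> S \<Longrightarrow> f x = c \<bullet> w x"
  defines "Q \<equiv> \<lambda>x. \<chi> j. c \<bullet> frechet_derivative w (at x) (axis j 1)"
  shows "continuous_on S Q" "\<And>x. x \<in> S \<Longrightarrow> (f has_derivative (\<lambda>v. Q x \<bullet> v)) (at x)"
proof -
  show "continuous_on S Q"
    unfolding Q_def by (intro continuous_intros Ck_on_1D(2)[OF w])
  fix x assume x: "x \<in> S"
  let ?L = "frechet_derivative w (at x)"
  have d: "(w has_derivative ?L) (at x)"
    using Ck_on_1D(1)[OF w x] by (simp add: frechet_derivative_works)
  have "((\<lambda>x. c \<bullet> w x) has_derivative (\<lambda>v. c \<bullet> ?L v)) (at x)"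
    by (rule has_derivative_inner_right[OF d])
  moreover from has_derivative_bounded_linear[OF this] have "c \<bullet> ?L v = Q x \<bullet> v" for v
    unfolding Q_def by (rule linear_functional_eq_inner)
  ultimately have "((\<lambda>x. c \<bullet> w x) has_derivative (\<lambda>v. Q x \<bullet> v)) (at x)" by simp
  then show "(f has_derivative (\<lambda>v. Q x \<bullet> v)) (at x)"
    by (rule has_derivative_transform_within_open[OF _ S x]) (simp add: f)
qed

lemma grad_Ck_on_1:
  assumes S: "open S" and f: "Ck_on 1 S f"
  shows "continuous_on S (grad f)" "\<And>x. x \<in> S \<Longrightarrow> (f has_derivative (\<lambda>v. grad f x \<bullet> v)) (at x)"
proof -
  show "continuous_on S (grad f)"
    unfolding grad_def by (intro continuous_intros Ck_on_1D(2)[OF f])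
  fix x assume x: "x \<in> S"
  let ?L = "frechet_derivative f (at x)"
  have d: "(f has_derivative ?L) (at x)"
    using Ck_on_1D(1)[OF f x] by (simp add: frechet_derivative_works)
  from has_derivative_bounded_linear[OF this] have "grad f x \<bullet> v = ?L v" for v
    unfolding grad_def by (rule linear_functional_eq_inner[symmetric])
  with d show "(f has_derivative (\<lambda>v. grad f x \<bullet> v)) (at x)" by simp
qed

lemma test_function_C1_compact:
  assumes "test_function S \<psi>" shows "C1_compact S \<psi> (grad \<psi>)"
proof -
  obtain C where C: "compact C" "C \<subseteq> S" "\<And>x. x \<notin> C \<Longrightarrow> \<psi> x = 0"
    using assms by (auto simp: test_function_def)
  have "Ck_on 1 UNIV \<psi>" using assms unfolding test_function_def by blast
  from grad_Ck_on_1[OF open_UNIV this] have "C1_gradient \<psi> (grad \<psi>)"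
    by (simp add: C1_gradient_def)
  then show ?thesis using C by (rule C1_compactI)
qed

lemma locally_integrable_on_scaleR:
  assumes "continuous_on S h" "locally_integrable_on S w"
  shows "locally_integrable_on S (\<lambda>x. h x *\<^sub>R w x)"
  using assms unfolding locally_integrable_on_def
  by (auto intro!: pairing_integrable intro: continuous_on_subset)

lemma supported_pairing_integrable:
  assumes "continuous_on S h" "locally_integrable_on S w" "compact C" "C \<subseteq> S" "\<And>x. x \<notin> C \<Longrightarrow> h x = 0"
  shows "set_integrable lebesgue S (\<lambda>x. h x *\<^sub>R w x)"
proof -
  have "set_integrable lebesgue C (\<lambda>x. h x *\<^sub>R w x)"
    using locally_integrable_on_scaleR[OF assms(1,2)] assms(3,4) by (simp add: locally_integrable_on_def)
  then show ?thesis using set_integrable_support[of C S "\<lambda>x. h x *\<^sub>R w x" lebesgue] assms by auto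
qed

lemma locally_integrable_on_vec_nth:
  fixes g :: "real^'n \<Rightarrow> complex^'n"
  shows "locally_integrable_on S g \<Longrightarrow> locally_integrable_on S (\<lambda>x. g x $ i)"
  by (auto simp: locally_integrable_on_def intro: set_integrable_vec_nth)

lemma set_integral_finite_sum:
  fixes f :: "'i \<Rightarrow> 'a \<Rightarrow> 'b::{banach, second_countable_topology}"
  assumes "\<And>i. i \<in> I \<Longrightarrow> set_integrable M S (f i)"
  shows "set_integrable M S (\<lambda>x. \<Sum>i\<in>I. f i x)"
    "(LINT x:S|M. (\<Sum>i\<in>I. f i x)) = (\<Sum>i\<in>I. LINT x:S|M. f i x)"
  using assms unfolding set_integrable_def set_lebesgue_integral_def scaleR_sum_right
  by (auto intro: Bochner_Integration.integrable_sum Bochner_Integration.integral_sum)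

lemma locally_integrable_on_add:
  "locally_integrable_on S f \<Longrightarrow> locally_integrable_on S g \<Longrightarrow> locally_integrable_on S (\<lambda>x. f x + g x)"
  by (auto simp: locally_integrable_on_def)

lemma locally_integrable_on_sum:
  "(\<And>i. i \<in> I \<Longrightarrow> locally_integrable_on S (f i)) \<Longrightarrow> locally_integrable_on S (\<lambda>x. \<Sum>i\<in>I. f i x)"
  by (auto simp: locally_integrable_on_def intro!: set_integral_finite_sum(1))

lemma locally_integrable_on_vec:
  fixes F :: "real^'n \<Rightarrow> complex^'n"
  assumes "\<And>i. locally_integrable_on S (\<lambda>x. F x $ i)"
  shows "locally_integrable_on S F"
proof -
  have "F x = (\<Sum>i\<in>UNIV. axis i (F x $ i))" for x
    by (simp add: vec_eq_iff axis_def if_distrib cong: if_cong)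
  moreover have "locally_integrable_on S (\<lambda>x. axis i (F x $ i) :: complex^'n)" for i
  proof -
    have "bounded_linear (axis i :: complex \<Rightarrow> complex^'n)"
      by (intro linear_conv_bounded_linear[THEN iffD1] linearI) (auto simp: vec_eq_iff axis_def)
    note bl = this
    have sc: "axis i (r *\<^sub>R z) = r *\<^sub>R (axis i z :: complex^'n)" for r z
      by (simp add: vec_eq_iff axis_def)
    show ?thesis
      unfolding locally_integrable_on_def
    proof (intro allI impI)
      fix C :: "(real^'n) set" assume "compact C \<and> C \<subseteq> S"
      then have "integrable lebesgue (\<lambda>x. indicat_real C x *\<^sub>R F x $ i)"
        using assms[of i] by (simp add: locally_integrable_on_def set_integrable_def)
      from integrable_bounded_linear[OF bl this]
      show "set_integrable lebesgue C (\<lambda>x. axis i (F x $ i) :: complex^'n)"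
        by (simp add: set_integrable_def sc)
    qed
  qed
  ultimately show ?thesis
    using locally_integrable_on_sum[of UNIV S "\<lambda>i x. axis i (F x $ i)"] by simp
qed

text \<open>The product rule for a weakly differentiable scalar times a C1 field. It is the weak
  gradient identity of \<open>a\<close> tested with \<open>\<psi>\<close> times a component of
  \<open>X\<close>. That product has compact support but is in general only C1, so the extended form
  of the identity is what applies.\<close>

lemma weak_divergence_product:
  fixes X :: "real^'n \<Rightarrow> real^'n"
  assumes S: "open S" and a: "is_weak_gradient S a g"
    and X: "\<And>i x. x \<in> S \<Longrightarrow> ((\<lambda>x. X x $ i) has_derivative (\<lambda>v. E i x \<bullet> v)) (at x)"
      "\<And>i. continuous_on S (E i)"
  shows "is_weak_divergence S (\<lambda>x. \<chi> i. a x * complex_of_real (X x $ i))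
    (\<lambda>x. (\<Sum>i\<in>UNIV. X x $ i *\<^sub>R g x $ i) + (\<Sum>i\<in>UNIV. E i x $ i) *\<^sub>R a x)"
  unfolding is_weak_divergence_def
proof (intro conjI allI impI)
  have al: "locally_integrable_on S a" and gl: "\<And>i. locally_integrable_on S (\<lambda>x. g x $ i)"
    using a locally_integrable_on_vec_nth[of S g] by (auto simp: is_weak_gradient_def)
  have Xc: "continuous_on S (\<lambda>x. X x $ i)" for i
    using X(1) by (meson continuous_at_imp_continuous_on has_derivative_continuous)
  have Ec: "continuous_on S (\<lambda>x. E i x $ i)" for i using X(2) by (intro continuous_intros)
  show "locally_integrable_on S (\<lambda>x. \<chi> i. a x * complex_of_real (X x $ i))"
    using locally_integrable_on_scaleR[OF Xc al]
    by (intro locally_integrable_on_vec) (simp add: scaleR_conv_of_real mult.commute)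
  show "locally_integrable_on S (\<lambda>x. (\<Sum>i\<in>UNIV. X x $ i *\<^sub>R g x $ i) + (\<Sum>i\<in>UNIV. E i x $ i) *\<^sub>R a x)"
    by (intro locally_integrable_on_add locally_integrable_on_sum locally_integrable_on_scaleR
        Xc gl al continuous_on_sum Ec)
  fix \<psi> assume "test_function S \<psi>"
  then have \<psi>: "C1_compact S \<psi> (grad \<psi>)" by (rule test_function_C1_compact)
  then obtain C where C: "compact C" "C \<subseteq> S" "\<And>x. x \<notin> C \<Longrightarrow> \<psi> x = 0 \<and> grad \<psi> x = 0"
    and \<psi>D: "C1_gradient \<psi> (grad \<psi>)" by (auto simp: C1_compact_def)
  have \<psi>c: "continuous_on S \<psi>" "continuous_on S (grad \<psi>)"
    using C1_gradient_continuous[OF \<psi>D] \<psi>D by (auto simp: C1_gradient_def intro: continuous_on_subset)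
  let ?Gi = "\<lambda>i x. (\<psi> x * X x $ i) *\<^sub>R g x $ i"
  let ?Ei = "\<lambda>i x. (\<psi> x * E i x $ i) *\<^sub>R a x"
  let ?Di = "\<lambda>i x. (grad \<psi> x $ i * X x $ i) *\<^sub>R a x"
  have i1: "set_integrable lebesgue S (?Gi i)" for i
    by (rule supported_pairing_integrable[OF _ gl C(1,2)])
      (auto intro!: continuous_intros \<psi>c Xc simp: C(3))
  have i2: "set_integrable lebesgue S (?Ei i)" for i
    by (rule supported_pairing_integrable[OF _ al C(1,2)])
      (auto intro!: continuous_intros \<psi>c Ec simp: C(3))
  have i3: "set_integrable lebesgue S (?Di i)" for i
    by (rule supported_pairing_integrable[OF _ al C(1,2)])
      (auto intro!: continuous_intros \<psi>c Xc simp: C(3))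
  have parts: "(LINT x:S|lebesgue. ?Gi i x) = - (LINT x:S|lebesgue. ?Ei i x) - (LINT x:S|lebesgue. ?Di i x)" for i
  proof -
    have "(LINT x:S|lebesgue. ?Gi i x)
        = - (LINT x:S|lebesgue. ((\<psi> x *\<^sub>R E i x + X x $ i *\<^sub>R grad \<psi> x) $ i) *\<^sub>R a x)"
      by (rule weak_gradient_C1_compact[OF S a C1_compact_mult[OF S \<psi> X]])
    also have "(LINT x:S|lebesgue. ((\<psi> x *\<^sub>R E i x + X x $ i *\<^sub>R grad \<psi> x) $ i) *\<^sub>R a x)
        = (LINT x:S|lebesgue. ?Ei i x + ?Di i x)"
      by (simp add: scaleR_left_distrib mult.commute[of "X _ $ i"])
    also have "\<dots> = (LINT x:S|lebesgue. ?Ei i x) + (LINT x:S|lebesgue. ?Di i x)"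
      by (rule set_integral_add(2)[OF i2 i3])
    finally show ?thesis by simp
  qed
  have "(LINT x:S|lebesgue. \<psi> x *\<^sub>R ((\<Sum>i\<in>UNIV. X x $ i *\<^sub>R g x $ i) + (\<Sum>i\<in>UNIV. E i x $ i) *\<^sub>R a x))
      = (LINT x:S|lebesgue. (\<Sum>i\<in>UNIV. ?Gi i x) + (\<Sum>i\<in>UNIV. ?Ei i x))"
    by (simp add: scaleR_right_distrib scaleR_sum_right scaleR_sum_left sum_distrib_left)
  also have "\<dots> = (\<Sum>i\<in>UNIV. LINT x:S|lebesgue. ?Gi i x) + (\<Sum>i\<in>UNIV. LINT x:S|lebesgue. ?Ei i x)"
    using i1 i2 by (simp add: set_integral_add(2) set_integral_finite_sum)
  also have "\<dots> = - (\<Sum>i\<in>UNIV. LINT x:S|lebesgue. ?Di i x)"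
    unfolding parts by (simp add: sum_subtractf sum_negf)
  also have "\<dots> = - (LINT x:S|lebesgue. (\<Sum>i\<in>UNIV. ?Di i x))"
    using i3 by (simp add: set_integral_finite_sum)
  also have "\<dots> = - (LINT x:S|lebesgue. (\<Sum>i\<in>UNIV. (grad \<psi> x $ i) *\<^sub>R (\<chi> i. a x * complex_of_real (X x $ i)) $ i))"
    by (simp add: scaleR_conv_of_real ac_simps)
  finally show "(LINT x:S|lebesgue. \<psi> x *\<^sub>R ((\<Sum>i\<in>UNIV. X x $ i *\<^sub>R g x $ i) + (\<Sum>i\<in>UNIV. E i x $ i) *\<^sub>R a x))
      = - (LINT x:S|lebesgue. (\<Sum>i\<in>UNIV. (grad \<psi> x $ i) *\<^sub>R (\<chi> i. a x * complex_of_real (X x $ i)) $ i))" .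
qed

text \<open>For a field \<open>p\<close> with Jacobian rows \<open>Q i\<close>, the gradient of the \<open>i\<close>-th component
  of \<open>p / (norm p)\<^sup>2\<close>.\<close>

definition inversion_gradient ::
    "(real^'n \<Rightarrow> real^'n) \<Rightarrow> ('n \<Rightarrow> real^'n \<Rightarrow> real^'n) \<Rightarrow> 'n \<Rightarrow> real^'n \<Rightarrow> real^'n" where
  "inversion_gradient p Q i x = (1 / (p x \<bullet> p x)) *\<^sub>R Q i x
     - (2 * p x $ i / (p x \<bullet> p x)\<^sup>2) *\<^sub>R (\<Sum>l\<in>UNIV. p x $ l *\<^sub>R Q l x)"

lemma inversion_field_has_derivative:
  fixes p :: "real^'n \<Rightarrow> real^'n"
  assumes Q: "\<And>i. ((\<lambda>x. p x $ i) has_derivative (\<lambda>v. Q i x \<bullet> v)) (at x)" and p: "p x \<noteq> 0"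
  shows "((\<lambda>x. p x $ i / (norm (p x))\<^sup>2) has_derivative (\<lambda>v. inversion_gradient p Q i x \<bullet> v)) (at x)"
proof -
  let ?P = "\<lambda>v. \<Sum>l\<in>UNIV. 2 * (p x $ l * (Q l x \<bullet> v))"
  have "((\<lambda>x. \<Sum>l\<in>UNIV. p x $ l * p x $ l) has_derivative ?P) (at x)"
    by (rule has_derivative_eq_rhs, rule has_derivative_sum, rule has_derivative_mult[OF Q Q])
      (simp add: algebra_simps)
  then have P: "((\<lambda>x. p x \<bullet> p x) has_derivative ?P) (at x)" by (simp add: inner_vec_def)
  have nz: "p x \<bullet> p x \<noteq> 0" using p by simp
  have "((\<lambda>x. p x $ i / (p x \<bullet> p x)) has_derivative
      (\<lambda>v. ((Q i x \<bullet> v) * (p x \<bullet> p x) - p x $ i * ?P v) / ((p x \<bullet> p x) * (p x \<bullet> p x)))) (at x)"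
    by (rule has_derivative_divide'[OF Q P nz])
  moreover have "((Q i x \<bullet> v) * (p x \<bullet> p x) - p x $ i * ?P v) / ((p x \<bullet> p x) * (p x \<bullet> p x))
      = inversion_gradient p Q i x \<bullet> v" for v
  proof -
    have "?P v = 2 * ((\<Sum>l\<in>UNIV. p x $ l *\<^sub>R Q l x) \<bullet> v)"
      by (simp add: inner_sum_left sum_distrib_left)
    then show ?thesis using nz
      by (simp add: inversion_gradient_def inner_diff_left diff_divide_distrib power2_eq_square)
  qed
  ultimately show ?thesis by (simp add: power2_norm_eq_inner)
qed

text \<open>Origin of the factor \<open>CARD('n) + 2\<close>. The divergence of
  \<open>p / (norm p)\<^sup>2\<close> is the trace of the Jacobian over
  \<open>(norm p)\<^sup>2\<close>, minus twice its quadratic form at \<open>p\<close> over the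
  fourth power. Each of the \<open>CARD('n)\<close> diagonal entries is at most the operator norm,
  the quadratic form at most the operator norm times \<open>(norm p)\<^sup>2\<close>, and the 2
  comes from differentiating the square of the norm.\<close>

lemma inversion_divergence_bound:
  fixes p :: "real^'n \<Rightarrow> real^'n" and Q :: "'n \<Rightarrow> real^'n \<Rightarrow> real^'n"
  defines "L \<equiv> \<lambda>x v. \<chi> i. Q i x \<bullet> v"
  assumes p: "p x \<noteq> 0"
  shows "\<bar>\<Sum>i\<in>UNIV. inversion_gradient p Q i x $ i\<bar> \<le> real (CARD('n) + 2) * onorm (L x) / (norm (p x))\<^sup>2"
proof -
  let ?q = "p x \<bullet> p x"
  have bl: "bounded_linear (L x)"
    unfolding L_def by (intro linear_conv_bounded_linear[THEN iffD1] linearI)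
      (auto simp: vec_eq_iff inner_add_right)
  have q: "?q > 0" using p by simp
  have tr: "\<bar>\<Sum>i\<in>UNIV. Q i x $ i\<bar> \<le> real CARD('n) * onorm (L x)"
  proof -
    have "\<bar>Q i x $ i\<bar> \<le> onorm (L x)" for i
    proof -
      have "Q i x $ i = L x (axis i 1) $ i" by (simp add: L_def inner_axis)
      also have "\<bar>\<dots>\<bar> \<le> norm (L x (axis i 1))" by (rule component_le_norm_cart)
      also have "\<dots> \<le> onorm (L x)" using onorm[OF bl, of "axis i 1"] by simp
      finally show ?thesis .
    qed
    then have "(\<Sum>i\<in>UNIV. \<bar>Q i x $ i\<bar>) \<le> (\<Sum>i\<in>(UNIV::'n set). onorm (L x))" by (intro sum_mono)
    then show ?thesis by (intro order_trans[OF sum_abs]) simp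
  qed
  have quad: "\<bar>p x \<bullet> L x (p x)\<bar> \<le> onorm (L x) * ?q"
  proof -
    have "\<bar>p x \<bullet> L x (p x)\<bar> \<le> norm (p x) * norm (L x (p x))" by (rule Cauchy_Schwarz_ineq2)
    also have "\<dots> \<le> norm (p x) * (onorm (L x) * norm (p x))" by (intro mult_left_mono onorm[OF bl]) simp
    finally show ?thesis by (simp add: ac_simps flip: power2_norm_eq_inner) (simp add: power2_eq_square ac_simps)
  qed
  have "(\<Sum>i\<in>UNIV. inversion_gradient p Q i x $ i)
      = (\<Sum>i\<in>UNIV. Q i x $ i) / ?q - 2 * (\<Sum>i\<in>UNIV. p x $ i * (\<Sum>l\<in>UNIV. p x $ l * Q l x $ i)) / ?q\<^sup>2"
    by (simp add: inversion_gradient_def sum_subtractf sum_divide_distrib sum_distrib_left ac_simps)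
  also have "(\<Sum>i\<in>UNIV. p x $ i * (\<Sum>l\<in>UNIV. p x $ l * Q l x $ i)) = p x \<bullet> L x (p x)"
    unfolding L_def inner_vec_def
    by (simp add: sum_distrib_left, subst sum.swap) (simp add: ac_simps)
  also have "\<bar>(\<Sum>i\<in>UNIV. Q i x $ i) / ?q - 2 * (p x \<bullet> L x (p x)) / ?q\<^sup>2\<bar>
      \<le> real CARD('n) * onorm (L x) / ?q + 2 * (onorm (L x) * ?q) / ?q\<^sup>2"
  proof -
    have "\<bar>(\<Sum>i\<in>UNIV. Q i x $ i) / ?q\<bar> \<le> real CARD('n) * onorm (L x) / ?q"
      using tr q by (simp add: abs_divide divide_right_mono)
    moreover have "\<bar>2 * (p x \<bullet> L x (p x)) / ?q\<^sup>2\<bar> \<le> 2 * (onorm (L x) * ?q) / ?q\<^sup>2"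
      using quad by (simp add: abs_divide abs_mult divide_right_mono)
    ultimately show ?thesis by linarith
  qed
  also have "\<dots> = real (CARD('n) + 2) * onorm (L x) / ?q"
    using q by (simp add: power2_eq_square field_simps)
  finally show ?thesis by (simp add: power2_norm_eq_inner)
qed

lemma L1_norm_le_weighted:
  fixes g :: "real^'n \<Rightarrow> complex^'n" and a :: "real^'n \<Rightarrow> complex" and u :: "real^'n \<Rightarrow> complex"
  assumes S: "open S" and g: "set_integrable lebesgue S g" and a: "set_integrable lebesgue S a"
    and u: "\<And>x. x \<in> S \<Longrightarrow> ennreal (norm (u x)) \<le> c * ennreal (norm (g x)) + d * ennreal \<bar>h x\<bar> * ennreal (norm (a x))"
  shows "L1_norm S u \<le> c * L1_norm S g + d * Linf_norm S h * L1_norm S a"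
proof -
  have m: "(\<lambda>x. ennreal (norm (w x)) * indicator S x) \<in> borel_measurable lebesgue"
    if "set_integrable lebesgue S w" for w :: "real^'n \<Rightarrow> 'c::{banach, second_countable_topology}"
  proof -
    have "(\<lambda>x. indicat_real S x *\<^sub>R w x) \<in> borel_measurable lebesgue"
      using that unfolding set_integrable_def by (rule borel_measurable_integrable)
    then have "(\<lambda>x. ennreal (norm (indicat_real S x *\<^sub>R w x))) \<in> borel_measurable lebesgue" by measurable
    moreover have "(\<lambda>x. ennreal (norm (indicat_real S x *\<^sub>R w x))) = (\<lambda>x. ennreal (norm (w x)) * indicator S x)"
      by (auto simp: indicator_def fun_eq_iff)
    ultimately show ?thesis by (simp only:)
  qed
  have "AE x in lebesgue_on S. ennreal \<bar>h x\<bar> \<le> Linf_norm S h"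
    unfolding Linf_norm_def by (rule esssup_AE)
  then have "AE x in lebesgue. x \<in> S \<longrightarrow> ennreal \<bar>h x\<bar> \<le> Linf_norm S h"
    using S by (subst (asm) AE_restrict_space_iff) auto
  then have "AE x in lebesgue. ennreal (norm (u x)) * indicator S x
      \<le> c * (ennreal (norm (g x)) * indicator S x)
        + d * Linf_norm S h * (ennreal (norm (a x)) * indicator S x)"
  proof (rule AE_mp, intro AE_I2 impI)
    fix x assume h: "x \<in> S \<longrightarrow> ennreal \<bar>h x\<bar> \<le> Linf_norm S h"
    show "ennreal (norm (u x)) * indicator S x \<le> c * (ennreal (norm (g x)) * indicator S x)
        + d * Linf_norm S h * (ennreal (norm (a x)) * indicator S x)"
    proof (cases "x \<in> S")
      case True
      then have "d * ennreal \<bar>h x\<bar> * ennreal (norm (a x)) \<le> d * Linf_norm S h * ennreal (norm (a x))"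
        using h by (intro mult_mono) auto
      then show ?thesis using u[OF True] True by (simp add: add_left_mono order_trans)
    qed simp
  qed
  then have "L1_norm S u \<le> (\<integral>\<^sup>+x. c * (ennreal (norm (g x)) * indicator S x)
      + d * Linf_norm S h * (ennreal (norm (a x)) * indicator S x) \<partial>lebesgue)"
    unfolding L1_norm_def by (rule nn_integral_mono_AE)
  also have "\<dots> = c * L1_norm S g + d * Linf_norm S h * L1_norm S a"
    unfolding L1_norm_def using m[OF g] m[OF a] by (simp add: nn_integral_add nn_integral_cmult)
  finally show ?thesis .
qed

lemma phase_gradient:
  fixes \<omega> :: "real^'n \<Rightarrow> real^'n"
  assumes \<Omega>: "open \<Omega>" and \<omega>: "Ck_on 1 \<Omega> \<omega>"
  shows "x \<in> \<Omega> \<Longrightarrow> grad (phase \<omega> k) x = (\<chi> j. rvec k \<bullet> frechet_derivative \<omega> (at x) (axis j 1))"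
    "x \<in> \<Omega> \<Longrightarrow> (phase \<omega> k has_derivative (\<lambda>v. grad (phase \<omega> k) x \<bullet> v)) (at x)"
    "continuous_on \<Omega> (grad (phase \<omega> k))"
proof -
  have ph: "phase \<omega> k x = rvec k \<bullet> \<omega> x" for x by (simp add: phase_def)
  note Q = inner_Ck_on_1_gradient[OF \<Omega> \<omega> ph]
  show g: "grad (phase \<omega> k) x = (\<chi> j. rvec k \<bullet> frechet_derivative \<omega> (at x) (axis j 1))" if "x \<in> \<Omega>" for x
    by (rule grad_eqI[OF Q(2)[OF that]])
  show "(phase \<omega> k has_derivative (\<lambda>v. grad (phase \<omega> k) x \<bullet> v)) (at x)" if "x \<in> \<Omega>" for x
    using Q(2)[OF that] by (simp add: g[OF that])
  show "continuous_on \<Omega> (grad (phase \<omega> k))"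
    by (rule continuous_on_eq[OF Q(1)]) (simp add: g)
qed

lemma gap_pos:
  assumes "gap \<Omega> \<omega> k > 0" "x \<in> \<Omega>"
  shows "gap \<Omega> \<omega> k \<le> ennreal (norm (grad (phase \<omega> k) x))" "grad (phase \<omega> k) x \<noteq> 0"
proof -
  show le: "gap \<Omega> \<omega> k \<le> ennreal (norm (grad (phase \<omega> k) x))"
    unfolding gap_def by (rule INF_lower[OF assms(2)])
  then show "grad (phase \<omega> k) x \<noteq> 0" using assms(1) by auto
qed

lemma ennreal_le_divideI:
  fixes x y :: ennreal
  assumes "r > 0" "ennreal r * x \<le> y" shows "x \<le> y / ennreal r"
proof -
  have "x = (x * ennreal r) / ennreal r"
    by (rule mult_divide_eq_ennreal[symmetric]) (use assms(1) in auto)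
  also have "\<dots> \<le> y / ennreal r"
    using assms(2) by (intro divide_right_mono_ennreal) (simp add: mult.commute)
  finally show ?thesis .
qed

text \<open>Transfers a bound valid for each weak gradient to the infimum that defines
  \<open>weak_gradient_L1_norm\<close>. For finite \<open>R\<close> the inequality is rearranged
  until only \<open>f g\<close> stands on the right, the infimum is taken there, and the
  rearrangement is undone.\<close>

lemma ennreal_le_INF_divide_add:
  fixes D R :: ennreal
  assumes r: "r > 0" and le: "\<And>g. g \<in> A \<Longrightarrow> D \<le> f g / ennreal r + R"
  shows "D \<le> (INF g\<in>A. f g) / ennreal r + R"
proof (cases "R = top")
  case False
  have "ennreal r * (D - R) \<le> f g" if "g \<in> A" for g
  proof -
    have "D - R \<le> f g / ennreal r"
      using le[OF that] False by (simp add: ennreal_minus_le_iff add.commute)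
    then have "ennreal r * (D - R) \<le> ennreal r * (f g / ennreal r)" by (intro mult_left_mono) auto
    also have "\<dots> = f g * (ennreal r / ennreal r)" by (simp add: ennreal_times_divide mult.commute)
    also have "\<dots> = f g" using r by simp
    finally show ?thesis .
  qed
  then have "ennreal r * (D - R) \<le> (INF g\<in>A. f g)" by (rule INF_greatest)
  then have "D - R \<le> (INF g\<in>A. f g) / ennreal r" by (rule ennreal_le_divideI[OF r])
  then show ?thesis using False by (simp add: ennreal_minus_le_iff add.commute)
qed simp

lemma set_integrable_if_L1_norm_finite:
  fixes u :: "real^'n \<Rightarrow> complex"
  assumes "(\<lambda>x. indicat_real S x *\<^sub>R u x) \<in> borel_measurable lebesgue" "L1_norm S u < top"
  shows "set_integrable lebesgue S u"
  unfolding set_integrable_def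
proof (rule integrableI_bounded[OF assms(1)])
  have "(\<integral>\<^sup>+x. ennreal (norm (indicat_real S x *\<^sub>R u x)) \<partial>lebesgue) = L1_norm S u"
    unfolding L1_norm_def by (rule nn_integral_cong) (simp add: indicator_def)
  then show "(\<integral>\<^sup>+x. ennreal (norm (indicat_real S x *\<^sub>R u x)) \<partial>lebesgue) < \<infinity>"
    using assms(2) by simp
qed

lemma set_measurable_continuous_scaleR:
  fixes w :: "real^'n \<Rightarrow> 'b::{banach, second_countable_topology}"
  assumes S: "open S" and h: "continuous_on S h" and w: "set_integrable lebesgue S w"
  shows "(\<lambda>x. indicat_real S x *\<^sub>R (h x *\<^sub>R w x)) \<in> borel_measurable lebesgue"
proof -
  have "(\<lambda>x. indicat_real S x *\<^sub>R h x) \<in> borel_measurable borel"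
    using S by (intro borel_measurable_continuous_on_indicator h) auto
  then have "(\<lambda>x. indicat_real S x *\<^sub>R h x) \<in> borel_measurable lebesgue"
    by (intro measurable_completion) simp
  moreover have "(\<lambda>x. indicat_real S x *\<^sub>R w x) \<in> borel_measurable lebesgue"
    using w unfolding set_integrable_def by (rule borel_measurable_integrable)
  ultimately have "(\<lambda>x. (indicat_real S x *\<^sub>R h x) *\<^sub>R (indicat_real S x *\<^sub>R w x)) \<in> borel_measurable lebesgue"
    by (rule borel_measurable_scaleR)
  also have "(\<lambda>x. (indicat_real S x *\<^sub>R h x) *\<^sub>R (indicat_real S x *\<^sub>R w x))
      = (\<lambda>x. indicat_real S x *\<^sub>R (h x *\<^sub>R w x))"
    by (auto simp: indicator_def fun_eq_iff)
  finally show ?thesis .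
qed

lemma Ck_on_2D: "Ck_on 2 S f \<Longrightarrow> Ck_on 1 S (\<lambda>x. frechet_derivative f (at x) v)"
  unfolding Suc_1[symmetric] Ck_on.simps(2) by blast

lemma norm_sum_scaleR_le:
  fixes g :: "complex^'n" and X :: "real^'n"
  shows "norm (\<Sum>i\<in>UNIV. X $ i *\<^sub>R g $ i) \<le> norm X * norm g"
proof -
  have "norm (\<Sum>i\<in>UNIV. X $ i *\<^sub>R g $ i) \<le> (\<Sum>i\<in>UNIV. \<bar>X $ i\<bar> * \<bar>norm (g $ i)\<bar>)"
    by (rule sum_norm_le) simp
  also have "\<dots> \<le> L2_set (\<lambda>i. X $ i) UNIV * L2_set (\<lambda>i. norm (g $ i)) UNIV"
    by (rule L2_set_mult_ineq)
  also have "\<dots> = norm X * norm g"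
    by (simp add: norm_vec_def L2_set_def)
  finally show ?thesis .
qed

lemma transport_divergence_bound:
  fixes \<Omega> :: "(real^'n) set" and \<omega> :: "real^'n \<Rightarrow> real^'n"
  assumes \<Omega>: "open \<Omega>" and \<omega>: "Ck_on 1 \<Omega> \<omega>" "Ck_on 2 \<Omega> \<omega>"
    and W: "W11 \<Omega> (amplitude G f0 k)" and gap: "gap \<Omega> \<omega> k > 0"
  shows "weak_divergence_L1_norm \<Omega> (transport_field \<omega> G f0 k)
    \<le> weak_gradient_L1_norm \<Omega> (amplitude G f0 k) / gap \<Omega> \<omega> k
      + of_nat (CARD('n) + 2) * hess_bound \<Omega> \<omega> k / (gap \<Omega> \<omega> k)\<^sup>2 * L1_norm \<Omega> (amplitude G f0 k)"
proof (cases "\<Omega> = {}")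
  \<comment> \<open>Over the empty set \<open>gap\<close> is an infimum of no values, hence infinite
    and not of the form \<open>ennreal r\<close>. The zero function represents the divergence in
    this case.\<close>
  case True
  have "weak_divergence_L1_norm \<Omega> (transport_field \<omega> G f0 k) \<le> L1_norm \<Omega> (\<lambda>_. 0 :: complex)"
    unfolding weak_divergence_L1_norm_def
    by (rule INF_lower) (simp add: True is_weak_divergence_def locally_integrable_on_def
        set_integrable_def set_lebesgue_integral_def)
  also have "\<dots> = 0" by (simp add: L1_norm_def)
  finally show ?thesis by simp
next
  case False
  let ?a = "amplitude G f0 k"
  define p where "p = grad (phase \<omega> k)"
  have "gap \<Omega> \<omega> k < top"
    using False gap_pos(1)[OF gap] by (metis ennreal_less_top ex_in_conv le_less_trans)
  then obtain r where r: "gap \<Omega> \<omega> k = ennreal r" "r > 0"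
    using gap by (cases "gap \<Omega> \<omega> k") (auto simp: ennreal_eq_0_iff)
  have pr: "r \<le> norm (p x)" "p x \<noteq> 0" if "x \<in> \<Omega>" for x
    using gap_pos[OF gap that] r by (auto simp: p_def)
  \<comment> \<open>On \<open>\<Omega>\<close> the components of the phase gradient are
    \<open>rvec k\<close> paired with the directional derivatives \<open>w j\<close>. These are C1
    because the frequency map is C2, so \<open>Q j\<close> is the gradient of the
    \<open>j\<close>-th component.\<close>
  define w where "w j x = frechet_derivative \<omega> (at x) (axis j 1)" for j x
  define Q where "Q j x = (\<chi> l. rvec k \<bullet> frechet_derivative (w j) (at x) (axis l 1))" for j x
  have w1: "Ck_on 1 \<Omega> (w j)" for j
    using Ck_on_2D[OF \<omega>(2)] by (simp add: w_def[abs_def] del: Ck_on.simps)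
  have pj: "p x $ j = rvec k \<bullet> w j x" if "x \<in> \<Omega>" for x j
    using phase_gradient(1)[OF \<Omega> \<omega>(1) that] by (simp add: p_def w_def)
  have Qc: "continuous_on \<Omega> (Q j)" for j
    using inner_Ck_on_1_gradient(1)[OF \<Omega> w1 pj] by (simp add: Q_def[abs_def])
  have Qd: "((\<lambda>x. p x $ j) has_derivative (\<lambda>v. Q j x \<bullet> v)) (at x)" if "x \<in> \<Omega>" for x j
    using inner_Ck_on_1_gradient(2)[OF \<Omega> w1 pj that] by (simp add: Q_def)
  have pc: "continuous_on \<Omega> p" unfolding p_def by (rule phase_gradient(3)[OF \<Omega> \<omega>(1)])
  define L where "L x v = (\<chi> i. Q i x \<bullet> v)" for x v
  \<comment> \<open>Identifies the Jacobian with rows \<open>Q i\<close> as the Hessian map, so that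
    the operator norm in the divergence bound is the function whose essential supremum is
    \<open>hess_bound\<close>.\<close>
  have hess: "(*v) (hessian (phase \<omega> k) x) = L x" if "x \<in> \<Omega>" for x
  proof -
    have d: "(p has_derivative L x) (at x)"
    proof (rule has_derivative_componentwise_within[THEN iffD2], rule ballI)
      fix b :: "real^'n" assume "b \<in> Basis"
      then obtain i where "b = axis i 1" by (auto simp: Basis_vec_def)
      then show "((\<lambda>x. p x \<bullet> b) has_derivative (\<lambda>v. L x v \<bullet> b)) (at x)"
        using Qd[OF that, of i] by (simp add: inner_axis L_def)
    qed
    then have "hessian (phase \<omega> k) x = matrix (L x)"
      unfolding hessian_def p_def[symmetric] by (simp only: frechet_derivative_at[symmetric])
    moreover have "(\<lambda>v. matrix (L x) *v v) = L x"
      by (rule matrix_vector_mul(3)[OF has_derivative_bounded_linear[OF d]])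
    ultimately show ?thesis by simp
  qed
  define h where "h x = onorm ((*v) (hessian (phase \<omega> k) x))" for x
  define X where "X x = (\<chi> i. p x $ i / (norm (p x))\<^sup>2)" for x
  have Xd: "((\<lambda>x. X x $ i) has_derivative (\<lambda>v. inversion_gradient p Q i x \<bullet> v)) (at x)" if "x \<in> \<Omega>" for i x
    unfolding X_def using inversion_field_has_derivative[where p=p and Q=Q and x=x, OF Qd[OF that] pr(2)[OF that]] by simp
  have Ec: "continuous_on \<Omega> (inversion_gradient p Q i)" for i
    unfolding inversion_gradient_def using pr(2) by (intro continuous_intros pc Qc) auto
  have Xc: "continuous_on \<Omega> (\<lambda>x. X x $ i)" for i
    using Xd by (meson continuous_at_imp_continuous_on has_derivative_continuous)
  have tf: "transport_field \<omega> G f0 k = (\<lambda>x. \<chi> i. ?a x * complex_of_real (X x $ i))"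
    by (simp add: transport_field_def fun_eq_iff X_def p_def)
  have ai: "set_integrable lebesgue \<Omega> ?a" using W by (simp add: W11_def)
  have main: "weak_divergence_L1_norm \<Omega> (transport_field \<omega> G f0 k)
    \<le> L1_norm \<Omega> g / ennreal r + of_nat (CARD('n) + 2) * hess_bound \<Omega> \<omega> k / (ennreal r)\<^sup>2 * L1_norm \<Omega> ?a"
    (is "_ \<le> ?R") if g: "is_weak_gradient \<Omega> ?a g" "set_integrable lebesgue \<Omega> g" for g
  proof (cases "?R = top")
    \<comment> \<open>A finite right-hand side is what makes \<open>u\<close> integrable, and only
      integrable representatives compete in \<open>weak_divergence_L1_norm\<close>.\<close>
    case finite: False
    define u where "u x = (\<Sum>i\<in>UNIV. X x $ i *\<^sub>R g x $ i)
        + (\<Sum>i\<in>UNIV. inversion_gradient p Q i x $ i) *\<^sub>R ?a x" for x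
    have wd: "is_weak_divergence \<Omega> (transport_field \<omega> G f0 k) u"
      unfolding tf u_def by (rule weak_divergence_product[OF \<Omega> g(1) Xd Ec])
    have "L1_norm \<Omega> u \<le> ennreal (1 / r) * L1_norm \<Omega> g
        + ennreal (real (CARD('n) + 2) / r\<^sup>2) * Linf_norm \<Omega> h * L1_norm \<Omega> ?a"
    proof (rule L1_norm_le_weighted[OF \<Omega> g(2) ai])
      fix x assume x: "x \<in> \<Omega>"
      have np: "norm (p x) > 0" using pr(2)[OF x] by simp
      have h0: "h x \<ge> 0" unfolding h_def by (intro onorm_pos_le) simp
      have "norm (X x) = 1 / norm (p x)"
      proof -
        have "X x = (1 / (norm (p x))\<^sup>2) *\<^sub>R p x" by (simp add: X_def vec_eq_iff)
        then show ?thesis using np by (simp add: power2_eq_square)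
      qed
      also have "\<dots> \<le> 1 / r" using pr(1)[OF x] r(2) np by (intro divide_left_mono mult_pos_pos) auto
      finally have 1: "norm (\<Sum>i\<in>UNIV. X x $ i *\<^sub>R g x $ i) \<le> 1 / r * norm (g x)"
        using norm_sum_scaleR_le[of "X x" "g x"] by (meson mult_right_mono norm_ge_zero order_trans)
      have "\<bar>\<Sum>i\<in>UNIV. inversion_gradient p Q i x $ i\<bar> \<le> real (CARD('n) + 2) * h x / (norm (p x))\<^sup>2"
        using inversion_divergence_bound[of p x Q] pr(2)[OF x]
        unfolding h_def hess[OF x] by (simp add: L_def[abs_def])
      also have "\<dots> \<le> real (CARD('n) + 2) * h x / r\<^sup>2"
        using pr(1)[OF x] r(2) np h0 by (intro divide_left_mono power_mono mult_nonneg_nonneg mult_pos_pos zero_less_power) auto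
      finally have "\<bar>\<Sum>i\<in>UNIV. inversion_gradient p Q i x $ i\<bar> \<le> real (CARD('n) + 2) * h x / r\<^sup>2" .
      from mult_right_mono[OF this norm_ge_zero[of "?a x"]]
      have 2: "norm ((\<Sum>i\<in>UNIV. inversion_gradient p Q i x $ i) *\<^sub>R ?a x)
          \<le> real (CARD('n) + 2) * h x / r\<^sup>2 * norm (?a x)"
        by simp
      have "norm (u x) \<le> 1 / r * norm (g x) + real (CARD('n) + 2) / r\<^sup>2 * \<bar>h x\<bar> * norm (?a x)"
        unfolding u_def using norm_triangle_mono[OF 1 2] h0 by simp
      then have "ennreal (norm (u x))
          \<le> ennreal (1 / r * norm (g x) + real (CARD('n) + 2) / r\<^sup>2 * \<bar>h x\<bar> * norm (?a x))"
        by (rule ennreal_leI)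
      also have "\<dots> = ennreal (1 / r) * ennreal (norm (g x))
          + ennreal (real (CARD('n) + 2) / r\<^sup>2) * ennreal \<bar>h x\<bar> * ennreal (norm (?a x))"
        using r(2) by (simp add: ennreal_plus mult.assoc flip: ennreal_mult del: of_nat_add)
      finally show "ennreal (norm (u x)) \<le> ennreal (1 / r) * ennreal (norm (g x))
          + ennreal (real (CARD('n) + 2) / r\<^sup>2) * ennreal \<bar>h x\<bar> * ennreal (norm (?a x))" .
    qed
    also have "\<dots> = ?R"
    proof -
      have "ennreal (1 / r) * y = y / ennreal r" for y
        using r(2) by (simp add: divide_ennreal_def inverse_ennreal inverse_eq_divide mult.commute)
      moreover have "ennreal (real (CARD('n) + 2) / r\<^sup>2) * y = of_nat (CARD('n) + 2) * y / (ennreal r)\<^sup>2" for y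
      proof -
        have "ennreal (real m / r\<^sup>2) = of_nat m / (ennreal r)\<^sup>2" for m
          using r(2) by (simp add: ennreal_power ennreal_of_nat_eq_real_of_nat divide_ennreal)
        from this[of "CARD('n) + 2"] show ?thesis
          by (simp only: divide_ennreal_def ac_simps)
      qed
      ultimately show ?thesis by (simp add: hess_bound_def h_def[abs_def])
    qed
    finally have le: "L1_norm \<Omega> u \<le> ?R" .
    have "(\<lambda>x. \<Sum>i\<in>UNIV. indicat_real \<Omega> x *\<^sub>R (X x $ i *\<^sub>R g x $ i)) \<in> borel_measurable lebesgue"
      by (intro borel_measurable_sum set_measurable_continuous_scaleR[OF \<Omega> Xc] set_integrable_vec_nth g)
    moreover have "(\<lambda>x. indicat_real \<Omega> x *\<^sub>R ((\<Sum>i\<in>UNIV. inversion_gradient p Q i x $ i) *\<^sub>R ?a x))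
        \<in> borel_measurable lebesgue"
      by (intro set_measurable_continuous_scaleR[OF \<Omega> _ ai] continuous_intros Ec)
    ultimately have "(\<lambda>x. (\<Sum>i\<in>UNIV. indicat_real \<Omega> x *\<^sub>R (X x $ i *\<^sub>R g x $ i))
        + indicat_real \<Omega> x *\<^sub>R ((\<Sum>i\<in>UNIV. inversion_gradient p Q i x $ i) *\<^sub>R ?a x))
        \<in> borel_measurable lebesgue" by (rule borel_measurable_add)
    then have "(\<lambda>x. indicat_real \<Omega> x *\<^sub>R u x) \<in> borel_measurable lebesgue"
      by (simp only: u_def scaleR_right_distrib scaleR_sum_right)
    then have ui: "set_integrable lebesgue \<Omega> u"
      using le finite by (intro set_integrable_if_L1_norm_finite) (auto simp: less_top[symmetric] top_unique)
    have "weak_divergence_L1_norm \<Omega> (transport_field \<omega> G f0 k) \<le> L1_norm \<Omega> u"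
      unfolding weak_divergence_L1_norm_def using wd ui by (intro INF_lower) simp
    then show ?thesis using le by (rule order_trans)
  qed (metis top_greatest)
  show ?thesis
    unfolding r(1) weak_gradient_L1_norm_def
    by (rule ennreal_le_INF_divide_add[OF r(2)]) (use main in auto)
qed

section \<open>The time-average estimate and the explicit bound on its constant\<close>

theorem proposition3p1:
  fixes \<Omega> :: "(real^'n) set"
    and \<omega> :: "real^'n \<Rightarrow> real^'n"
    and f0 :: "(real^'n) \<times> (real^'n) \<Rightarrow> real"
    and G :: "(real^'n) \<times> (real^'n) \<Rightarrow> complex"
    and K :: real
  assumes "open \<Omega>"
    and "Ck_on 1 \<Omega> \<omega>"
    and "C1c_torus \<Omega> f0"
    and "\<forall>I\<in>\<Omega>. \<forall>\<theta>. f0 (I, \<theta>) \<ge> 0"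
    and "C_torus \<Omega> G"
    and "K \<ge> 1"
    and "\<forall>k. 0 < l1 k \<and> real_of_int (l1 k) \<le> K \<longrightarrow>
           W11 \<Omega> (amplitude G f0 k) \<and> gap \<Omega> \<omega> k > 0"
  shows "(\<forall>t. t \<noteq> 0 \<longrightarrow>
           ennreal (cmod (time_average \<Omega> \<omega> f0 G t - initial_average \<Omega> f0 (angle_average G)))
             \<le> C_G \<Omega> \<omega> G f0 K / ennreal \<bar>t\<bar> + tail \<Omega> G f0 K)
       \<and> (Ck_on 2 \<Omega> \<omega> \<longrightarrow>
           C_G \<Omega> \<omega> G f0 K \<le> ennreal ((2 * pi) ^ CARD('n)) *
             (\<Sum>k\<in>low_modes K.
                weak_gradient_L1_norm \<Omega> (amplitude G f0 k) / gap \<Omega> \<omega> k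
                + of_nat (CARD('n) + 2) * hess_bound \<Omega> \<omega> k / (gap \<Omega> \<omega> k)\<^sup>2
                    * L1_norm \<Omega> (amplitude G f0 k)))"
proof (intro conjI allI impI)
  have K: "W11 \<Omega> (amplitude G f0 k)" "gap \<Omega> \<omega> k > 0" if "k \<in> low_modes K" for k
    using assms(7) that by (auto simp: low_modes_def)
  {
    fix t :: real assume t: "t \<noteq> 0"
    let ?N = "ennreal ((2 * pi) ^ CARD('n))"
    obtain C where C: "compact C" "C \<subseteq> \<Omega>" "\<And>k I. I \<in> \<Omega> - C \<Longrightarrow> amplitude G f0 k I = 0"
      using amplitude_properties(2)[OF assms(3,5)] by blast
    have mode: "ennreal (cmod (LINT I:\<Omega>|lebesgue. amplitude G f0 k I
          * exp (\<i> * complex_of_real (t * phase \<omega> k I))))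
        \<le> weak_divergence_L1_norm \<Omega> (transport_field \<omega> G f0 k) / ennreal \<bar>t\<bar>"
      if k: "k \<in> low_modes K" for k
    proof (rule ennreal_le_divideI)
      show "\<bar>t\<bar> > 0" using t by simp
      have al: "locally_integrable_on \<Omega> (amplitude G f0 k)"
        using K(1)[OF k] by (auto simp: W11_def is_weak_gradient_def)
      show "ennreal \<bar>t\<bar> * ennreal (cmod (LINT I:\<Omega>|lebesgue. amplitude G f0 k I
          * exp (\<i> * complex_of_real (t * phase \<omega> k I))))
        \<le> weak_divergence_L1_norm \<Omega> (transport_field \<omega> G f0 k)"
        unfolding weak_divergence_L1_norm_def
      proof (rule INF_greatest)
        \<comment> \<open>The oscillatory bound holds for every integrable representative. If there
          is none, the infimum is infinite and the mode estimate is trivial.\<close>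
        fix u assume "u \<in> {u. is_weak_divergence \<Omega> (transport_field \<omega> G f0 k) u \<and> set_integrable lebesgue \<Omega> u}"
        then have u: "is_weak_divergence \<Omega> (transport_field \<omega> G f0 k) u" "set_integrable lebesgue \<Omega> u"
          by auto
        show "ennreal \<bar>t\<bar> * ennreal (cmod (LINT I:\<Omega>|lebesgue. amplitude G f0 k I
            * exp (\<i> * complex_of_real (t * phase \<omega> k I)))) \<le> L1_norm \<Omega> u"
          by (rule oscillatory_integral_bound[OF assms(1) phase_gradient(2,3)[OF assms(1,2)]
                gap_pos(2)[OF K(2)[OF k]] al C _ u])
            (simp_all add: transport_field_def)
      qed
    qed
    have "ennreal (cmod (time_average \<Omega> \<omega> f0 G t - initial_average \<Omega> f0 (angle_average G)))
        \<le> ?N * (\<Sum>k\<in>low_modes K. ennreal (cmod (LINT I:\<Omega>|lebesgue. amplitude G f0 k I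
            * exp (\<i> * complex_of_real (t * phase \<omega> k I))))) + tail \<Omega> G f0 K"
      by (rule averages_difference_bound[OF assms(1) Ck_on_1D(3)[OF assms(2)] assms(3,5,6)])
    also have "\<dots> \<le> ?N * (\<Sum>k\<in>low_modes K.
        weak_divergence_L1_norm \<Omega> (transport_field \<omega> G f0 k) / ennreal \<bar>t\<bar>) + tail \<Omega> G f0 K"
      by (intro add_right_mono mult_left_mono sum_mono mode) auto
    also have "\<dots> = C_G \<Omega> \<omega> G f0 K / ennreal \<bar>t\<bar> + tail \<Omega> G f0 K"
      unfolding C_G_def divide_ennreal_def sum_distrib_right[symmetric] by (simp add: mult.assoc)
    finally show "ennreal (cmod (time_average \<Omega> \<omega> f0 G t - initial_average \<Omega> f0 (angle_average G)))
        \<le> C_G \<Omega> \<omega> G f0 K / ennreal \<bar>t\<bar> + tail \<Omega> G f0 K" .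
  }
  assume "Ck_on 2 \<Omega> \<omega>"
  then show "C_G \<Omega> \<omega> G f0 K \<le> ennreal ((2 * pi) ^ CARD('n)) *
      (\<Sum>k\<in>low_modes K.
         weak_gradient_L1_norm \<Omega> (amplitude G f0 k) / gap \<Omega> \<omega> k
         + of_nat (CARD('n) + 2) * hess_bound \<Omega> \<omega> k / (gap \<Omega> \<omega> k)\<^sup>2
             * L1_norm \<Omega> (amplitude G f0 k))"
    unfolding C_G_def
    by (intro mult_left_mono sum_mono transport_divergence_bound[OF assms(1,2)] K) auto
qed

end
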